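(* Let $R,S\in\mathbb{N}=\{1,2,\dots\}$ with $R\neq S$, let $a,b\in\mathbb{C}\setminus\{0\}$, and let $v(x)=a e^{-2iRx}+b e^{2iSx}$. Then there is no basis in $L^2([0,\pi],\mathbb{C})$ consisting of root functions of the operator $L_{Per^+}(v)$. If $R$ and $S$ are both odd, then there is also no basis in $L^2([0,\pi],\mathbb{C})$ consisting of root functions of $L_{Per^-}(v)$.
   Context: For a smooth $\pi$-periodic complex-valued potential $v$, $L_{Per^\pm}(v)$ denotes the Hill operator $Ly=-y''+v(x)y$, $0\le x\le\pi$, acting in $L^2([0,\pi],\mathbb{C})$ on the domain of all $y\in H^2([0,\pi])$ satisfying the periodic ($Per^+$) or antiperiodic ($Per^-$) boundary conditions $y(\pi)=\pm y(0)$, $y'(\pi)=\pm y'(0)$. The spectrum is discrete. Root functions are eigenfunctions and associated functions, i.e. nonzero elements of $\bigcup_{k\ge1}\ker (L-\lambda)^k$ for eigenvalues $\lambda$. "Basis" means a (Schauder) basis of the Hilbert space. *)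

theory Defs
  imports "HOL-Analysis.Analysis"
begin

text \<open>
  Elements of \<open>L\<^sup>2([0,\<pi>],\<complex>)\<close> are represented by functions \<open>real \<Rightarrow> complex\<close>, of which
  only the values on \<open>[0,\<pi>]\<close> matter. Equality in \<open>L\<^sup>2\<close> is always spelled out
  as equality almost everywhere on \<open>[0,\<pi>]\<close>.
\<close>

abbreviation leb_pi :: "real measure" where
  "leb_pi \<equiv> lebesgue_on {0..pi}"

definition L2_pi :: "(real \<Rightarrow> complex) set" where
  "L2_pi = {f. f \<in> borel_measurable leb_pi \<and> integrable leb_pi (\<lambda>x. (cmod (f x))\<^sup>2)}"

definition L2_norm_pi :: "(real \<Rightarrow> complex) \<Rightarrow> real" where
  "L2_norm_pi f = sqrt (LINT x|leb_pi. (cmod (f x))\<^sup>2)"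

text \<open>
  \<open>H2_derivs u u1 u2\<close>: \<open>u\<close> is the \<open>C\<^sup>1\<close> representative of an element of \<open>H\<^sup>2([0,\<pi>])\<close>,
  with \<open>u1 = u'\<close> absolutely continuous and \<open>u2\<close> a representative of \<open>u'' \<in> L\<^sup>2\<close>.
  Derivatives at the end points are one-sided.
\<close>

definition H2_derivs :: "(real \<Rightarrow> complex) \<Rightarrow> (real \<Rightarrow> complex) \<Rightarrow> (real \<Rightarrow> complex) \<Rightarrow> bool" where
  "H2_derivs u u1 u2 \<longleftrightarrow>
     u2 \<in> L2_pi \<and>
     (\<forall>x\<in>{0..pi}. (u has_vector_derivative u1 x) (at x within {0..pi})) \<and>
     (\<forall>x\<in>{0..pi}. (u2 has_integral (u1 x - u1 0)) {0..x})"

text \<open>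
  Unbounded operators in \<open>L\<^sup>2\<close> are given by their graphs. \<open>hill_op \<sigma> v y g\<close> says that
  (the class of) \<open>y\<close> lies in the domain of \<open>Ly = -y'' + v y\<close> with boundary conditions
  \<open>y(\<pi>) = \<sigma> y(0)\<close>, \<open>y'(\<pi>) = \<sigma> y'(0)\<close>, and that \<open>Ly = g\<close> in \<open>L\<^sup>2\<close>.
\<close>

definition hill_op ::
  "complex \<Rightarrow> (real \<Rightarrow> complex) \<Rightarrow> (real \<Rightarrow> complex) \<Rightarrow> (real \<Rightarrow> complex) \<Rightarrow> bool" where
  "hill_op \<sigma> v y g \<longleftrightarrow>
     y \<in> L2_pi \<and> g \<in> L2_pi \<and>
     (\<exists>u u1 u2. H2_derivs u u1 u2 \<and>
        u pi = \<sigma> * u 0 \<and> u1 pi = \<sigma> * u1 0 \<and>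
        (AE x in leb_pi. y x = u x) \<and>
        (AE x in leb_pi. g x = - u2 x + v x * u x))"

abbreviation hill_per_plus :: "(real \<Rightarrow> complex) \<Rightarrow> (real \<Rightarrow> complex) \<Rightarrow> (real \<Rightarrow> complex) \<Rightarrow> bool" where
  "hill_per_plus \<equiv> hill_op 1"

abbreviation hill_per_minus :: "(real \<Rightarrow> complex) \<Rightarrow> (real \<Rightarrow> complex) \<Rightarrow> (real \<Rightarrow> complex) \<Rightarrow> bool" where
  "hill_per_minus \<equiv> hill_op (-1)"

text \<open>
  \<open>in_ker_pow L \<mu> k y\<close> is \<open>y \<in> ker (L - \<mu>)\<^sup>k\<close>, with the natural domain of the power: each
  \<open>(L - \<mu>)\<^sup>j y\<close>, \<open>j < k\<close>, has to lie in the domain of \<open>L\<close>.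
\<close>

fun in_ker_pow ::
  "((real \<Rightarrow> complex) \<Rightarrow> (real \<Rightarrow> complex) \<Rightarrow> bool) \<Rightarrow> complex \<Rightarrow> nat \<Rightarrow> (real \<Rightarrow> complex) \<Rightarrow> bool" where
  "in_ker_pow L \<mu> 0 y \<longleftrightarrow> y \<in> L2_pi \<and> (AE x in leb_pi. y x = 0)"
| "in_ker_pow L \<mu> (Suc k) y \<longleftrightarrow> (\<exists>g. L y g \<and> in_ker_pow L \<mu> k (\<lambda>x. g x - \<mu> * y x))"

definition is_eigenvalue ::
  "((real \<Rightarrow> complex) \<Rightarrow> (real \<Rightarrow> complex) \<Rightarrow> bool) \<Rightarrow> complex \<Rightarrow> bool" where
  "is_eigenvalue L \<mu> \<longleftrightarrow> (\<exists>y. L y (\<lambda>x. \<mu> * y x) \<and> \<not> (AE x in leb_pi. y x = 0))"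

definition root_function ::
  "((real \<Rightarrow> complex) \<Rightarrow> (real \<Rightarrow> complex) \<Rightarrow> bool) \<Rightarrow> (real \<Rightarrow> complex) \<Rightarrow> bool" where
  "root_function L y \<longleftrightarrow>
     \<not> (AE x in leb_pi. y x = 0) \<and>
     (\<exists>\<mu> k. is_eigenvalue L \<mu> \<and> k \<ge> 1 \<and> in_ker_pow L \<mu> k y)"

definition schauder_basis_L2 :: "(nat \<Rightarrow> real \<Rightarrow> complex) \<Rightarrow> bool" where
  "schauder_basis_L2 e \<longleftrightarrow>
     (\<forall>n. e n \<in> L2_pi) \<and>
     (\<forall>f\<in>L2_pi. \<exists>!c :: nat \<Rightarrow> complex.
        (\<lambda>N. L2_norm_pi (\<lambda>x. f x - (\<Sum>n<N. c n * e n x))) \<longlonglongrightarrow> 0)"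

end

theory Submission
  imports Defs
begin

text \<open>
  For \<open>n = R S j\<close> write \<open>\<lambda> = n\<^sup>2 + z\<close> and let \<open>y k\<close> be the Fourier coefficient at frequency
  \<open>2 k - n\<close>. The eigenvalue equation becomes
  \<open>(4 k (n - k) + z) y k = a y (k + R) + b y (k - S)\<close>, whose resonant indices are \<open>0\<close> and \<open>n\<close>.
  Eliminating the other indices leaves \<open>(z - \<alpha>(z))\<^sup>2 = \<beta>\<^sup>+(z) \<beta>\<^sup>-(z)\<close>, where \<open>\<beta>\<^sup>+\<close> and \<open>\<beta>\<^sup>-\<close> are
  dominated by the direct paths of \<open>n/S\<close> steps up and \<open>n/R\<close> steps down. These are nonzero
  and, since \<open>R \<noteq> S\<close>, of superexponentially different size. Hence there are simple
  eigenvalues whose eigenfunctions \<open>Y\<close> are uniformly close to a single exponential, so that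
  \<open>\<integral> Y\<^sup>2\<close> is nonzero but tends to \<open>0\<close>. A basis of root functions contains a multiple of each such \<open>Y\<close>,
  and its coordinate functional is \<open>f \<mapsto> \<integral> f Y / \<integral> Y\<^sup>2\<close>: for a suitable \<open>f\<close> the terms of the expansion
  are unbounded.
\<close>

section \<open>The recurrence for Fourier coefficients\<close>

text \<open>Multiples of \<open>R * S\<close> are taken so that a direct path exists in both
  directions between the resonant indices. The obstacle is the size of \<open>beta\<close>: it
  decays superexponentially, so norm estimates for the Neumann series, which gain only powers of
  \<open>1 / n\<close> at each order, say nothing about it. Everything off-diagonal is therefore
  measured relative to its leading path, through a supersolution \<open>H\<close> that matches the
  path weights up to bounded factors. The product \<open>H k * H (n - k)\<close> is then at most of
  the size of one full path; this is what makes the quadratic terms in the integral of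
  \<open>Y * Y\<close> small against the cross term, of size \<open>2 * \<rho>\<close>. The
  reflection \<open>k \<mapsto> n - k\<close> exchanges \<open>(R, a)\<close> with
  \<open>(S, b)\<close>, so each estimate serves both directions. On the operator side only two
  facts about a mode enter: pairing with \<open>Y\<close> turns the operator into multiplication by
  \<open>lam\<close>, and bounded solutions of the recurrence are unique up to scale. Localisation
  of the spectrum and completeness of the root functions play no part.\<close>

abbreviation abs_summable :: "(int \<Rightarrow> complex) \<Rightarrow> bool" where
  "abs_summable y \<equiv> (\<lambda>k. cmod (y k)) summable_on UNIV"

abbreviation self_conv :: "nat \<Rightarrow> (int \<Rightarrow> complex) \<Rightarrow> complex" where
  "self_conv n y \<equiv> (\<Sum>\<^sub>\<infinity>k. y k * y (int n - k))"

abbreviation gap :: "nat \<Rightarrow> int \<Rightarrow> real" where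
  "gap n k \<equiv> \<bar>real_of_int k\<bar> * \<bar>real_of_int (int n - k)\<bar>"

definition recip_sum :: "nat \<Rightarrow> real" where
  "recip_sum n = (\<Sum>\<^sub>\<infinity>k\<in>-{0, int n}. 1 / gap n k)"

section \<open>Decay of the reciprocal gap sums\<close>

lemma summable_on_int_powr:
  "(\<lambda>k::int. \<bar>of_int k\<bar> powr (-3/2) :: real) summable_on UNIV"
proof -
  have "summable (\<lambda>n. real n powr (-3/2))"
    by (subst summable_real_powr_iff) auto
  then have s: "(\<lambda>n. real n powr (-3/2)) summable_on UNIV"
    by (subst summable_on_UNIV_nonneg_real_iff) auto
  have 1: "(\<lambda>k::int. \<bar>of_int k\<bar> powr (-3/2) :: real) summable_on range int"
    by (subst summable_on_reindex) (use s in \<open>auto simp: o_def\<close>)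
  have 2: "(\<lambda>k::int. \<bar>of_int k\<bar> powr (-3/2) :: real) summable_on range (\<lambda>n. - int n)"
    by (subst summable_on_reindex) (use s in \<open>auto simp: o_def inj_on_def\<close>)
  have "(\<lambda>k::int. \<bar>of_int k\<bar> powr (-3/2) :: real) summable_on (range int \<union> range (\<lambda>n. - int n))"
    by (rule summable_on_union[OF 1 2])
  moreover have "range int \<union> range (\<lambda>n. - int n) = UNIV"
  proof -
    have "x \<in> range int \<union> range (\<lambda>n. - int n)" for x :: int
      by (cases "x \<ge> 0") (auto intro: range_eqI[of _ _ "nat x"] range_eqI[of _ _ "nat (-x)"])
    then show ?thesis by blast
  qed
  ultimately show ?thesis by simp
qed

text \<open>Twice the zeta value at 3/2: both signs are summed, and \<open>0 powr (-3/2)\<close> is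
  0 by convention.\<close>

definition zeta_3_2 :: real where
  "zeta_3_2 = (\<Sum>\<^sub>\<infinity>k::int. \<bar>of_int k\<bar> powr (-3/2))"

text \<open>The larger factor is at least \<open>n / 2\<close> and at least the smaller one, so its
  reciprocal is at most \<open>sqrt (2 / n)\<close> times the inverse square root of the smaller
  one. This gives up the true order \<open>ln n / n\<close> of \<open>recip_sum\<close> in return
  for a majorant that is summable term by term.\<close>

lemma recip_le_powr:
  fixes x y n :: real
  assumes "x > 0" "y > 0" "x + y \<ge> n" "n > 0"
  shows "1 / (x * y) \<le> sqrt (2 / n) * (x powr (-3/2) + y powr (-3/2))"
proof -
  have *: "1 / (x * y) \<le> sqrt (2 / n) * x powr (-3/2)" if "x > 0" "y \<ge> x" "x + y \<ge> n" for x y :: real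
  proof -
    have y: "y \<ge> n / 2" "y > 0" using that by auto
    have "1 / y = 1 / (sqrt y * sqrt y)" using y by simp
    also have "\<dots> \<le> 1 / (sqrt (n / 2) * sqrt x)"
      using that y assms by (intro divide_left_mono mult_mono) auto
    also have "\<dots> = sqrt (2 / n) * (1 / sqrt x)"
      by (simp add: real_sqrt_divide)
    finally have "1 / (x * y) \<le> sqrt (2 / n) * (1 / sqrt x) / x"
      using that by (simp add: divide_simps mult.commute)
    also have "sqrt (2 / n) * (1 / sqrt x) / x = sqrt (2 / n) * ((1 / sqrt x) / x)" by simp
    also have "(1 / sqrt x) / x = x powr (-3/2)"
    proof -
      have "x powr (-3/2) = x powr (- (1 / 2)) * x powr (-1)"
        unfolding powr_add[symmetric] by simp
      also have "\<dots> = (1 / sqrt x) / x"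
        using that unfolding powr_minus by (simp add: powr_half_sqrt divide_simps)
      finally show ?thesis by simp
    qed
    finally show ?thesis .
  qed
  have nn: "sqrt (2 / n) * t powr (-3/2) \<ge> 0" for t using assms by simp
  show ?thesis
  proof (cases "x \<le> y")
    case True
    then show ?thesis using *[of x y] nn[of y] assms unfolding distrib_left by linarith
  next
    case False
    then show ?thesis using *[of y x] nn[of x] assms unfolding distrib_left mult.commute[of x y] by linarith
  qed
qed

lemma recip_summable:
  assumes "n > 0"
  shows "(\<lambda>k. 1 / gap n k :: real) summable_on -{0, int n}" (is "?f summable_on ?A")
    and "recip_sum n \<le> 2 * sqrt (2 / n) * zeta_3_2"
    and "0 \<le> recip_sum n"
proof -
  let ?p = "\<lambda>k::int. \<bar>of_int k\<bar> powr (-3/2) :: real"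
  have bij: "bij (\<lambda>k. int n - k)"
    by (rule bij_betw_byWitness[of _ "\<lambda>k. int n - k"]) auto
  have s2: "(\<lambda>k. ?p (int n - k)) summable_on UNIV"
    using summable_on_reindex_bij_betw[OF bij, of ?p] summable_on_int_powr by simp
  have i2: "infsum (\<lambda>k. ?p (int n - k)) UNIV = zeta_3_2"
    using infsum_reindex_bij_betw[OF bij, of ?p] by (simp add: zeta_3_2_def)
  let ?g = "\<lambda>k. sqrt (2 / n) * (?p k + ?p (int n - k))"
  have sg: "?g summable_on UNIV"
    by (intro summable_on_cmult_right summable_on_add summable_on_int_powr s2)
  have le: "?f k \<le> ?g k" if "k \<in> ?A" for k
    using that assms by (intro recip_le_powr) auto
  show s: "?f summable_on ?A"
    by (rule summable_on_comparison_test[OF summable_on_subset_banach[OF sg]]) (use le in auto)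
  have "recip_sum n \<le> infsum ?g UNIV"
    unfolding recip_sum_def
    by (rule infsum_mono_neutral[OF s sg]) (use le assms in auto)
  also have "infsum ?g UNIV = sqrt (2 / n) * (zeta_3_2 + zeta_3_2)"
    by (subst infsum_cmult_right', subst infsum_add[OF summable_on_int_powr s2]) (simp only: i2, simp add: zeta_3_2_def)
  finally show "recip_sum n \<le> 2 * sqrt (2 / n) * zeta_3_2" by simp
  show "0 \<le> recip_sum n" unfolding recip_sum_def by (intro infsum_nonneg) auto
qed

lemma recip_sum_tendsto: "recip_sum \<longlonglongrightarrow> 0"
proof (rule tendsto_sandwich[where f="\<lambda>_. 0"])
  show "\<forall>\<^sub>F n in sequentially. 0 \<le> recip_sum n"
    using eventually_gt_at_top[of 0] by eventually_elim (rule recip_summable)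
  show "\<forall>\<^sub>F n in sequentially. recip_sum n \<le> 2 * sqrt (2 / n) * zeta_3_2"
    using eventually_gt_at_top[of 0] by eventually_elim (rule recip_summable)
  have "(\<lambda>n. 2 / real n) \<longlonglongrightarrow> 0"
    by (rule real_tendsto_divide_at_top[OF tendsto_const filterlim_real_sequentially])
  then have "(\<lambda>n. 2 * sqrt (2 / real n) * zeta_3_2) \<longlonglongrightarrow> 2 * sqrt 0 * zeta_3_2"
    by (intro tendsto_intros)
  then show "(\<lambda>n. 2 * sqrt (2 / real n) * zeta_3_2) \<longlonglongrightarrow> 0" by simp
qed auto

text \<open>All four numerical assumptions hold for large multiples of \<open>R * S\<close>, since
  \<open>recip_sum\<close> tends to 0. The linear ones control single steps of the recurrence,
  \<open>n_big2\<close> the quantities quadratic in the coefficients, and \<open>pair_small\<close>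
  the self-pairing in \<open>Q_le\<close>.\<close>

locale hill_seq =
  fixes R S n :: nat and a b :: complex
  assumes R_pos: "R \<ge> 1" and S_pos: "S \<ge> 1"
    and a_nz: "a \<noteq> 0" and b_nz: "b \<noteq> 0"
    and R_dvd: "R dvd n" and S_dvd: "S dvd n"
    and n_big: "64 * (real R + real S) * (1 + cmod a + cmod b) \<le> real n"
    and recip_small: "64 * (real R + real S) * (1 + cmod a + cmod b) * recip_sum n \<le> 1"
    and n_big2: "64 * (1 + cmod a + cmod b)\<^sup>2 \<le> real n"
    and pair_small: "16 * real S * (cmod a + cmod b) * sqrt (3 * cmod a / cmod b) * recip_sum n \<le> 1"
begin

text \<open>The spectral parameter \<open>n^2 + z\<close> minus the squared frequency
  \<open>(2 * k - n)^2\<close>.\<close>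

definition D :: "complex \<Rightarrow> int \<Rightarrow> complex" where
  "D z k = 4 * of_int k * of_int (int n - k) + z"

lemma pos_facts:
  "real S \<ge> 1" "real R \<ge> 1" "cmod a \<ge> 0" "cmod b \<ge> 0" "real S * cmod a \<ge> 0" "real S * cmod b \<ge> 0"
  using S_pos R_pos by auto

text \<open>The constant of \<open>n_big\<close> multiplied out, with \<open>R * cmod a\<close> and
  \<open>R * cmod b\<close> weakened to \<open>cmod a\<close> and \<open>cmod b\<close>, so that the
  constants needed later can be compared with it term by term.\<close>

abbreviation budget :: real where
  "budget \<equiv> 64 * (real R + real S + cmod a + cmod b + real S * cmod a + real S * cmod b)"

lemma budget_le: "budget \<le> 64 * (real R + real S) * (1 + cmod a + cmod b)"
proof -
  have "real R * cmod a \<ge> cmod a" "real R * cmod b \<ge> cmod b"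
    using R_pos by (simp_all add: mult_le_cancel_right1)
  then show ?thesis by (simp add: algebra_simps)
qed

lemma n_bounds:
  shows "real n \<ge> 64 * (real S * cmod a)" "real n \<ge> 64 * (real S * cmod b)"
    "real n \<ge> 64 * cmod a + 64 * cmod b + 128" "n > R" "n > S" "n \<ge> 128" "n > R + S" "n \<ge> 64 * S"
proof -
  have *: "budget \<le> real n" using budget_le n_big by linarith
  with pos_facts show "real n \<ge> 64 * (real S * cmod a)" "real n \<ge> 64 * (real S * cmod b)"
    "real n \<ge> 64 * cmod a + 64 * cmod b + 128"
    by argo+
  have "real n \<ge> 64 * (real R + real S)" using * pos_facts by argo
  then have "real n \<ge> 64 * real (R + S)" by simp
  then have "n \<ge> 64 * (R + S)" by linarith
  then show "n > R" "n > S" "n \<ge> 128" "n > R + S" "n \<ge> 64 * S" using R_pos S_pos by auto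
qed

lemmas norms_nonneg = norm_ge_zero[of a] norm_ge_zero[of b]

section \<open>Invertibility of the equations away from the resonant indices\<close>

lemma abs_prod_ge:
  assumes "k \<noteq> 0" "k \<noteq> int n"
  shows "gap n k \<ge> real n - 1"
proof -
  have "\<bar>k\<bar> * \<bar>int n - k\<bar> \<ge> \<bar>k\<bar> + \<bar>int n - k\<bar> - 1"
  proof -
    have "(\<bar>k\<bar> - 1) * (\<bar>int n - k\<bar> - 1) \<ge> 0" using assms by (intro mult_nonneg_nonneg) auto
    then show ?thesis by (simp add: algebra_simps)
  qed
  moreover have "\<bar>k\<bar> + \<bar>int n - k\<bar> \<ge> int n" by arith
  ultimately have "\<bar>k\<bar> * \<bar>int n - k\<bar> \<ge> int n - 1" by linarith
  then have "real_of_int (\<bar>k\<bar> * \<bar>int n - k\<bar>) \<ge> real_of_int (int n - 1)" by (simp only: of_int_le_iff)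
  then show ?thesis by simp
qed

lemma norm_D_ge:
  assumes "k \<noteq> 0" "k \<noteq> int n" "cmod z \<le> 1"
  shows "cmod (D z k) \<ge> 4 * gap n k - 1"
    and "cmod (D z k) \<ge> 3 * gap n k"
    and "cmod (D z k) \<ge> 3 * (real n - 1)"
    and "cmod (D z k) > 0" "D z k \<noteq> 0"
proof -
  have "cmod (4 * of_int k * of_int (int n - k)) - cmod z \<le> cmod (D z k)"
    unfolding D_def by (metis norm_diff_ineq)
  moreover have "cmod (4 * of_int k * of_int (int n - k)) = 4 * gap n k"
    by (simp only: norm_mult norm_of_int norm_numeral mult.assoc)
  ultimately show 1: "cmod (D z k) \<ge> 4 * gap n k - 1"
    using assms by linarith
  then show "cmod (D z k) \<ge> 3 * gap n k"
    "cmod (D z k) \<ge> 3 * (real n - 1)" "cmod (D z k) > 0" "D z k \<noteq> 0"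
    using abs_prod_ge[OF assms(1,2)] n_bounds(6) by auto
qed

text \<open>The denominators are at least \<open>2 * (1 + cmod a + cmod b)\<close>, so the supremum
  \<open>X\<close> of \<open>cmod (x k)\<close>, finite by boundedness though perhaps not attained,
  satisfies \<open>X \<le> \<delta> / 2 + X / 2\<close>. With \<open>\<delta> = 0\<close> this gives
  uniqueness for given resonant values, with \<open>\<delta> = cmod (z - w)\<close> the dependence
  on \<open>z\<close>.\<close>

lemma a_priori:
  assumes z: "cmod z \<le> 1" and bdd: "bounded (range x)" and x0: "x 0 = 0" "x (int n) = 0"
    and eq: "\<And>k. k \<noteq> 0 \<Longrightarrow> k \<noteq> int n \<Longrightarrow>
      cmod (D z k * x k - a * x (k + int R) - b * x (k - int S)) \<le> \<delta>"
    and \<delta>: "\<delta> \<ge> 0"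
  shows "cmod (x k) \<le> \<delta>"
proof -
  define X where "X = (SUP k. cmod (x k))"
  have bd: "bdd_above (range (\<lambda>k. cmod (x k)))"
    using bdd unfolding bounded_iff bdd_above_def by auto
  have le: "cmod (x k) \<le> X" for k
    unfolding X_def by (rule cSUP_upper[OF _ bd]) auto
  have X0: "X \<ge> 0" using le[of 0] norm_ge_zero[of "x 0"] by linarith
  have "cmod (x k) \<le> \<delta> / 2 + X / 2" for k
  proof (cases "k = 0 \<or> k = int n")
    case True
    then show ?thesis using x0 X0 \<delta> by auto
  next
    case False
    then have k: "k \<noteq> 0" "k \<noteq> int n" by auto
    have "cmod (D z k * x k) \<le> cmod (D z k * x k - a * x (k + int R) - b * x (k - int S))
       + cmod (a * x (k + int R)) + cmod (b * x (k - int S))"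
      by (smt (verit, ccfv_SIG) norm_triangle_ineq norm_triangle_ineq2 diff_add_cancel)
    also have "\<dots> \<le> \<delta> + cmod a * X + cmod b * X"
      using eq[OF k] le by (intro add_mono) (auto simp: norm_mult mult_left_mono)
    finally have "cmod (D z k) * cmod (x k) \<le> \<delta> + (cmod a + cmod b) * X"
      by (simp add: norm_mult algebra_simps)
    moreover have "3 * (real n - 1) * cmod (x k) \<le> cmod (D z k) * cmod (x k)"
      using norm_D_ge(3)[OF k z] by (intro mult_right_mono) auto
    moreover have "3 * (real n - 1) \<ge> 2 * (1 + cmod a + cmod b)"
      using n_bounds(3) norms_nonneg by argo
    ultimately have "2 * (1 + cmod a + cmod b) * cmod (x k) \<le> \<delta> + (cmod a + cmod b) * X"
      by (smt (verit) mult_right_mono norm_ge_zero)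
    also have "\<dots> \<le> (1 + cmod a + cmod b) * (\<delta> + X)"
      using \<delta> X0 by (simp add: algebra_simps)
    finally have "(1 + cmod a + cmod b) * (2 * cmod (x k)) \<le> (1 + cmod a + cmod b) * (\<delta> + X)"
      by (simp add: algebra_simps)
    then have "2 * cmod (x k) \<le> \<delta> + X"
      by (rule mult_left_le_imp_le) (smt (verit) norm_ge_zero)
    then show ?thesis by linarith
  qed
  then have "X \<le> \<delta> / 2 + X / 2"
    unfolding X_def by (intro cSUP_least) (auto simp: X_def[symmetric])
  then show ?thesis using le[of k] by linarith
qed

section \<open>Neumann iteration with the values 1 at 0 and 0 at n imposed\<close>

fun iter :: "complex \<Rightarrow> nat \<Rightarrow> int \<Rightarrow> complex" where
  "iter z 0 k = (if k = 0 then 1 else 0)"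
| "iter z (Suc j) k = (if k = 0 then 1 else if k = int n then 0 else
     (a * iter z j (k + int R) + b * iter z j (k - int S)) / D z k)"

text \<open>The solution of all nonresonant equations with value 1 at 0 and 0 at \<open>n\<close>.
  The limit is known to exist only for \<open>cmod z \<le> 1\<close>, which therefore accompanies
  every fact about \<open>phi\<close>.\<close>

definition phi :: "complex \<Rightarrow> int \<Rightarrow> complex" where
  "phi z k = lim (\<lambda>j. iter z j k)"

abbreviation step_sum :: "(int \<Rightarrow> real) \<Rightarrow> int \<Rightarrow> real" where
  "step_sum H k \<equiv> cmod a * H (k + int R) + cmod b * H (k - int S)"

text \<open>Supersolutions dominate the Neumann iterates, hence also \<^term>\<open>phi z\<close>; the \<open>- 1\<close> absorbs
  \<open>cmod z \<le> 1\<close>.\<close>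

definition supersol :: "(int \<Rightarrow> real) \<Rightarrow> bool" where
  "supersol H \<longleftrightarrow> (\<forall>k. H k \<ge> 0) \<and> H 0 \<ge> 1 \<and> (\<forall>k. k \<noteq> 0 \<longrightarrow> k \<noteq> int n \<longrightarrow>
     step_sum H k
       \<le> (4 * gap n k - 1) * H k)"

lemma iter_le:
  assumes "supersol H" "cmod z \<le> 1"
  shows "cmod (iter z j k) \<le> H k"
proof (induction j arbitrary: k)
  case 0
  then show ?case using assms by (auto simp: supersol_def)
next
  case (Suc j)
  show ?case
  proof (cases "k = 0 \<or> k = int n")
    case True
    then show ?thesis using assms by (auto simp: supersol_def)
  next
    case False
    then have k: "k \<noteq> 0" "k \<noteq> int n" by auto
    have "cmod (a * iter z j (k + int R) + b * iter z j (k - int S))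
      \<le> step_sum H k"
      by (rule order_trans[OF norm_triangle_ineq])
         (auto simp: norm_mult intro!: add_mono mult_left_mono Suc)
    also have "\<dots> \<le> (4 * gap n k - 1) * H k"
      using assms k by (auto simp: supersol_def)
    also have "\<dots> \<le> cmod (D z k) * H k"
      using norm_D_ge(1)[OF k assms(2)] assms(1) by (intro mult_right_mono) (auto simp: supersol_def)
    finally show ?thesis
      using k norm_D_ge(4)[OF k assms(2)] by (simp add: norm_divide divide_simps mult.commute)
  qed
qed

lemma supersol_1: "supersol (\<lambda>_. 1)"
  unfolding supersol_def
proof (intro conjI allI impI, goal_cases)
  case (3 k)
  define X where "X = gap n k"
  have "X \<ge> real n - 1" unfolding X_def using 3 by (intro abs_prod_ge) auto
  then have "cmod a * 1 + cmod b * 1 \<le> (4 * X - 1) * 1"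
    using n_bounds(3) norms_nonneg by argo
  then show ?case unfolding X_def .
qed auto

text \<open>Each iteration halves the distance in the supremum norm, because the denominators are at
  least \<open>2 * (cmod a + cmod b)\<close>. The initial distance 2 comes from the constant
  supersolution 1.\<close>

lemma iter_diff:
  assumes "cmod z \<le> 1"
  shows "cmod (iter z (Suc j) k - iter z j k) \<le> 2 * (1/2) ^ j"
proof (induction j arbitrary: k)
  case 0
  have "cmod (iter z (Suc 0) k - iter z 0 k) \<le> cmod (iter z (Suc 0) k) + cmod (iter z 0 k)"
    by (rule norm_triangle_ineq4)
  also have "\<dots> \<le> 1 + 1" by (intro add_mono iter_le[OF supersol_1 assms])
  finally show ?case by simp
next
  case (Suc j)
  show ?case
  proof (cases "k = 0 \<or> k = int n")
    case True
    then show ?thesis by auto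
  next
    case False
    then have k: "k \<noteq> 0" "k \<noteq> int n" by auto
    have "cmod (D z k) * cmod (iter z (Suc (Suc j)) k - iter z (Suc j) k) =
      cmod (D z k * (iter z (Suc (Suc j)) k - iter z (Suc j) k))" by (simp only: norm_mult)
    also have "D z k * (iter z (Suc (Suc j)) k - iter z (Suc j) k) =
       a * (iter z (Suc j) (k + int R) - iter z j (k + int R)) + b * (iter z (Suc j) (k - int S) - iter z j (k - int S))"
      using k norm_D_ge(5)[OF k assms] by (simp add: right_diff_distrib del: iter.simps(1))
    also have "cmod \<dots> \<le> cmod a * (2 * (1/2) ^ j) + cmod b * (2 * (1/2) ^ j)"
      by (rule order_trans[OF norm_triangle_ineq])
         (unfold norm_mult, intro add_mono mult_left_mono Suc norm_ge_zero)
    also have "\<dots> = 2 * (cmod a + cmod b) * (2 * (1/2) ^ Suc j)" by (simp add: algebra_simps)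
    also have "\<dots> \<le> cmod (D z k) * (2 * (1/2) ^ Suc j)"
      using norm_D_ge(3)[OF k assms] n_bounds(3) norms_nonneg
      by (intro mult_right_mono) auto
    finally show ?thesis
      using norm_D_ge(4)[OF k assms] by (meson mult_left_le_imp_le)
  qed
qed

lemma iter_tendsto:
  assumes "cmod z \<le> 1"
  shows "(\<lambda>j. iter z j k) \<longlonglongrightarrow> phi z k"
proof -
  have "summable (\<lambda>j. iter z (Suc j) k - iter z j k)"
  proof (rule summable_comparison_test')
    show "summable (\<lambda>j. 2 * (1/2::real) ^ j)" by (intro summable_mult summable_geometric) auto
    show "cmod (iter z (Suc j) k - iter z j k) \<le> 2 * (1/2) ^ j" for j
      by (rule iter_diff[OF assms])
  qed
  then obtain l where "(\<lambda>N. \<Sum>j<N. iter z (Suc j) k - iter z j k) \<longlonglongrightarrow> l"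
    unfolding summable_def sums_def by blast
  then have "(\<lambda>N. iter z N k - iter z 0 k) \<longlonglongrightarrow> l"
    using sum_lessThan_telescope[of "\<lambda>j. iter z j k"] by (simp del: iter.simps)
  then have "(\<lambda>N. iter z N k - iter z 0 k + iter z 0 k) \<longlonglongrightarrow> l + iter z 0 k"
    by (intro tendsto_intros)
  then have "convergent (\<lambda>j. iter z j k)"
    unfolding convergent_def by (auto simp only: diff_add_cancel)
  then show ?thesis unfolding phi_def convergent_LIMSEQ_iff by simp
qed

lemma phi_le:
  assumes "supersol H" "cmod z \<le> 1"
  shows "cmod (phi z k) \<le> H k"
  by (rule tendsto_upperbound[OF tendsto_norm[OF iter_tendsto[OF assms(2)]]])
     (auto intro!: always_eventually iter_le assms)

lemma phi_0 [simp]: "cmod z \<le> 1 \<Longrightarrow> phi z 0 = 1"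
  by (rule LIMSEQ_unique[OF iter_tendsto LIMSEQ_offset[where k=1]]) auto

lemma phi_n [simp]: "cmod z \<le> 1 \<Longrightarrow> phi z (int n) = 0"
proof (rule LIMSEQ_unique[OF iter_tendsto LIMSEQ_offset[where k=1]])
  show "(\<lambda>j. iter z (j + 1) (int n)) \<longlonglongrightarrow> 0" using n_bounds(6) by auto
qed auto

lemma phi_eq:
  assumes "cmod z \<le> 1" "k \<noteq> 0" "k \<noteq> int n"
  shows "D z k * phi z k = a * phi z (k + int R) + b * phi z (k - int S)"
proof -
  have "(\<lambda>j. D z k * iter z (Suc j) k) \<longlonglongrightarrow> D z k * phi z k"
    by (intro tendsto_intros filterlim_compose[OF iter_tendsto filterlim_Suc] assms)
  moreover have "(\<lambda>j. D z k * iter z (Suc j) k) = (\<lambda>j. a * iter z j (k + int R) + b * iter z j (k - int S))"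
    using assms norm_D_ge(5)[OF assms(2,3,1)] by auto
  moreover have "(\<lambda>j. a * iter z j (k + int R) + b * iter z j (k - int S)) \<longlonglongrightarrow> a * phi z (k + int R) + b * phi z (k - int S)"
    by (intro tendsto_intros iter_tendsto assms)
  ultimately show ?thesis using LIMSEQ_unique by metis
qed

lemma phi_le_1: "cmod z \<le> 1 \<Longrightarrow> cmod (phi z k) \<le> 1"
  by (rule phi_le[OF supersol_1])

text \<open>One use of the recurrence improves the bound 1 to the reciprocal of the denominator,
  which is what makes \<open>phi z\<close> absolutely summable.\<close>

lemma phi_decay:
  assumes "cmod z \<le> 1" "k \<noteq> 0" "k \<noteq> int n"
  shows "cmod (phi z k) \<le> (cmod a + cmod b) / 3 * (1 / gap n k)"
    and "cmod (phi z k) \<le> (cmod a + cmod b) / (3 * (real n - 1))"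
proof -
  have "cmod (D z k) * cmod (phi z k) = cmod (a * phi z (k + int R) + b * phi z (k - int S))"
    using phi_eq[OF assms] by (simp flip: norm_mult)
  also have "\<dots> \<le> cmod a * 1 + cmod b * 1"
    by (rule order_trans[OF norm_triangle_ineq])
       (unfold norm_mult, intro add_mono mult_left_mono phi_le_1 assms norm_ge_zero)
  finally have *: "cmod (D z k) * cmod (phi z k) \<le> cmod a + cmod b" by simp
  have pos: "gap n k > 0" using assms by auto
  have "3 * gap n k * cmod (phi z k) \<le> cmod a + cmod b"
    by (rule order_trans[OF mult_right_mono[OF norm_D_ge(2)[OF assms(2,3,1)]] *]) auto
  then show "cmod (phi z k) \<le> (cmod a + cmod b) / 3 * (1 / gap n k)"
    using pos by (simp add: field_simps)
  have "3 * (real n - 1) * cmod (phi z k) \<le> cmod a + cmod b"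
    by (rule order_trans[OF mult_right_mono[OF norm_D_ge(3)[OF assms(2,3,1)]] *]) auto
  then show "cmod (phi z k) \<le> (cmod a + cmod b) / (3 * (real n - 1))"
    using n_bounds(6) by (simp add: field_simps)
qed

text \<open>The difference has resonant values 0 and solves the remaining equations with right-hand
  side \<open>(w - z) * phi w k\<close>, so \<open>a_priori\<close> applies.\<close>

lemma phi_Lipschitz:
  assumes "cmod z \<le> 1" "cmod w \<le> 1"
  shows "cmod (phi z k - phi w k) \<le> cmod (z - w)"
proof (rule a_priori[OF assms(1)])
  show "bounded (range (\<lambda>k. phi z k - phi w k))"
  proof -
    have "cmod (phi z k - phi w k) \<le> 1 + 1" for k
      by (rule order_trans[OF norm_triangle_ineq4]) (intro add_mono phi_le_1 assms)
    then show ?thesis unfolding bounded_iff by blast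
  qed
  fix k assume k: "k \<noteq> 0" "k \<noteq> int n"
  have "D z k * (phi z k - phi w k) - a * (phi z (k + int R) - phi w (k + int R)) - b * (phi z (k - int S) - phi w (k - int S))
     = (D w k - D z k) * phi w k"
    using phi_eq[OF assms(1) k] phi_eq[OF assms(2) k] by (simp add: algebra_simps)
  also have "cmod \<dots> = cmod (w - z) * cmod (phi w k)" by (simp add: D_def norm_mult)
  also have "\<dots> \<le> cmod (w - z) * 1" by (intro mult_left_mono phi_le_1 assms) auto
  finally show "cmod (D z k * (phi z k - phi w k) - a * (phi z (k + int R) - phi w (k + int R)) - b * (phi z (k - int S) - phi w (k - int S))) \<le> cmod (z - w)"
    by (simp add: norm_minus_commute)
qed (use assms in auto)

lemma phi_continuous: "continuous_on (cball 0 1) (\<lambda>z. phi z k)"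
  unfolding continuous_on_iff
proof (intro ballI allI impI)
  fix z :: complex and e :: real assume "z \<in> cball 0 1" "e > 0"
  then show "\<exists>d>0. \<forall>w\<in>cball 0 1. dist w z < d \<longrightarrow> dist (phi w k) (phi z k) < e"
    by (intro exI[of _ e]) (auto simp: dist_norm intro!: le_less_trans[OF phi_Lipschitz])
qed

abbreviation tail_sum :: "(int \<Rightarrow> complex) \<Rightarrow> real" where
  "tail_sum f \<equiv> infsum (\<lambda>k. cmod (f k)) (-{0, int n})"

lemma phi_sum:
  assumes "cmod z \<le> 1"
  shows "(\<lambda>k. cmod (phi z k)) summable_on -{0, int n}"
    and "tail_sum (phi z) \<le> (cmod a + cmod b) / 3 * recip_sum n"
    and "abs_summable (phi z)"
proof -
  have n: "n > 0" using n_bounds(6) by simp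
  have sg: "(\<lambda>k. (cmod a + cmod b) / 3 * (1 / gap n k)) summable_on -{0, int n}"
    by (intro summable_on_cmult_right recip_summable n)
  show s: "(\<lambda>k. cmod (phi z k)) summable_on -{0, int n}"
    by (rule summable_on_comparison_test[OF sg]) (use phi_decay(1) assms in auto)
  have "tail_sum (phi z) \<le> infsum (\<lambda>k. (cmod a + cmod b) / 3 * (1 / gap n k)) (-{0, int n})"
    by (rule infsum_mono[OF s sg]) (use phi_decay(1) assms in auto)
  then show "tail_sum (phi z) \<le> (cmod a + cmod b) / 3 * recip_sum n"
    unfolding recip_sum_def by (subst (asm) infsum_cmult_right') simp
  have "(\<lambda>k. cmod (phi z k)) summable_on -{0, int n} \<union> {0, int n}"
    by (rule summable_on_union[OF s]) auto
  then show "abs_summable (phi z)" by (simp add: Un_commute Compl_partition)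
qed

end

section \<open>A supersolution following the leading path\<close>

context hill_seq
begin

section \<open>Weights of the direct path in steps of S\<close>

definition p :: nat where "p = n div S"

text \<open>The cost of the step arriving at \<open>i * S\<close>, with \<open>z\<close> neglected
  in the denominator. Hence \<open>g q\<close> below is the modulus of the weight of the direct path
  from 0 to \<open>q * S\<close>.\<close>

definition e :: "nat \<Rightarrow> real" where
  "e i = cmod b / (4 * (real i * real S) * (real n - real i * real S))"

definition g :: "nat \<Rightarrow> real" where "g q = (\<Prod>i=1..q. e i)"

lemma n_eq: "n = S * p" "real n = real S * real p"
proof -
  show "n = S * p" using S_dvd by (simp add: p_def)
  then show "real n = real S * real p" by (metis of_nat_mult)
qed

lemma p_ge: "p \<ge> 64"
  using n_bounds(8) S_pos n_eq(1) by (metis mult.commute mult_le_cancel1 not_one_le_zero not_gr_zero)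

lemma e_sym:
  assumes "i \<le> p"
  shows "e (p - i) = e i"
  using assms by (simp add: e_def n_eq(2) of_nat_diff algebra_simps)

lemma e_bounds:
  assumes "1 \<le> i" "i < p"
  shows "e i > 0" "e i \<le> 1" "real i * real S * (real n - real i * real S) \<ge> real n - 1"
    "real i * real S * (real n - real i * real S) > 0"
proof -
  have lt: "i * S < n" using mult_strict_right_mono[of i p S] assms S_pos n_eq(1) by (simp add: mult.commute)
  have "\<bar>real_of_int (int (i * S))\<bar> * \<bar>real_of_int (int n - int (i * S))\<bar> \<ge> real n - 1"
    using assms S_pos lt by (intro abs_prod_ge) (simp_all del: of_nat_mult)
  note ** = this
  show *: "real i * real S * (real n - real i * real S) \<ge> real n - 1"
  proof -
    have "real i * real S < real n" using lt by (metis of_nat_less_iff of_nat_mult)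
    with ** show ?thesis by simp
  qed
  show pos: "real i * real S * (real n - real i * real S) > 0"
    using * n_bounds(6) by linarith
  then show "e i > 0" using b_nz by (simp add: e_def mult.assoc)
  have "cmod b \<le> 4 * (real i * real S * (real n - real i * real S))"
    using * n_bounds(3) norms_nonneg by linarith
  then show "e i \<le> 1" using pos by (simp add: e_def divide_simps mult.assoc)
qed

lemma g_Suc: "g (Suc q) = g q * e (Suc q)"
  by (simp add: g_def)

lemma g_0 [simp]: "g 0 = 1"
  by (simp add: g_def)

lemma g_pos: "q < p \<Longrightarrow> g q > 0"
  unfolding g_def by (intro prod_pos) (auto intro!: e_bounds)

lemma g_mono: "q \<le> q' \<Longrightarrow> q' < p \<Longrightarrow> g q' \<le> g q"
proof (induction q' rule: dec_induct)
  case (step m)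
  have "g (Suc m) \<le> g m * 1"
    unfolding g_Suc using step g_pos[of m] by (intro mult_left_mono e_bounds) auto
  then show ?case using step by auto
qed auto

lemma g_le_1: "q < p \<Longrightarrow> g q \<le> 1"
  using g_mono[of 0 q] by simp

text \<open>The step costs are symmetric under \<open>i \<mapsto> p - i\<close>, so the second
  factor is also the cost of the remaining steps, from \<open>q * S\<close> to
  \<open>(p - 1) * S\<close>.\<close>

lemma g_sym:
  assumes "q < p"
  shows "g q * g (p - 1 - q) = g (p - 1)"
proof -
  have "(\<Prod>i=1..p - 1 - q. e i) = (\<Prod>i=q+1..p-1. e i)"
    by (rule prod.reindex_bij_witness[of _ "\<lambda>i. p - i" "\<lambda>i. p - i"]) (use assms e_sym in auto)
  moreover have "(\<Prod>i=1..p-1. e i) = (\<Prod>i=1..q. e i) * (\<Prod>i=q+1..p-1. e i)"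
  proof -
    have "{1..p - 1} = {1..q} \<union> {q+1..p-1}" using assms by auto
    then show ?thesis using prod.union_disjoint[of "{1..q}" "{q+1..p-1}" e] by auto
  qed
  ultimately show ?thesis unfolding g_def by simp
qed

text \<open>Height of the plateau of \<open>G\<close> near \<open>n\<close>, relative to
  \<open>g (p - 1)\<close>. For \<open>k > n - S\<close> the step inequality needs
  \<open>n * S \<le> M * k * (n - k)\<close>, and there
  \<open>k * (n - k) \<ge> n - 1 \<ge> n / 2\<close>.\<close>

definition M :: real where "M = 2 * real S"

lemma M_ge: "M \<ge> 2" using S_pos by (simp add: M_def)

text \<open>Between consecutive multiples of \<^term>\<open>S\<close> the leading path weights \<^term>\<open>g\<close> are
  interpolated geometrically; concavity of \<open>ln (k * (n - k))\<close> makes this a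
  supersolution for the step by \<^term>\<open>S\<close>. Beyond \<open>n - S\<close> the interpolation would involve the junk
  value \<open>e p = b / 0 = 0\<close>, and a constant suffices.\<close>

definition G :: "nat \<Rightarrow> real" where
  "G k = (if k > n - S then M * g (p - 1)
     else g (k div S) * (if k mod S = 0 then 1 else e (Suc (k div S)) powr (real (k mod S) / real S)))"

lemma div_less_p: "k < n \<Longrightarrow> k div S < p"
  using n_eq(1) S_pos by (simp add: div_less_iff_less_mult mult.commute)

lemma Suc_div_less_p:
  assumes "k \<le> n - S" "k mod S \<noteq> 0"
  shows "Suc (k div S) < p"
proof (rule ccontr)
  assume "\<not> ?thesis"
  then have "p - 1 \<le> k div S" by simp
  then have "(p - 1) * S \<le> k div S * S" by simp
  moreover have "(p - 1) * S = n - S" using n_eq(1) by (simp add: algebra_simps)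
  ultimately have "k \<le> k div S * S" using assms(1) by linarith
  then have "k mod S = 0" using div_mult_mod_eq[of k S] by linarith
  with assms show False by simp
qed

text \<open>The interpolating factor is a power, with exponent in the unit interval, of a step cost
  at most 1; hence \<open>G\<close> stays between consecutive path weights.\<close>

lemma G_bounds_le:
  assumes "k \<le> n - S"
  shows "G k \<le> g (k div S)" "k mod S \<noteq> 0 \<Longrightarrow> g (Suc (k div S)) \<le> G k" "G k > 0"
proof -
  have q: "k div S < p" using assms S_pos n_bounds(5) by (intro div_less_p) simp
  note gp = g_pos[OF q]
  show "G k \<le> g (k div S)"
  proof (cases "k mod S = 0")
    case False
    note e = e_bounds[OF _ Suc_div_less_p[OF assms False]]
    have "e (Suc (k div S)) powr (real (k mod S) / real S) \<le> 1"
      using e by (intro powr_le1) auto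
    then show ?thesis using False assms gp by (simp add: G_def mult_le_cancel_left2)
  qed (use assms in \<open>simp add: G_def\<close>)
  show "g (Suc (k div S)) \<le> G k" if "k mod S \<noteq> 0"
  proof -
    note e = e_bounds[OF _ Suc_div_less_p[OF assms that]]
    have "real (k mod S) / real S \<le> 1" using S_pos mod_less_divisor[of S k] by (simp add: less_imp_le)
    then have "e (Suc (k div S)) powr 1 \<le> e (Suc (k div S)) powr (real (k mod S) / real S)"
      using e by (intro powr_mono') auto
    then show ?thesis using that assms gp e by (simp add: G_def g_Suc)
  qed
  show "G k > 0"
    using assms gp e_bounds(1)[OF _ Suc_div_less_p[OF assms]] by (auto simp: G_def)
qed

lemma div_eq_top:
  assumes "n - S < k" "k < n"
  shows "k div S = p - 1"
proof -
  have "(p - 1) * S = n - S" using n_eq(1) by (simp add: algebra_simps)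
  moreover have "Suc (p - 1) * S = n" using n_eq(1) p_ge by (simp add: mult.commute)
  ultimately show ?thesis using assms by (intro div_nat_eqI) (auto simp: mult.commute)
qed

lemma G_pos: "k < n \<Longrightarrow> G k > 0"
  using G_bounds_le(3)[of k] g_pos[of "p-1"] M_ge p_ge by (cases "k \<le> n - S") (auto simp: G_def)

lemma G_le: "k < n \<Longrightarrow> G k \<le> M * g (k div S)"
proof (cases "k \<le> n - S")
  case True
  assume "k < n"
  then have "g (k div S) > 0" by (intro g_pos div_less_p)
  then show ?thesis using G_bounds_le(1)[OF True] M_ge by (smt (verit) mult_le_cancel_right1)
next
  case False
  assume "k < n"
  then show ?thesis using False div_eq_top[of k] by (simp add: G_def)
qed

lemma G_ge: "k < n \<Longrightarrow> g (p - 1) \<le> G k"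
proof (cases "k \<le> n - S")
  case True
  assume k: "k < n"
  show ?thesis
  proof (cases "k mod S = 0")
    case True
    then show ?thesis using \<open>k \<le> n - S\<close> g_mono[of "k div S" "p - 1"] div_less_p[OF k] by (auto simp: G_def)
  next
    case False
    have "g (p - 1) \<le> g (Suc (k div S))"
      using Suc_div_less_p[OF \<open>k \<le> n - S\<close> False] by (intro g_mono) linarith+
    then show ?thesis using G_bounds_le(2)[OF \<open>k \<le> n - S\<close> False] by linarith
  qed
next
  case False
  then show ?thesis using g_pos[of "p-1"] p_ge M_ge by (simp add: G_def)
qed

text \<open>Below the plateau \<open>G\<close> really decreases; the factor \<open>M\<close> pays
  for the upward jump at the edge of the plateau.\<close>

lemma G_antimono:
  assumes "k \<le> j" "j < n"
  shows "G j \<le> M * G k"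
proof (cases "j \<le> n - S")
  case False
  then show ?thesis using G_ge[of k] assms M_ge by (simp add: G_def)
next
  case True
  have k: "k \<le> n - S" using True assms by simp
  have jp: "j div S < p" using assms by (intro div_less_p)
  have "G j \<le> G k"
  proof (cases "j div S = k div S")
    case False
    then have "k div S < j div S" using assms div_le_mono[of k j S] by simp
    then have "G j \<le> g (Suc (k div S))" "G j \<le> g (k div S)"
      using G_bounds_le(1)[OF True] g_mono[OF _ jp] by (meson Suc_leI less_imp_le order_trans)+
    then show ?thesis using G_bounds_le(2)[OF k] k by (cases "k mod S = 0") (auto simp: G_def)
  next
    case same: True
    show ?thesis
    proof (cases "k mod S = 0")
      case True
      then show ?thesis using G_bounds_le(1)[OF \<open>j \<le> n - S\<close>] same k by (simp add: G_def)
    next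
      case False
      have "k mod S \<le> j mod S" using assms(1) same
        by (metis add_le_cancel_left div_mult_mod_eq)
      then have j0: "j mod S \<noteq> 0" using False by simp
      note e = e_bounds[OF _ Suc_div_less_p[OF True j0]]
      have "e (Suc (j div S)) powr (real (j mod S) / real S) \<le> e (Suc (j div S)) powr (real (k mod S) / real S)"
        using e \<open>k mod S \<le> j mod S\<close> by (intro powr_mono' divide_right_mono) auto
      then show ?thesis
        using same k True j0 False g_pos[OF jp] by (simp add: G_def)
    qed
  qed
  also have "G k \<le> M * G k" using M_ge G_pos[of k] assms by simp
  finally show ?thesis .
qed

text \<open>At multiples of \<open>S\<close> below the plateau this is an equality, by the choice of
  \<open>e\<close>. Between them the weighted arithmetic-geometric mean inequality does the work,
  and on the plateau the slack lies in \<open>M\<close>.\<close>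

lemma G_step:
  assumes "S \<le> k" "k < n"
  shows "cmod b * G (k - S) \<le> 4 * (real k * (real n - real k)) * G k"
proof -
  define q where "q = k div S - 1"
  have q: "k div S = Suc q" using assms S_pos by (simp add: q_def div_greater_zero_iff Suc_diff_1[symmetric] del: Suc_diff_1)
  have q': "(k - S) div S = q" "(k - S) mod S = k mod S"
    using assms q le_mod_geq[of S k] S_pos by (auto simp: le_div_geq)
  have qp: "Suc q < p" using div_less_p[OF assms(2)] q by simp
  have gq: "g q > 0" using qp by (intro g_pos) simp
  have kS: "k - S \<le> n - S" using assms by simp
  note eq = e_bounds[OF _ qp, simplified]
  have ee: "cmod b = 4 * (real (Suc q) * real S * (real n - real (Suc q) * real S)) * e (Suc q)"
  proof -
    have "real (Suc q) * real S \<noteq> 0" "real n - real (Suc q) * real S \<noteq> 0" using eq(4) S_pos by auto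
    then show ?thesis using S_pos by (simp add: e_def del: of_nat_Suc)
  qed
  have ge: "g (Suc q) = g q * e (Suc q)" by (rule g_Suc)
  show ?thesis
  proof (cases "k \<le> n - S")
    case False
    have kt: "k div S = p - 1" using False assms by (intro div_eq_top) auto
    have "cmod b * G (k - S) \<le> cmod b * g q"
      using G_bounds_le(1)[OF kS] q' by (intro mult_left_mono) auto
    also have "\<dots> = 4 * (real (Suc q) * real S * (real n - real (Suc q) * real S)) * g (p - 1)"
    proof -
      have "g (p - 1) = g q * e (Suc q)" using kt q ge by simp
      then show ?thesis by (subst ee) (simp add: mult_ac del: of_nat_Suc)
    qed
    also have "real (Suc q) * real S * (real n - real (Suc q) * real S) \<le> real n * real S"
    proof -
      have "Suc q * S = n - S" using kt q n_eq(1) by (simp add: algebra_simps)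
      then have "real (Suc q) * real S = real n - real S" using n_bounds(5) by (metis of_nat_mult of_nat_diff less_imp_le)
      then show ?thesis by (simp only:) (simp add: left_diff_distrib)
    qed
    also have "real n * real S \<le> real k * (real n - real k) * M"
    proof -
      have "\<bar>real_of_int (int k)\<bar> * \<bar>real_of_int (int n - int k)\<bar> \<ge> real n - 1"
        using assms S_pos by (intro abs_prod_ge) auto
      then have "real k * (real n - real k) \<ge> real n - 1" using assms by simp
      then have "real k * (real n - real k) * 2 \<ge> real n" using n_bounds(6) by linarith
      then have "real k * (real n - real k) * 2 * real S \<ge> real n * real S" by (intro mult_right_mono) auto
      then show ?thesis by (simp add: M_def)
    qed
    finally show ?thesis
      using False g_pos[of "p-1"] p_ge by (simp add: G_def mult_right_mono)
  next
    case True
    show ?thesis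
    proof (cases "k mod S = 0")
      case r0: True
      have "real k = real (Suc q) * real S" using r0 q
        by (metis div_mult_mod_eq add_0_right of_nat_mult)
      then show ?thesis using True r0 q q' kS by (simp add: G_def ee ge)
    next
      case r0: False
      define t where "t = real (k mod S) / real S"
      have t: "0 < t" "t < 1" using r0 S_pos by (auto simp: t_def)
      note qp2 = Suc_div_less_p[OF True r0, unfolded q]
      note eq2 = e_bounds[OF _ qp2, simplified]
      define x where "x = real (Suc q) * real S"
      define x2 where "x2 = real (Suc (Suc q)) * real S"
      have kx: "real k = (1 - t) * x + t * x2"
      proof -
        have "real k = real (k div S) * real S + real (k mod S)"
          by (metis div_mult_mod_eq of_nat_add of_nat_mult)
        also have "real (k mod S) = t * real S" using S_pos by (simp add: t_def)
        finally show ?thesis by (simp add: q x_def x2_def algebra_simps)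
      qed
      have xp: "x > 0" "x2 > 0" "real n - x > 0" "real n - x2 > 0"
        using eq(4) eq2(4) S_pos by (auto simp: x_def x2_def zero_less_mult_iff)
      have e1: "e (Suc q) = cmod b / (4 * x * (real n - x))" by (simp add: e_def x_def)
      have e2: "e (Suc (Suc q)) = cmod b / (4 * x2 * (real n - x2))" by (simp add: e_def x2_def)
      have "x powr (1 - t) * x2 powr t \<le> real k"
        unfolding kx using t xp by (intro Youngs_inequality_0) auto
      moreover have "(real n - x) powr (1 - t) * (real n - x2) powr t \<le> real n - real k"
      proof -
        have "(real n - x) powr (1 - t) * (real n - x2) powr t \<le> (1 - t) * (real n - x) + t * (real n - x2)"
          using t xp by (intro Youngs_inequality_0) auto
        also have "\<dots> = real n - real k" by (simp add: kx algebra_simps)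
        finally show ?thesis .
      qed
      \<comment> \<open>Weighted geometric means of the values at the two neighbouring multiples of
        \<open>S\<close> bound both \<open>k\<close> and \<open>n - k\<close> from below; the
        product is the log-concavity of \<open>k * (n - k)\<close>.\<close>
      ultimately have am: "(x powr (1 - t) * x2 powr t) * ((real n - x) powr (1 - t) * (real n - x2) powr t) \<le> real k * (real n - real k)"
        by (intro mult_mono) auto
      have "cmod b = (4 * ((x powr (1 - t) * x2 powr t) * ((real n - x) powr (1 - t) * (real n - x2) powr t)))
         * (e (Suc q) powr (1 - t) * e (Suc (Suc q)) powr t)"
      proof -
        have c: "cmod b = c powr (1 - t) * c powr t" if "c = cmod b" for c
          using that b_nz by (simp flip: powr_add)
        have f: "4 = (4::real) powr (1 - t) * 4 powr t" by (simp flip: powr_add)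
        have "(4 * ((x powr (1 - t) * x2 powr t) * ((real n - x) powr (1 - t) * (real n - x2) powr t)))
         * (e (Suc q) powr (1 - t) * e (Suc (Suc q)) powr t)
          = (4 * x * (real n - x) * e (Suc q)) powr (1 - t) * (4 * x2 * (real n - x2) * e (Suc (Suc q))) powr t"
          using xp eq(1) eq2(1) by (subst f) (simp add: powr_mult)
        also have "4 * x * (real n - x) * e (Suc q) = cmod b" using xp by (simp add: e1)
        also have "4 * x2 * (real n - x2) * e (Suc (Suc q)) = cmod b" using xp by (simp add: e2)
        finally show ?thesis using c by simp
      qed
      also have "\<dots> \<le> 4 * (real k * (real n - real k)) * (e (Suc q) powr (1 - t) * e (Suc (Suc q)) powr t)"
        using am by (intro mult_right_mono mult_left_mono) auto
      finally have "cmod b * (g q * e (Suc q) powr t) \<le>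
          4 * (real k * (real n - real k)) * (e (Suc q) powr (1 - t) * e (Suc (Suc q)) powr t) * (g q * e (Suc q) powr t)"
        using gq by (intro mult_right_mono) auto
      also have "\<dots> = 4 * (real k * (real n - real k)) * (g q * (e (Suc q) powr (1 - t) * e (Suc q) powr t) * e (Suc (Suc q)) powr t)"
        by (simp add: mult_ac)
      also have "e (Suc q) powr (1 - t) * e (Suc q) powr t = e (Suc q)"
        using eq(1) by (simp flip: powr_add)
      finally show ?thesis
        using True r0 q q' kS by (simp add: G_def ge t_def)
    qed
  qed
qed

text \<open>Since \<open>k div S\<close> and \<open>(n - k) div S\<close> add up to at least
  \<open>p - 1\<close>, the two partial paths together contain as many steps as the direct path has
  denominators, and \<open>g_sym\<close> multiplies their weights.\<close>

lemma G_prod: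
  assumes "0 < k" "k < n"
  shows "G k * G (n - k) \<le> M\<^sup>2 * g (p - 1)"
proof -
  define q where "q = k div S"
  have qp: "q < p" using div_less_p[OF assms(2)] by (simp add: q_def)
  have "k < Suc q * S" unfolding q_def using S_pos by (simp add: dividend_less_div_times)
  moreover have "n = (p - 1 - q) * S + Suc q * S"
  proof -
    have "p - 1 - q + Suc q = p" using qp by simp
    then show ?thesis using n_eq(1) by (metis distrib_right mult.commute)
  qed
  ultimately have "(p - 1 - q) * S \<le> n - k" by linarith
  then have le: "p - 1 - q \<le> (n - k) div S" using S_pos by (simp add: less_eq_div_iff_mult_less_eq)
  have nk: "n - k < n" using assms by simp
  have "G (n - k) \<le> M * g ((n - k) div S)" by (rule G_le[OF nk])
  also have "\<dots> \<le> M * g (p - 1 - q)"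
    using M_ge by (intro mult_left_mono g_mono le div_less_p[OF nk]) auto
  finally have "G k * G (n - k) \<le> (M * g q) * (M * g (p - 1 - q))"
    using G_le[OF assms(2)] G_pos[OF nk] G_pos[OF assms(2)] g_pos[OF qp] M_ge
    by (intro mult_mono) (auto simp: q_def)
  also have "\<dots> = M\<^sup>2 * (g q * g (p - 1 - q))" by (simp add: power2_eq_square)
  finally show ?thesis unfolding g_sym[OF qp] .
qed

section \<open>The correction factor for downward steps and for z\<close>

abbreviation slope :: real where
  "slope \<equiv> (1 + M * cmod a) / 2"

abbreviation psum :: "nat \<Rightarrow> real" where
  "psum k \<equiv> (\<Sum>i=1..k. 1 / (real i * (real n - real i)))"

text \<open>A step of \<open>S\<close> raises \<open>u\<close> by at least
  \<open>slope / (k * (n - k))\<close>. Multiplied by the denominator \<open>4 * k * (n - k)\<close>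
  this frees \<open>2 * (1 + M * cmod a) * G k\<close>: room for the term with \<open>k + R\<close>
  and for the \<open>- 1\<close> in \<open>supersol\<close>. The total growth stays below 1 because
  \<open>recip_sum\<close> is small.\<close>

definition u :: "nat \<Rightarrow> real" where
  "u k = 1 + slope * psum k"

lemma partial_recip_sum:
  assumes "k < n"
  shows "psum k \<le> recip_sum n"
proof -
  let ?f = "\<lambda>k::int. 1 / gap n k :: real"
  have "psum k = (\<Sum>i\<in>int ` {1..k}. ?f i)"
    using assms by (subst sum.reindex) (auto intro!: sum.cong)
  also have "\<dots> \<le> infsum ?f (-{0, int n})"
    using assms n_bounds(6) by (intro finite_sum_le_infsum recip_summable) auto
  finally show ?thesis by (simp add: recip_sum_def)
qed

lemma recip_small':
  assumes "c \<le> budget"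
  shows "c * recip_sum n \<le> 1"
proof -
  have "c \<le> 64 * (real R + real S) * (1 + cmod a + cmod b)" using assms budget_le by linarith
  then have "c * recip_sum n \<le> 64 * (real R + real S) * (1 + cmod a + cmod b) * recip_sum n"
    using recip_summable(3)[of n] n_bounds(6) by (intro mult_right_mono) auto
  then show ?thesis using recip_small by linarith
qed

lemma u_bounds:
  assumes "k < n"
  shows "1 \<le> u k" "u k \<le> 2"
proof -
  have 1: "0 \<le> psum k" using assms by (intro sum_nonneg) auto
  have Ma: "0 \<le> slope" using M_ge by simp
  show "1 \<le> u k" unfolding u_def using mult_nonneg_nonneg[OF Ma 1] by linarith
  have "slope * psum k \<le> slope * recip_sum n"
    by (rule mult_left_mono[OF partial_recip_sum[OF assms] Ma])
  also have "\<dots> \<le> 1"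
  proof (rule recip_small')
    show "slope \<le> budget" using pos_facts
      unfolding M_def by argo
  qed
  finally show "u k \<le> 2" by (simp add: u_def)
qed

lemma u_step:
  assumes "S \<le> k" "k < n"
  shows "u (k - S) + slope / (real k * (real n - real k)) \<le> u k"
proof -
  have "{1..k} = insert k {1..k-1}" using assms S_pos by auto
  then have "psum k = 1 / (real k * (real n - real k)) + psum (k-1)"
    using assms S_pos by simp
  moreover have "psum (k-1) \<ge> psum (k-S)"
    using assms S_pos by (intro sum_mono2) auto
  ultimately have "1 / (real k * (real n - real k)) + psum (k-S) \<le> psum k"
    by linarith
  then have "slope * (1 / (real k * (real n - real k)) + psum (k-S)) \<le> slope * psum k"
    using M_ge by (intro mult_left_mono) auto
  then show ?thesis unfolding u_def distrib_left by simp
qed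

text \<open>The value at \<open>n\<close> is the one imposed on \<open>phi\<close>. The outer
  constants come from one more step, down from 0 or up from the plateau \<open>M * g (p - 1)\<close>
  with \<open>u \<le> 2\<close>, each divided by a denominator of order \<open>n\<close>.\<close>

definition H :: "int \<Rightarrow> real" where
  "H k = (if k < 0 then cmod a / n else if k < int n then G (nat k) * u (nat k)
     else if k = int n then 0 else 2 * M * cmod b * g (p - 1) / n)"

lemma H_top: "2 * M * cmod b * g (p - 1) / n \<le> g (p - 1)"
proof -
  have "2 * M * cmod b \<le> real n" using n_bounds(2) by (simp add: M_def)
  then have "2 * M * cmod b * g (p - 1) \<le> real n * g (p - 1)"
    using g_pos[of "p-1"] p_ge by (intro mult_right_mono) auto
  then show ?thesis using n_bounds(6) by (simp add: divide_simps mult.commute)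
qed

lemma H_nonneg: "H k \<ge> 0"
proof -
  have "g (p - 1) > 0" using p_ge by (intro g_pos) auto
  moreover have "0 \<le> G (nat k) * u (nat k)" if "\<not> k < 0" "k < int n"
    using that G_pos[of "nat k"] u_bounds(1)[of "nat k"] by (intro mult_nonneg_nonneg) linarith+
  ultimately show ?thesis using M_ge by (auto simp: H_def)
qed

lemma H_le_2G: "k < n \<Longrightarrow> H (int k) \<le> 2 * G k"
  using u_bounds(2)[of k] G_pos[of k] by (simp add: H_def mult.commute)

text \<open>Controls the term with \<open>k + R\<close> in the recurrence by the local value
  \<open>G k\<close>, whether that index lies below, at or beyond \<open>n\<close>.\<close>

lemma H_ahead:
  assumes "k < n"
  shows "H (int k + int r) \<le> 2 * M * G k"
proof -
  consider "k + r < n" | "k + r = n" | "k + r > n" by linarith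
  then show ?thesis
  proof cases
    case 1
    have "H (int (k + r)) \<le> 2 * G (k + r)" by (rule H_le_2G[OF 1])
    also have "\<dots> \<le> 2 * (M * G k)" using G_antimono[of k "k + r"] 1 by simp
    finally show ?thesis by simp
  next
    case 2
    then show ?thesis using G_pos[OF assms] M_ge by (simp add: H_def flip: of_nat_add)
  next
    case 3
    then have "H (int k + int r) = 2 * M * cmod b * g (p - 1) / n" by (simp add: H_def)
    also have "\<dots> \<le> 1 * G k" using H_top G_ge[OF assms] by simp
    also have "\<dots> \<le> 2 * M * G k" using G_pos[OF assms] M_ge by (intro mult_right_mono) auto
    finally show ?thesis .
  qed
qed

lemma supersol_H_neg:
  assumes "k < 0"
  shows "step_sum H k \<le> (4 * gap n k - 1) * H k"
proof -
  have n0: "real n > 0" using n_bounds(6) by simp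
  have "H (k + int R) \<le> 2"
  proof (cases "k + int R < 0")
    case True
    have "cmod a \<le> real n" using n_bounds(3) norms_nonneg by linarith
    then have "cmod a / real n \<le> 1" using n0 by simp
    then show ?thesis using True by (simp add: H_def)
  next
    case False
    define j where "j = nat (k + int R)"
    have j: "k + int R = int j" "j < n - S" "j < n" using False assms n_bounds(7) by (auto simp: j_def)
    have "H (int j) \<le> 2 * G j" by (rule H_le_2G) (use j in auto)
    also have "G j \<le> g (j div S)" using j by (intro G_bounds_le) auto
    also have "\<dots> \<le> 1" by (intro g_le_1 div_less_p j)
    finally show ?thesis by (simp add: j)
  qed
  moreover have "H (k - int S) = cmod a / real n" using assms by (simp add: H_def)
  moreover have "cmod a * (cmod b / real n) \<le> cmod a"
  proof -
    have "cmod b / real n \<le> 1" using n_bounds(3) norms_nonneg n0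
      by (subst divide_le_eq_1_pos) linarith+
    from mult_left_mono[OF this norm_ge_zero[of a]] show ?thesis by simp
  qed
  ultimately have "step_sum H k \<le> cmod a * 2 + cmod a"
    by (intro add_mono mult_left_mono) (auto simp: mult.commute)
  also have "\<dots> = (3 * real n) * (cmod a / real n)" using n0 by simp
  also have "\<dots> \<le> (4 * gap n k - 1) * (cmod a / real n)"
  proof (rule mult_right_mono)
    have "gap n k \<ge> 1 * real n"
      using assms by (intro mult_mono) auto
    then show "3 * real n \<le> 4 * gap n k - 1"
      using n_bounds(6) by linarith
  qed auto
  finally show ?thesis using assms by (simp add: H_def)
qed

lemma supersol_H_gt:
  assumes "k > int n"
  shows "step_sum H k \<le> (4 * gap n k - 1) * H k"
proof -
  have n0: "real n > 0" using n_bounds(6) by simp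
  define T where "T = 2 * M * cmod b * g (p - 1) / n"
  have gp: "g (p - 1) > 0" using p_ge by (intro g_pos) auto
  have T0: "T \<ge> 0" using gp M_ge by (simp add: T_def)
  have nT: "real n * T = 2 * M * cmod b * g (p - 1)" using n0 by (simp add: T_def)
  have R: "H (k + int R) = T" using assms by (simp add: H_def T_def)
  have L: "H (k - int S) \<le> T + 2 * M * g (p - 1)"
  proof -
    consider "k - int S < int n" | "k - int S = int n" | "k - int S > int n" by linarith
    then show ?thesis
    proof cases
      case 1
      define j where "j = nat (k - int S)"
      have j: "k - int S = int j" "n - S < j" "j < n" using 1 assms n_bounds(5) by (auto simp: j_def)
      have "H (int j) \<le> 2 * G j" by (rule H_le_2G) (use j in auto)
      also have "G j = M * g (p - 1)" using j by (simp add: G_def)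
      finally show ?thesis using T0 j by simp
    next
      case 2
      then show ?thesis using T0 M_ge gp by (simp add: H_def)
    next
      case 3
      then show ?thesis using M_ge gp by (simp add: H_def T_def)
    qed
  qed
  have "step_sum H k \<le> cmod a * T + cmod b * (T + 2 * M * g (p - 1))"
    unfolding R using L by (intro add_mono mult_left_mono) auto
  also have "\<dots> = (cmod a + cmod b) * T + real n * T" unfolding nT by (simp add: algebra_simps)
  also have "\<dots> \<le> (2 * real n) * T"
    using n_bounds(3) norms_nonneg T0
    unfolding distrib_right[symmetric] by (intro mult_right_mono) linarith+
  also have "\<dots> \<le> (4 * gap n k - 1) * T"
  proof (rule mult_right_mono[OF _ T0])
    have "gap n k \<ge> real n * 1"
      using assms by (intro mult_mono) auto
    then show "2 * real n \<le> 4 * gap n k - 1"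
      using n_bounds(6) by linarith
  qed
  finally show ?thesis using assms by (simp add: H_def T_def)
qed

lemma supersol_H_mid:
  assumes "0 < k" "k < n"
  shows "cmod a * H (int k + int R) + cmod b * H (int k - int S) \<le> (4 * (real k * (real n - real k)) - 1) * (G k * u k)"
proof -
  have n0: "real n > 0" using n_bounds(6) by simp
  define d where "d = 4 * (real k * (real n - real k))"
  have "\<bar>real_of_int (int k)\<bar> * \<bar>real_of_int (int n - int k)\<bar> \<ge> real n - 1"
    using assms by (intro abs_prod_ge) auto
  then have d: "d \<ge> 4 * real n - 4" using assms by (simp add: d_def)
  have d0: "d > 0" using d n_bounds(6) by linarith
  note Gp = G_pos[OF assms(2)]
  note ub = u_bounds[OF assms(2)]
  have A: "cmod a * H (int k + int R) \<le> cmod a * (2 * M * G k)"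
    by (intro mult_left_mono H_ahead assms) auto
  show ?thesis
  proof (cases "S \<le> k")
    case True
    have u0: "0 \<le> u (k - S)" using u_bounds(1)[of "k - S"] assms by linarith
    have "H (int k - int S) = G (k - S) * u (k - S)"
      using True assms by (auto simp: H_def nat_diff_distrib)
    then have "cmod b * H (int k - int S) = (cmod b * G (k - S)) * u (k - S)" by simp
    also have "\<dots> \<le> (d * G k) * u (k - S)"
      using G_step[OF True assms(2)] u0 by (intro mult_right_mono) (simp_all add: d_def)
    also have "\<dots> \<le> (d * G k) * (u k - 2 * (1 + M * cmod a) / d)"
    proof (rule mult_left_mono)
      have "slope / (real k * (real n - real k)) = 2 * (1 + M * cmod a) / d"
      proof -
        have "x / 2 / y = 2 * x / (4 * y)" for x y :: real by simp
        then show ?thesis unfolding d_def by blast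
      qed
      then show "u (k - S) \<le> u k - 2 * (1 + M * cmod a) / d"
        using u_step[OF True assms(2)] by linarith
      show "0 \<le> d * G k" using d0 Gp by simp
    qed
    also have "\<dots> = d * (G k * u k) - 2 * (1 + M * cmod a) * G k"
      using d0 by (simp add: field_simps)
    finally have "cmod a * H (int k + int R) + cmod b * H (int k - int S) \<le> d * (G k * u k) - 2 * G k"
      using A by (simp add: algebra_simps)
    \<comment> \<open>Of the amount freed by \<open>u\<close>, the part with \<open>cmod a\<close>
      has cancelled the term with \<open>k + R\<close>; the remaining \<open>2 * G k\<close> covers
      \<open>G k * u k\<close> since \<open>u k \<le> 2\<close>.\<close>
    also have "\<dots> \<le> d * (G k * u k) - G k * u k" using ub Gp by simp
    finally show ?thesis by (simp add: d_def algebra_simps)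
  next
    case False
    then have "H (int k - int S) = cmod a / n" by (simp add: H_def)
    \<comment> \<open>For \<open>k < S\<close> the upward step starts left of 0, off the direct
      path. Its contribution is dominated because \<open>G k\<close> is still at least the first
      step cost, of order \<open>cmod b / (S * n)\<close>.\<close>
    moreover have "cmod a * cmod b / n \<le> real n * G k"
    proof -
      have kd: "k div S = 0" "k mod S \<noteq> 0" "k \<le> n - S" using False assms n_bounds(8) S_pos by auto
      have gk: "e (Suc 0) \<le> G k" using G_bounds_le(2)[OF kd(3) kd(2)] kd by (simp add: g_def)
      have "cmod a \<le> real n / (4 * real S)" using n_bounds(1) S_pos n0 by (simp add: field_simps)
      then have "cmod a * cmod b / n \<le> real n / (4 * real S) * cmod b / n"
        using n0 by (intro divide_right_mono mult_right_mono) auto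
      also have "\<dots> = real n * (cmod b / (4 * real S * real n))" using n0 by simp
      also have "\<dots> \<le> real n * e (Suc 0)"
        unfolding e_def using S_pos n_bounds(5)
        by (intro mult_left_mono divide_left_mono) (auto intro!: mult_pos_pos)
      also have "\<dots> \<le> real n * G k" using gk n0 by simp
      finally show ?thesis .
    qed
    ultimately have "cmod a * H (int k + int R) + cmod b * H (int k - int S) \<le> cmod a * (2 * M * G k) + real n * G k"
      using A by (intro add_mono) (auto simp: mult.commute)
    also have "\<dots> = (4 * (real S * cmod a) + real n) * G k" by (simp add: algebra_simps M_def)
    also have "\<dots> \<le> (d - 1) * G k"
      using d n_bounds(1,6) Gp by (intro mult_right_mono) linarith+
    also have "\<dots> \<le> (d - 1) * (G k * u k)"
      using d n_bounds(6) Gp ub by (intro mult_left_mono) auto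
    finally show ?thesis by (simp add: d_def)
  qed
qed

lemma supersol_H: "supersol H"
  unfolding supersol_def
proof (intro conjI allI impI)
  show "H 0 \<ge> 1" using n_bounds(5,6) by (simp add: H_def G_def u_def)
  fix k assume k: "k \<noteq> 0" "k \<noteq> int n"
  consider "k < 0" | "k > int n" | "0 < k" "k < int n" using k by linarith
  then show "step_sum H k \<le> (4 * gap n k - 1) * H k"
  proof cases
    case 3
    then show ?thesis using supersol_H_mid[of "nat k"] by (simp add: H_def)
  qed (use supersol_H_neg supersol_H_gt in auto)
qed (rule H_nonneg)

text \<open>The two indices share one path between them: inside by \<open>G_prod\<close>, outside
  because one factor is already of the order of the full path. This bound gives
  \<open>Q_bound\<close> its factor \<open>sqrt (g (p - 1))\<close>.\<close>

lemma H_prod: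
  assumes "k \<noteq> 0" "k \<noteq> int n"
  shows "H k * H (int n - k) \<le> 4 * M\<^sup>2 * g (p - 1)"
proof -
  have gp: "g (p - 1) > 0" using p_ge by (intro g_pos) auto
  have an: "cmod a / real n \<le> 1" using n_bounds(3,6) norms_nonneg
      by (subst divide_le_eq_1_pos) linarith+
  have out: "H j * H (int n - j) \<le> 4 * M\<^sup>2 * g (p - 1)" if "j < 0" for j
  proof -
    have "H j * H (int n - j) = (cmod a / n) * (2 * M * cmod b * g (p - 1) / n)"
      using that by (simp add: H_def)
    also have "\<dots> \<le> 1 * g (p - 1)" using an H_top gp M_ge by (intro mult_mono) auto
    also have "1 * g (p - 1) \<le> 4 * M\<^sup>2 * g (p - 1)"
      using gp M_ge one_le_power[of M 2] by (intro mult_right_mono) linarith+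
    finally show ?thesis .
  qed
  consider "k < 0" | "k > int n" | "0 < k" "k < int n" using assms by linarith
  then show ?thesis
  proof cases
    case 2
    then show ?thesis using out[of "int n - k"] by (simp add: mult.commute)
  next
    case 3
    define j where "j = nat k"
    have j: "k = int j" "0 < j" "j < n" using 3 by (auto simp: j_def)
    have "H (int j) * H (int (n - j)) \<le> (2 * G j) * (2 * G (n - j))"
      using j G_pos[of j] by (intro mult_mono H_le_2G H_nonneg) auto
    also have "\<dots> \<le> 4 * (M\<^sup>2 * g (p - 1))" using G_prod[OF j(2,3)] by simp
    finally show ?thesis using j by (simp add: of_nat_diff)
  qed (use out in auto)
qed

end

section \<open>Asymptotics of the off-diagonal coefficient\<close>

lemma summable_on_mult_bounded:
  fixes f h :: "'i \<Rightarrow> complex"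
  assumes "(\<lambda>k. cmod (f k)) summable_on A" "\<And>k. k \<in> A \<Longrightarrow> cmod (h k) \<le> C"
  shows "(\<lambda>k. f k * h k) summable_on A" "(\<lambda>k. cmod (f k * h k)) summable_on A"
proof -
  have "(\<lambda>k. cmod (f k) * C) summable_on A"
    by (intro summable_on_cmult_left assms)
  then show "(\<lambda>k. cmod (f k * h k)) summable_on A"
    by (rule summable_on_comparison_test) (auto simp: norm_mult intro!: mult_left_mono assms)
  then show "(\<lambda>k. f k * h k) summable_on A" by (rule abs_summable_summable)
qed

lemma bij_int_shift: "bij (\<lambda>k::int. k + c)" and bij_int_reflect: "bij (\<lambda>k::int. c - k)"
  by (rule bij_betw_byWitness[of _ "\<lambda>k. k - c"], auto)
     (rule bij_betw_byWitness[of _ "\<lambda>k. c - k"], auto)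

lemma infsum_int_shift: "infsum (\<lambda>k::int. f (k + c)) UNIV = infsum f UNIV"
  using infsum_reindex_bij_betw[OF bij_int_shift] .

lemma infsum_int_reflect: "infsum (\<lambda>k::int. f (c - k)) UNIV = infsum f UNIV"
  using infsum_reindex_bij_betw[OF bij_int_reflect] .

lemma summable_int_shift: "(\<lambda>k::int. f (k + c)) summable_on UNIV \<longleftrightarrow> f summable_on UNIV"
  using summable_on_reindex_bij_betw[OF bij_int_shift] .

lemma summable_int_reflect: "(\<lambda>k::int. f (c - k)) summable_on UNIV \<longleftrightarrow> f summable_on UNIV"
  using summable_on_reindex_bij_betw[OF bij_int_reflect] .

context hill_seq
begin

text \<open>\<open>beta\<close> and \<open>alpha\<close> are the right-hand sides of the resonant
  equations at \<open>n\<close> and at 0, evaluated on \<open>phi z\<close>: the off-diagonal and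
  diagonal entries in one column of the effective 2 by 2 matrix.\<close>

definition beta :: "complex \<Rightarrow> complex" where
  "beta z = a * phi z (int n + int R) + b * phi z (int n - int S)"

definition alpha :: "complex \<Rightarrow> complex" where
  "alpha z = a * phi z (int R) + b * phi z (- int S)"

definition cstep :: "nat \<Rightarrow> complex" where
  "cstep i = b / (4 * (of_nat i * of_nat S) * (of_nat n - of_nat i * of_nat S))"

definition cweight :: "nat \<Rightarrow> complex" where "cweight q = (\<Prod>i=1..q. cstep i)"

text \<open>The direct path has \<open>p\<close> steps but only \<open>p - 1\<close> denominators,
  since the last step arrives at the resonant index \<open>n\<close>.\<close>

definition lead :: complex where "lead = b * cweight (p - 1)"

lemma cmod_cstep:
  assumes "1 \<le> i" "i < p"
  shows "cmod (cstep i) = e i"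
proof -
  have "4 * (of_nat i * of_nat S) * (of_nat n - of_nat i * of_nat S) = complex_of_real (4 * (real i * real S) * (real n - real i * real S))"
    by simp
  moreover have "4 * (real i * real S) * (real n - real i * real S) > 0"
    using e_bounds(4)[OF assms] by (simp add: mult.assoc)
  ultimately have "cmod (4 * (of_nat i * of_nat S) * (of_nat n - of_nat i * of_nat S)) = 4 * (real i * real S) * (real n - real i * real S)"
    by (simp only: norm_of_real abs_of_pos)
  then show ?thesis by (simp only: cstep_def e_def norm_divide)
qed

lemma cmod_cweight: "q < p \<Longrightarrow> cmod (cweight q) = g q"
  unfolding cweight_def g_def by (auto simp: prod_norm[symmetric] cmod_cstep intro!: prod.cong)

lemma cmod_lead: "cmod lead = cmod b * g (p - 1)"
  using cmod_cweight[of "p - 1"] p_ge by (simp add: lead_def norm_mult)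

lemma lead_nz: "lead \<noteq> 0"
proof -
  have "cmod lead > 0" unfolding cmod_lead using g_pos[of "p-1"] p_ge b_nz by simp
  then show ?thesis by auto
qed

lemma G_multiple: "q < p \<Longrightarrow> G (q * S) = g q"
proof -
  assume "q < p"
  then have "q * S \<le> (p - 1) * S" by (intro mult_right_mono) auto
  also have "(p - 1) * S = n - S" using n_eq(1) by (simp add: algebra_simps)
  finally show ?thesis using S_pos by (simp add: G_def)
qed

text \<open>Dividing \<open>phi\<close> by the path weights turns the direct path into the constant
  1. The change over one step comes only from the term with \<open>k + R\<close> and from
  \<open>z\<close>; the supersolution bounds both by multiples of \<open>g (Suc q)\<close>, so the
  error is relative.\<close>

lemma chain_step:
  assumes z: "cmod z \<le> 1" and q: "Suc q < p"
  shows "cmod (phi z (int (Suc q * S)) / cweight (Suc q) - phi z (int (q * S)) / cweight q)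
     \<le> slope * (1 / (real (Suc q * S) * (real n - real (Suc q * S))))"
proof -
  define k where "k = Suc q * S"
  define d :: complex where "d = 4 * (of_nat (Suc q) * of_nat S) * (of_nat n - of_nat (Suc q) * of_nat S)"
  define d' where "d' = real k * (real n - real k)"
  have d'0: "d' > 0" using e_bounds(4)[OF _ q] by (simp add: d'_def k_def algebra_simps)
  have k: "0 < k" "k < n" 
  proof -
    have "real n - real k > 0" "real k > 0" using d'0 by (auto simp: d'_def zero_less_mult_iff)
    then show "0 < k" "k < n" by simp_all
  qed
  have dd: "d = of_real (4 * d')" by (simp add: d_def d'_def k_def algebra_simps)
  have nd: "cmod d = 4 * d'" unfolding dd norm_of_real using d'0 by simp
  have d0: "d \<noteq> 0" using d'0 by (auto simp: dd)
  have gq: "g (Suc q) > 0" by (rule g_pos[OF q])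
  have gcq: "cweight (Suc q) \<noteq> 0" using cmod_cweight[OF q] gq by auto
  have gc': "cweight (Suc q) = cweight q * cstep (Suc q)" by (simp add: cweight_def)
  then have gcq': "cweight q \<noteq> 0" using gcq by auto
  have cstep: "d * cstep (Suc q) = b" using d0 by (simp add: cstep_def d_def)
  have Dk: "D z (int k) = d + z" by (simp add: D_def d_def k_def algebra_simps)
  have e: "int k - int S = int (q * S)" by (simp add: k_def)
  have "D z (int k) * phi z (int k) = a * phi z (int k + int R) + b * phi z (int (q * S))"
    using phi_eq[OF z, of "int k"] k unfolding e by simp
  then have "d * phi z (int k) - b * phi z (int (q * S)) = a * phi z (int k + int R) - z * phi z (int k)"
    unfolding Dk by (simp add: algebra_simps)
  moreover have "phi z (int k) / cweight (Suc q) - phi z (int (q * S)) / cweight q = (d * phi z (int k) - b * phi z (int (q * S))) / (d * cweight (Suc q))"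
    using d0 gcq gcq' cstep unfolding gc' by (auto simp: field_simps)
  ultimately have "cmod (phi z (int k) / cweight (Suc q) - phi z (int (q * S)) / cweight q) = cmod (a * phi z (int k + int R) - z * phi z (int k)) / (4 * d' * g (Suc q))"
    using cmod_cweight[OF q] nd by (simp add: norm_divide norm_mult)
  also have "\<dots> \<le> (2 * (1 + M * cmod a) * g (Suc q)) / (4 * d' * g (Suc q))"
  proof (rule divide_right_mono)
    have "cmod (a * phi z (int k + int R) - z * phi z (int k)) \<le> cmod a * cmod (phi z (int k + int R)) + cmod z * cmod (phi z (int k))"
      by (rule order_trans[OF norm_triangle_ineq4]) (simp add: norm_mult)
    also have "\<dots> \<le> cmod a * (2 * M * G k) + 1 * (2 * G k)"
      by (intro add_mono mult_mono z mult_left_mono order_trans[OF phi_le[OF supersol_H z] H_ahead[OF k(2)]]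
          order_trans[OF phi_le[OF supersol_H z] H_le_2G[OF k(2)]]) auto
    also have "G k = g (Suc q)" unfolding k_def by (rule G_multiple[OF q])
    finally show "cmod (a * phi z (int k + int R) - z * phi z (int k)) \<le> 2 * (1 + M * cmod a) * g (Suc q)"
      by (simp add: algebra_simps)
  qed (use d'0 gq in auto)
  also have "\<dots> = slope * (1 / d')" using gq d'0 by (simp add: field_simps)
  finally show ?thesis unfolding k_def d'_def .
qed

text \<open>The relative errors of \<open>chain_step\<close> add up to at most
  \<open>slope * recip_sum n\<close>, hence to 1/4. The other term of \<open>beta\<close>, arriving
  from above \<open>n\<close>, costs a further 1/4 by the last clause of \<open>H\<close>.\<close>

lemma beta_close:
  assumes z: "cmod z \<le> 1"
  shows "cmod (beta z - lead) \<le> 1/2 * cmod lead"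
proof -
  define f where "f k = 1 / (real k * (real n - real k))" for k
  define x where "x q = phi z (int (q * S)) / cweight q" for q
  have gp: "g (p - 1) > 0" using p_ge by (intro g_pos) auto
  have Ma: "0 \<le> slope" using M_ge by simp
  have sums: "cmod (x q - 1) \<le> slope * (\<Sum>i=1..q. f (i * S))" if "q < p" for q
    using that
  proof (induction q)
    case 0
    then show ?case using z by (simp add: x_def cweight_def)
  next
    case (Suc q)
    have "cmod (x (Suc q) - 1) \<le> cmod (x (Suc q) - x q) + cmod (x q - 1)"
      by (metis diff_add_cancel add_diff_eq norm_triangle_ineq)
    also have "\<dots> \<le> slope * f (Suc q * S) + slope * (\<Sum>i=1..q. f (i * S))"
      using chain_step[OF z Suc.prems] Suc by (intro add_mono) (auto simp: x_def f_def)
    finally show ?case by (simp add: algebra_simps)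
  qed
  have "(\<Sum>i=1..p-1. f (i * S)) = (\<Sum>k\<in>(\<lambda>i. i * S) ` {1..p-1}. f k)"
    using S_pos by (subst sum.reindex) (auto simp: inj_on_def)
  also have "\<dots> \<le> (\<Sum>k=1..n-1. f k)"
  proof (rule sum_mono2)
    show "(\<lambda>i. i * S) ` {1..p - 1} \<subseteq> {1..n - 1}"
    proof clarify
      fix i assume i: "i \<in> {1..p-1}"
      have "i * S \<le> (p - 1) * S" using i by (intro mult_right_mono) auto
      also have "(p - 1) * S = n - S" using n_eq(1) by (simp add: algebra_simps)
      finally show "i * S \<in> {1..n - 1}" using i S_pos by (simp add: Suc_le_eq)
    qed
    show "0 \<le> f k" if "k \<in> {1..n-1} - (\<lambda>i. i * S) ` {1..p - 1}" for k
      using that by (auto simp: f_def)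
  qed auto
  also have "\<dots> \<le> recip_sum n" unfolding f_def using n_bounds(6) by (intro partial_recip_sum) auto
  finally have "slope * (\<Sum>i=1..p-1. f (i * S)) \<le> slope * recip_sum n"
    using Ma by (intro mult_left_mono)
  also have "4 * (slope * recip_sum n) = (2 * (1 + M * cmod a)) * recip_sum n" by simp
  then have "slope * recip_sum n \<le> 1/4"
  proof -
    have "(2 * (1 + M * cmod a)) * recip_sum n \<le> 1"
    proof (rule recip_small')
      show "2 * (1 + M * cmod a) \<le> budget" using pos_facts
        unfolding M_def by argo
    qed
    then show ?thesis by argo
  qed
  finally have x1: "cmod (x (p - 1) - 1) \<le> 1/4" using sums[of "p - 1"] p_ge by simp
  have gcp: "cweight (p - 1) \<noteq> 0" using cmod_cweight[of "p - 1"] gp p_ge by auto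
  have nS: "int n - int S = int ((p - 1) * S)"
    using n_eq(1) n_bounds(5) by (simp add: algebra_simps of_nat_diff)
  have "beta z - lead = a * phi z (int n + int R) + lead * (x (p - 1) - 1)"
    unfolding beta_def nS x_def lead_def using gcp by (simp add: algebra_simps)
  then have "cmod (beta z - lead) \<le> cmod a * cmod (phi z (int n + int R)) + cmod lead * cmod (x (p - 1) - 1)"
    using norm_triangle_ineq[of "a * phi z (int n + int R)" "lead * (x (p - 1) - 1)"] by (simp add: norm_mult)
  also have "\<dots> \<le> 1/4 * cmod lead + cmod lead * (1/4)"
  proof (intro add_mono mult_left_mono x1)
    have "cmod a * cmod (phi z (int n + int R)) \<le> cmod a * H (int n + int R)"
      by (intro mult_left_mono phi_le[OF supersol_H z]) auto
    also have "H (int n + int R) = 2 * M * cmod b * g (p - 1) / n" using R_pos by (simp add: H_def)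
    also have "cmod a * (2 * M * cmod b * g (p - 1) / n) = (2 * M * cmod a / n) * cmod lead"
      by (simp add: cmod_lead)
    also have "\<dots> \<le> 1/4 * cmod lead"
      using n_bounds(1,6) by (intro mult_right_mono) (auto simp: M_def divide_simps)
    finally show "cmod a * cmod (phi z (int n + int R)) \<le> 1/4 * cmod lead" .
  qed auto
  finally show ?thesis by simp
qed

lemma alpha_small:
  assumes "cmod z \<le> 1"
  shows "cmod (alpha z) \<le> 1/2"
proof -
  have "cmod (alpha z) \<le> cmod a * cmod (phi z (int R)) + cmod b * cmod (phi z (- int S))"
    unfolding alpha_def by (rule order_trans[OF norm_triangle_ineq]) (simp add: norm_mult)
  also have "\<dots> \<le> cmod a * ((cmod a + cmod b) / (3 * (real n - 1))) + cmod b * ((cmod a + cmod b) / (3 * (real n - 1)))"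
    using R_pos S_pos n_bounds(4) by (intro add_mono mult_left_mono phi_decay(2) assms) auto
  also have "\<dots> = (cmod a + cmod b)\<^sup>2 / (3 * (real n - 1))"
    by (simp add: power2_eq_square flip: distrib_right add_divide_distrib)
  also have "\<dots> \<le> 1/2"
  proof -
    have "(cmod a + cmod b)\<^sup>2 \<le> (1 + cmod a + cmod b)\<^sup>2" by (intro power_mono) auto
    then have "(cmod a + cmod b)\<^sup>2 \<le> (real n - 1)" using n_big2 n_bounds(6) by linarith
    then show ?thesis using n_bounds(6) by (simp add: divide_simps)
  qed
  finally show ?thesis .
qed

lemma lead_small: "cmod lead \<le> 1/4"
proof -
  have "g (p - 1) \<le> g 1" using p_ge by (intro g_mono) auto
  also have "g 1 = e 1" by (simp add: g_def)
  also have "e 1 \<le> cmod b / (4 * (real n - 1))"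
  proof -
    have "real 1 * real S * (real n - real 1 * real S) \<ge> real n - 1"
      using p_ge by (intro e_bounds(3)) auto
    then show ?thesis unfolding e_def using n_bounds(6)
      by (intro divide_left_mono mult_pos_pos) (use S_pos n_bounds(5) in \<open>auto simp: mult.assoc\<close>)
  qed
  finally have "cmod lead \<le> cmod b * (cmod b / (4 * (real n - 1)))"
    unfolding cmod_lead by (intro mult_left_mono) auto
  also have "\<dots> \<le> 1/4"
  proof -
    have "(cmod b)\<^sup>2 \<le> (1 + cmod a + cmod b)\<^sup>2" by (intro power_mono) auto
    then have "(cmod b)\<^sup>2 \<le> (real n - 1)" using n_big2 n_bounds(6) by linarith
    then show ?thesis using n_bounds(6) by (simp add: divide_simps power2_eq_square)
  qed
  finally show ?thesis .
qed

lemma beta_bounds: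
  assumes "cmod z \<le> 1"
  shows "cmod (beta z) \<ge> 1/2 * cmod lead" "cmod (beta z) \<le> 3/2 * cmod lead" "beta z \<noteq> 0"
    "cmod (beta z / lead - 1) \<le> 1/2"
proof -
  show 1: "cmod (beta z) \<ge> 1/2 * cmod lead" "cmod (beta z) \<le> 3/2 * cmod lead"
    using beta_close[OF assms] norm_triangle_ineq2[of lead "beta z"] norm_triangle_ineq2[of "beta z" lead]
    by (simp_all add: norm_minus_commute)
  show "beta z \<noteq> 0" using 1 lead_nz by auto
  have "beta z / lead - 1 = (beta z - lead) / lead" using lead_nz by (simp add: field_simps)
  then show "cmod (beta z / lead - 1) \<le> 1/2"
    using beta_close[OF assms] lead_nz by (simp add: norm_divide divide_simps)
qed

lemma alpha_continuous: "continuous_on (cball 0 1) alpha"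
  unfolding alpha_def[abs_def] by (intro continuous_intros phi_continuous)

lemma beta_continuous: "continuous_on (cball 0 1) beta"
  unfolding beta_def[abs_def] by (intro continuous_intros phi_continuous)

text \<open>The quotient \<open>beta z / lead\<close> stays within 1/2 of 1, away from the branch
  cut, so its principal root is continuous, while the root of \<open>lead\<close> is a constant. The
  bound 2/3 suffices since \<open>cmod (beta z) \<le> 3/8\<close>.\<close>

lemma sqrt_beta:
  obtains s where "continuous_on (cball 0 1) s" "\<And>z. cmod z \<le> 1 \<Longrightarrow> (s z)\<^sup>2 = beta z"
    "\<And>z. cmod z \<le> 1 \<Longrightarrow> cmod (s z) \<le> 2/3"
proof
  let ?s = "\<lambda>z. csqrt lead * csqrt (beta z / lead)"
  have Re: "Re (beta z / lead) > 0" if "cmod z \<le> 1" for z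
  proof -
    have "\<bar>Re (beta z / lead - 1)\<bar> \<le> 1/2" by (rule order_trans[OF abs_Re_le_cmod beta_bounds(4)[OF that]])
    then show ?thesis unfolding minus_complex.sel one_complex.sel by argo
  qed
  have "continuous_on {w. Re w > 0} csqrt"
    by (rule continuous_on_subset[OF continuous_on_csqrt]) (auto simp: complex_nonpos_Reals_iff)
  then have "continuous_on (cball 0 1) (\<lambda>z. csqrt (beta z / lead))"
    by (rule continuous_on_compose2)
       (use Re lead_nz in \<open>auto intro!: continuous_intros beta_continuous\<close>)
  then show "continuous_on (cball 0 1) ?s" by (intro continuous_intros)
  show sq: "(?s z)\<^sup>2 = beta z" if "cmod z \<le> 1" for z using lead_nz by (simp add: power_mult_distrib)
  show "cmod (?s z) \<le> 2/3" if "cmod z \<le> 1" for z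
  proof -
    have "(cmod (?s z))\<^sup>2 = cmod (beta z)" using sq[OF that] by (metis norm_power)
    also have "\<dots> \<le> (2/3)\<^sup>2" using beta_bounds(2)[OF that] lead_small by (simp add: power2_eq_square)
    finally show ?thesis by (rule power2_le_imp_le) simp
  qed
qed

definition Q :: "complex \<Rightarrow> complex" where
  "Q z = self_conv n (phi z)"

text \<open>Each summand has two bounds, \<open>H_prod\<close> and the square of the decay
  \<open>C / gap n k\<close>. Their geometric mean keeps a square root of the path weight and is
  still summable, with sum \<open>recip_sum\<close>. The resonant summands vanish since
  \<open>phi z n = 0\<close>.\<close>

lemma Q_bound:
  assumes z: "cmod z \<le> 1"
  shows "(\<lambda>k. phi z k * phi z (int n - k)) summable_on UNIV"
    and "cmod (Q z) \<le> 2 * M * sqrt (g (p - 1)) * ((cmod a + cmod b) / 3) * recip_sum n"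
proof -
  let ?f = "\<lambda>k. phi z k * phi z (int n - k)"
  show s: "?f summable_on UNIV" by (intro summable_on_mult_bounded(1)[OF phi_sum(3)[OF z] phi_le_1[OF z]])
  have sa: "(\<lambda>k. cmod (?f k)) summable_on -{0, int n}"
    by (rule summable_on_subset_banach[OF summable_on_mult_bounded(2)[OF phi_sum(3)[OF z] phi_le_1[OF z]]]) auto
  define C where "C = (cmod a + cmod b) / 3"
  let ?r = "\<lambda>k. 1 / gap n k :: real"
  have gp: "g (p - 1) > 0" using p_ge by (intro g_pos) auto
  have tm: "cmod (?f k) \<le> (2 * M * sqrt (g (p - 1)) * C) * ?r k" if "k \<in> -{0, int n}" for k
  proof -
    have k: "k \<noteq> 0" "k \<noteq> int n" "int n - k \<noteq> 0" "int n - k \<noteq> int n" using that by auto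
    have 1: "cmod (?f k) \<le> 4 * M\<^sup>2 * g (p - 1)"
      unfolding norm_mult
      by (rule order_trans[OF mult_mono[OF phi_le[OF supersol_H z] phi_le[OF supersol_H z]] H_prod[OF k(1,2)]])
         (auto intro: H_nonneg)
    have 2: "cmod (?f k) \<le> (C * ?r k) * (C * ?r k)"
      unfolding norm_mult
      using phi_decay(1)[OF z k(1,2)] phi_decay(1)[OF z k(3,4)]
      by (intro mult_mono) (auto simp: C_def mult.commute)
    have "(cmod (?f k))\<^sup>2 = cmod (?f k) * cmod (?f k)" by (rule power2_eq_square)
    also have "\<dots> \<le> (4 * M\<^sup>2 * g (p - 1)) * ((C * ?r k) * (C * ?r k))"
      using 1 2 gp by (intro mult_mono) auto
    also have "\<dots> = ((2 * M * sqrt (g (p - 1)) * C) * ?r k)\<^sup>2"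
    proof -
      have "(4 * M\<^sup>2 * g (p - 1)) * ((C * x) * (C * x)) = ((2 * M * sqrt (g (p - 1)) * C) * x)\<^sup>2" for x
        using gp by (simp add: power_mult_distrib power2_eq_square)
      then show ?thesis .
    qed
    finally show ?thesis
      by (rule power2_le_imp_le) (use gp M_ge in \<open>auto simp: C_def\<close>)
  qed
  have "Q z = infsum ?f (-{0, int n})"
    unfolding Q_def by (rule infsum_cong_neutral) (use z in auto)
  also have "cmod \<dots> \<le> infsum (\<lambda>k. cmod (?f k)) (-{0, int n})"
    by (rule norm_infsum_bound[OF sa])
  also have "\<dots> \<le> infsum (\<lambda>k. (2 * M * sqrt (g (p - 1)) * C) * ?r k) (-{0, int n})"
    using n_bounds(6) by (intro infsum_mono sa summable_on_cmult_right recip_summable(1) tm) auto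
  also have "\<dots> = (2 * M * sqrt (g (p - 1)) * C) * recip_sum n"
    unfolding recip_sum_def by (rule infsum_cmult_right')
  finally show "cmod (Q z) \<le> 2 * M * sqrt (g (p - 1)) * ((cmod a + cmod b) / 3) * recip_sum n"
    by (simp add: C_def)
qed

lemma phi_sum_small:
  assumes "cmod z \<le> 1"
  shows "tail_sum (phi z) \<le> 1/4"
proof -
  have "(4 * ((cmod a + cmod b) / 3)) * recip_sum n \<le> 1"
  proof (rule recip_small')
    show "4 * ((cmod a + cmod b) / 3) \<le> budget" using pos_facts
      by argo
  qed
  then show ?thesis using phi_sum(2)[OF assms] by argo
qed

end

section \<open>The two-mode reduction\<close>

text \<open>\<open>sw\<close> is the problem seen after \<open>k \<mapsto> n - k\<close>. Thus
  \<open>sw.phi z (int n - k)\<close> is the solution with value 0 at 0 and 1 at \<open>n\<close>,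
  and \<open>sw.beta\<close> leads from \<open>n\<close> back to 0.\<close>

locale hill_pair = hill_seq R S n a b + sw: hill_seq S R n b a for R S n a b
begin

lemma D_sym: "D z (int n - k) = D z k"
  by (simp add: D_def)

text \<open>A Green identity: unreflected, \<open>sw.phi z\<close> solves the transposed recurrence.
  Multiplying the two recurrences crosswise and summing, the shifts cancel and so do all nonresonant
  terms; at \<open>n\<close> both functions vanish, so the single term at 0 has to vanish too, and
  it is the difference of the two coefficients.\<close>

lemma alpha_eq:
  assumes z: "cmod z \<le> 1"
  shows "sw.alpha z = alpha z"
proof -
  note s1 = phi_sum(3)[OF z] and s2 = sw.phi_sum(3)[OF z]
  define f where "f k = a * (phi z (k + int R) * sw.phi z k) + b * (phi z (k - int S) * sw.phi z k)" for k
  define h where "h k = a * (phi z k * sw.phi z (k - int R)) + b * (phi z k * sw.phi z (k + int S))" for k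
  note m = summable_on_mult_bounded(1)
  have t1: "(\<lambda>k. phi z (k + c) * sw.phi z k) summable_on UNIV" for c
    by (rule m[of _ _ _ 1]) (use s1 z in \<open>auto simp: summable_int_shift[of "\<lambda>k. cmod (phi z k)"] sw.phi_le_1\<close>)
  have t2: "(\<lambda>k. phi z k * sw.phi z (k + c)) summable_on UNIV" for c
    by (rule m[of _ _ _ 1]) (use s1 z in \<open>auto simp: sw.phi_le_1\<close>)
  have i: "infsum (\<lambda>k. phi z (k + c) * sw.phi z k) UNIV = infsum (\<lambda>k. phi z k * sw.phi z (k - c)) UNIV" for c
    using infsum_int_shift[of "\<lambda>k. phi z k * sw.phi z (k - c)" c] by simp
  have sf: "f summable_on UNIV" and sh: "h summable_on UNIV"
    unfolding f_def h_def using t1[of "- int S"] t1[of "int R"] t2[of "- int R"] t2[of "int S"]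
    by (auto intro!: summable_on_add summable_on_cmult_right)
  have "infsum f UNIV = infsum h UNIV"
    unfolding f_def h_def using t1[of "- int S"] t1[of "int R"] t2[of "- int R"] t2[of "int S"] i[of "int R"] i[of "- int S"]
    by (simp add: infsum_add infsum_cmult_right' summable_on_cmult_right)
  then have "infsum (\<lambda>k. f k - h k) UNIV = 0"
    using infsum_add[of f UNIV "\<lambda>k. - h k"] sf sh by (simp add: infsum_uminus summable_on_uminus)
  moreover have "infsum (\<lambda>k. f k - h k) UNIV = infsum (\<lambda>k. f k - h k) {0}"
  proof (rule infsum_cong_neutral)
    fix k assume "k \<in> UNIV - {0::int}"
    then have k: "k \<noteq> 0" by simp
    show "f k - h k = 0"
    proof (cases "k = int n")
      case True
      then show ?thesis using z by (simp add: f_def h_def)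
    next
      case False
      have "f k = (D z k * phi z k) * sw.phi z k"
        using phi_eq[OF z k False] by (simp add: f_def algebra_simps)
      moreover have "h k = (D z k * sw.phi z k) * phi z k"
        using sw.phi_eq[OF z k False] by (simp add: h_def D_sym algebra_simps)
      ultimately show ?thesis by simp
    qed
  qed auto
  ultimately have "f 0 = h 0" by simp
  then show ?thesis using z by (simp add: f_def h_def alpha_def sw.alpha_def add.commute)
qed

text \<open>Brouwer's theorem needs only continuity in \<open>z\<close>, so analytic dependence is never used.\<close>

lemma root_exists:
  obtains z \<rho> where "cmod z \<le> 1" "z = alpha z + sw.beta z * \<rho>" "sw.beta z * \<rho>\<^sup>2 = beta z"
proof -
  obtain s where s: "continuous_on (cball 0 1) s" "\<And>z. cmod z \<le> 1 \<Longrightarrow> (s z)\<^sup>2 = beta z"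
    "\<And>z. cmod z \<le> 1 \<Longrightarrow> cmod (s z) \<le> 2/3" using sqrt_beta by blast
  obtain t where t: "continuous_on (cball 0 1) t" "\<And>z. cmod z \<le> 1 \<Longrightarrow> (t z)\<^sup>2 = sw.beta z"
    "\<And>z. cmod z \<le> 1 \<Longrightarrow> cmod (t z) \<le> 2/3" using sw.sqrt_beta by blast
  have "continuous_on (cball 0 1) (\<lambda>z. alpha z + s z * t z)"
    by (intro continuous_intros alpha_continuous s t)
  moreover have "(\<lambda>z. alpha z + s z * t z) \<in> cball 0 1 \<rightarrow> cball 0 1"
  proof
    fix z :: complex assume "z \<in> cball 0 1"
    then have z: "cmod z \<le> 1" by simp
    have "cmod (alpha z + s z * t z) \<le> cmod (alpha z) + cmod (s z) * cmod (t z)"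
      using norm_triangle_ineq[of "alpha z" "s z * t z"] by (simp add: norm_mult)
    \<comment> \<open>The total is 17/18; the constants in \<open>alpha_small\<close> and
      \<open>sqrt_beta\<close> are chosen to keep the map inside the unit ball.\<close>
    also have "\<dots> \<le> 1/2 + 2/3 * (2/3)"
      by (intro add_mono mult_mono alpha_small s t z) auto
    finally show "alpha z + s z * t z \<in> cball 0 1" by simp
  qed
  ultimately obtain z where z: "z \<in> cball 0 1" "alpha z + s z * t z = z"
    using brouwer_ball[of 1 0 "\<lambda>z. alpha z + s z * t z"] by auto
  have z1: "cmod z \<le> 1" using z by simp
  have t0: "t z \<noteq> 0" using t(2)[OF z1] sw.beta_bounds(3)[OF z1] by auto
  show thesis
  proof (rule that[OF z1])
    \<comment> \<open>With the quotient of the roots as \<open>\<rho>\<close>, the product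
      \<open>sw.beta z * \<rho>\<close> is \<open>s z * t z\<close>, so the fixed-point equation is
      the first claim.\<close>
    show "z = alpha z + sw.beta z * (s z / t z)"
      using z t0 by (simp add: t(2)[OF z1, symmetric] power2_eq_square mult.commute)
    show "sw.beta z * (s z / t z)\<^sup>2 = beta z"
      using t0 by (simp add: t(2)[OF z1, symmetric] s(2)[OF z1, symmetric] power_divide)
  qed
qed

text \<open>The parameter \<open>r\<close> is \<open>cmod \<rho>\<close> here and
  \<open>1 / cmod \<rho>\<close> for the exchanged problem. Since
  \<open>cmod sw.lead \<le> cmod a\<close>, the hypothesis bounds \<open>sqrt (g (p - 1))\<close> by
  a multiple of \<open>r\<close>, and \<open>pair_small\<close> absorbs the constants.\<close>

lemma Q_le:
  assumes z: "cmod z \<le> 1" and r: "0 \<le> r" and lr: "cmod lead \<le> 3 * r\<^sup>2 * cmod sw.lead"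
  shows "cmod (Q z) \<le> r / 4"
proof -
  define c where "c = (cmod a + cmod b) / 3"
  have c0: "c \<ge> 0" by (simp add: c_def)
  have ap: "cmod a > 0" "cmod b > 0" using a_nz b_nz by auto
  have gp: "g (p - 1) > 0" "sw.g (sw.p - 1) > 0" "sw.g (sw.p - 1) \<le> 1"
    using p_ge sw.p_ge by (auto intro!: g_pos sw.g_pos sw.g_le_1)
  have r0: "recip_sum n \<ge> 0" using n_bounds(6) by (intro recip_summable) auto
  have "sqrt (g (p - 1)) \<le> r * sqrt (3 * cmod a / cmod b)"
  proof (rule real_le_lsqrt)
    note lr
    also have "3 * r\<^sup>2 * cmod sw.lead \<le> 3 * r\<^sup>2 * cmod a"
      unfolding sw.cmod_lead using gp ap by (intro mult_left_mono) auto
    finally have "g (p - 1) \<le> r\<^sup>2 * (3 * cmod a / cmod b)"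
      unfolding cmod_lead using ap by (simp add: field_simps)
    also have "\<dots> = (r * sqrt (3 * cmod a / cmod b))\<^sup>2"
      by (simp add: power_mult_distrib)
    finally show "g (p - 1) \<le> (r * sqrt (3 * cmod a / cmod b))\<^sup>2" .
  qed (use gp r in auto)
  then have "2 * M * sqrt (g (p - 1)) * c * recip_sum n \<le> 2 * M * (r * sqrt (3 * cmod a / cmod b)) * c * recip_sum n"
    using M_ge c0 r0 by (intro mult_right_mono mult_left_mono) auto
  also have "\<dots> = (r / 12) * (16 * real S * (cmod a + cmod b) * sqrt (3 * cmod a / cmod b) * recip_sum n)"
    by (simp add: M_def c_def)
  also have "\<dots> \<le> (r / 12) * 1" using r by (intro mult_left_mono pair_small) auto
  also have "\<dots> \<le> r / 4" using r by simp
  finally show ?thesis using Q_bound(2)[OF z] by (simp add: c_def)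
qed

section \<open>Assembling the solution from both resonant indices\<close>

definition is_sol :: "complex \<Rightarrow> (int \<Rightarrow> complex) \<Rightarrow> bool" where
  "is_sol z y \<longleftrightarrow> (\<forall>k. D z k * y k = a * y (k + int R) + b * y (k - int S))"

definition ysol :: "complex \<Rightarrow> complex \<Rightarrow> int \<Rightarrow> complex" where
  "ysol z \<rho> k = phi z k + \<rho> * sw.phi z (int n - k)"

context
  fixes z \<rho> :: complex
  assumes z: "cmod z \<le> 1" and z_eq: "z = alpha z + sw.beta z * \<rho>" and rho_eq: "sw.beta z * \<rho>\<^sup>2 = beta z"
begin

lemma ysol_0: "ysol z \<rho> 0 = 1" and ysol_n: "ysol z \<rho> (int n) = \<rho>"
  using z by (simp_all add: ysol_def)

lemma sw_eq:
  assumes "k \<noteq> 0" "k \<noteq> int n"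
  shows "D z k * sw.phi z (int n - k) = a * sw.phi z (int n - (k + int R)) + b * sw.phi z (int n - (k - int S))"
  using sw.phi_eq[OF z, of "int n - k"] assms by (simp add: D_sym algebra_simps)

text \<open>Only the resonant equations need an argument. The one at 0 is \<open>z_eq\<close>; the
  one at \<open>n\<close> becomes \<open>\<rho>\<close> times the same equation, because
  \<open>alpha_eq\<close> makes the diagonal entries equal and \<open>rho_eq\<close> rewrites
  \<open>beta z\<close>.\<close>

lemma is_sol_ysol: "is_sol z (ysol z \<rho>)"
  unfolding is_sol_def
proof
  fix k
  consider "k = 0" | "k = int n" | "k \<noteq> 0" "k \<noteq> int n" by blast
  then show "D z k * ysol z \<rho> k = a * ysol z \<rho> (k + int R) + b * ysol z \<rho> (k - int S)"
  proof cases
    case 1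
    have "a * ysol z \<rho> (int R) + b * ysol z \<rho> (- int S) = alpha z + \<rho> * sw.beta z"
      by (simp add: ysol_def alpha_def sw.beta_def algebra_simps)
    also have "\<dots> = z" unfolding mult.commute[of \<rho>] by (rule z_eq[symmetric])
    finally show ?thesis using 1 by (simp add: ysol_0 D_def)
  next
    case 2
    have "a * ysol z \<rho> (int n + int R) + b * ysol z \<rho> (int n - int S) = beta z + \<rho> * sw.alpha z"
      by (simp add: ysol_def beta_def sw.alpha_def algebra_simps)
    also have "\<dots> = \<rho> * (alpha z + sw.beta z * \<rho>)"
      by (simp add: alpha_eq[OF z] rho_eq[symmetric] power2_eq_square algebra_simps)
    also have "\<dots> = z * \<rho>" unfolding z_eq[symmetric] by (rule mult.commute)
    finally show ?thesis using 2 by (simp add: ysol_n D_def)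
  next
    case 3
    then show ?thesis using phi_eq[OF z 3] sw_eq[OF 3] by (simp add: ysol_def algebra_simps)
  qed
qed

text \<open>By \<open>a_priori\<close> a bounded solution is determined by its two resonant values;
  the equation at 0 ties these together because \<open>sw.beta z\<close> is nonzero. This is
  geometric simplicity of the eigenvalue.\<close>

lemma sol_unique:
  assumes w: "is_sol z w" "bounded (range w)"
  shows "w k = w 0 * ysol z \<rho> k"
proof -
  define x where "x k = w k - w 0 * phi z k - w (int n) * sw.phi z (int n - k)" for k
  have wk: "w k = w 0 * phi z k + w (int n) * sw.phi z (int n - k)" for k
  proof -
    have "cmod (x k) \<le> 0"
    proof (rule a_priori[OF z])
      obtain C where C: "\<And>k. cmod (w k) \<le> C" using w(2) unfolding bounded_iff by auto
      have "cmod (x k) \<le> C + C * 1 + C * 1" for k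
        unfolding x_def
        by (rule order_trans[OF norm_triangle_ineq4 add_mono[OF order_trans[OF norm_triangle_ineq4 add_mono]]])
           (use C order_trans[OF norm_ge_zero C[of 0]] phi_le_1[OF z] sw.phi_le_1[OF z] in \<open>auto simp: norm_mult intro!: mult_mono[of _ C _ 1, simplified]\<close>)
      then show "bounded (range x)" unfolding bounded_iff by blast
      fix k assume k: "k \<noteq> 0" "k \<noteq> int n"
      have "D z k * w k = a * w (k + int R) + b * w (k - int S)" using w(1) by (simp add: is_sol_def)
      then have "D z k * x k - a * x (k + int R) - b * x (k - int S) = 0"
        unfolding x_def using phi_eq[OF z k] sw_eq[OF k] by (simp add: algebra_simps)
      then show "cmod (D z k * x k - a * x (k + int R) - b * x (k - int S)) \<le> 0" by simp
    qed (use z in \<open>auto simp: x_def\<close>)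
    then show ?thesis by (simp add: x_def algebra_simps)
  qed
  have "z * w 0 = a * w (int R) + b * w (- int S)"
    using w(1)[unfolded is_sol_def, rule_format, of 0] by (simp add: D_def)
  also have "\<dots> = w 0 * alpha z + w (int n) * sw.beta z"
    by (subst wk[of "int R"], subst wk[of "- int S"]) (simp add: alpha_def sw.beta_def algebra_simps)
  finally have "(alpha z + sw.beta z * \<rho>) * w 0 = w 0 * alpha z + w (int n) * sw.beta z"
    unfolding z_eq[symmetric] .
  then have "sw.beta z * w (int n) = sw.beta z * (\<rho> * w 0)" by (simp only: algebra_simps add_left_cancel)
  then have "w (int n) = \<rho> * w 0" using sw.beta_bounds(3)[OF z] by simp
  then show ?thesis using wk[of k] by (simp add: ysol_def algebra_simps)
qed

lemma ysol_sum: "abs_summable (ysol z \<rho>)"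
proof -
  have s: "(\<lambda>k. cmod (sw.phi z (int n - k))) summable_on UNIV"
    using summable_int_reflect[of "\<lambda>k. cmod (sw.phi z k)" "int n"] sw.phi_sum(3)[OF z] by simp
  have "(\<lambda>k. cmod (phi z k) + cmod \<rho> * cmod (sw.phi z (int n - k))) summable_on UNIV"
    by (intro summable_on_add summable_on_cmult_right s phi_sum z)
  then show ?thesis
    by (rule summable_on_comparison_test)
       (auto simp: ysol_def intro!: order_trans[OF norm_triangle_ineq] simp: norm_mult)
qed

lemma rho_bounds: "(cmod \<rho>)\<^sup>2 \<le> 3 * (cmod lead / cmod sw.lead)" "cmod lead / cmod sw.lead \<le> 3 * (cmod \<rho>)\<^sup>2"
proof -
  have l: "cmod sw.lead > 0" "cmod lead > 0" using lead_nz sw.lead_nz by auto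
  have e: "cmod (sw.beta z) * (cmod \<rho>)\<^sup>2 = cmod (beta z)"
    using rho_eq by (metis norm_mult norm_power)
  have "1/2 * cmod sw.lead * (cmod \<rho>)\<^sup>2 \<le> cmod (sw.beta z) * (cmod \<rho>)\<^sup>2"
    by (intro mult_right_mono sw.beta_bounds z) auto
  also have "\<dots> \<le> 3/2 * cmod lead" unfolding e by (intro beta_bounds z)
  finally show "(cmod \<rho>)\<^sup>2 \<le> 3 * (cmod lead / cmod sw.lead)" using l by (simp add: field_simps)
  have "1/2 * cmod lead \<le> cmod (sw.beta z) * (cmod \<rho>)\<^sup>2" unfolding e by (intro beta_bounds z)
  also have "\<dots> \<le> 3/2 * cmod sw.lead * (cmod \<rho>)\<^sup>2"
    by (intro mult_right_mono sw.beta_bounds z) auto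
  finally show "cmod lead / cmod sw.lead \<le> 3 * (cmod \<rho>)\<^sup>2" using l by (simp add: field_simps)
qed

lemma rho_pos: "cmod \<rho> > 0"
  using rho_eq beta_bounds(3)[OF z] by auto

lemma Q_rho: "cmod (Q z) \<le> cmod \<rho> / 4"
  using Q_le[OF z, of "cmod \<rho>"] rho_bounds(2) sw.lead_nz by (simp add: divide_simps)

lemma sw_Q_rho: "cmod \<rho> * cmod (sw.Q z) \<le> 1 / 4"
proof -
  interpret swapped: hill_pair S R n b a by unfold_locales
  have "cmod sw.lead \<le> 3 * (1 / cmod \<rho>)\<^sup>2 * cmod lead"
    using rho_bounds(1) sw.lead_nz rho_pos by (simp add: divide_simps mult_ac)
  from swapped.Q_le[OF z _ this] show ?thesis using rho_pos by (simp add: divide_simps mult_ac)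
qed

text \<open>The sum equals \<open>Q z + \<rho>\<^sup>2 * sw.Q z + 2 * \<rho> * P\<close> with
  \<open>P\<close> within 1/4 of 1. Relative to \<open>cmod \<rho>\<close>, the perturbations cost
  1/4, 1/4 and 1/2, less than the main contribution 2.\<close>

lemma pairing_nz: "self_conv n (ysol z \<rho>) \<noteq> 0"
proof -
  let ?\<phi> = "phi z" and ?\<sigma> = "sw.phi z"
  note s1 = phi_sum(3)[OF z] and s2 = sw.phi_sum(3)[OF z]
  have t: "(\<lambda>k. ?\<phi> k * ?\<sigma> k) summable_on UNIV"
    by (rule summable_on_mult_bounded(1)[OF s1 sw.phi_le_1[OF z]])
  have t': "(\<lambda>k. ?\<phi> (int n - k) * ?\<sigma> (int n - k)) summable_on UNIV"
    using summable_int_reflect[of "\<lambda>k. ?\<phi> k * ?\<sigma> k" "int n"] t by simp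
  have q: "(\<lambda>k. ?\<phi> k * ?\<phi> (int n - k)) summable_on UNIV" "(\<lambda>k. ?\<sigma> k * ?\<sigma> (int n - k)) summable_on UNIV"
    by (rule Q_bound(1)[OF z] sw.Q_bound(1)[OF z])+
  define P where "P = infsum (\<lambda>k. ?\<phi> k * ?\<sigma> k) UNIV"
  have i': "infsum (\<lambda>k. ?\<phi> (int n - k) * ?\<sigma> (int n - k)) UNIV = P"
    using infsum_int_reflect[of "\<lambda>k. ?\<phi> k * ?\<sigma> k" "int n"] by (simp add: P_def)
  have "self_conv n (ysol z \<rho>) =
     (\<Sum>\<^sub>\<infinity>k. (?\<phi> k * ?\<phi> (int n - k) + \<rho>\<^sup>2 * (?\<sigma> k * ?\<sigma> (int n - k))) + (\<rho> * (?\<phi> k * ?\<sigma> k) + \<rho> * (?\<phi> (int n - k) * ?\<sigma> (int n - k))))"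
    by (intro infsum_cong) (simp add: ysol_def algebra_simps power2_eq_square)
  also have "\<dots> = (Q z + \<rho>\<^sup>2 * sw.Q z) + (\<rho> * P + \<rho> * P)"
    unfolding Q_def sw.Q_def
    by (subst infsum_add; (intro summable_on_add summable_on_cmult_right q t t')?)
       (simp add: infsum_add infsum_cmult_right' summable_on_cmult_right q t t' i' P_def)
  finally have eq: "self_conv n (ysol z \<rho>) = (Q z + \<rho>\<^sup>2 * sw.Q z) + 2 * \<rho> * P" by simp
  have P: "cmod (P - 1) \<le> 1/4"
  proof -
    have st: "(\<lambda>k. ?\<phi> k * ?\<sigma> k) summable_on -{0, int n}"
      by (rule summable_on_subset_banach[OF t]) auto
    have "infsum (\<lambda>k. ?\<phi> k * ?\<sigma> k) ({0, int n} \<union> -{0, int n}) = infsum (\<lambda>k. ?\<phi> k * ?\<sigma> k) {0, int n} + infsum (\<lambda>k. ?\<phi> k * ?\<sigma> k) (-{0, int n})"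
      by (intro infsum_Un_disjoint st) auto
    moreover have "infsum (\<lambda>k. ?\<phi> k * ?\<sigma> k) {0, int n} = 1"
      using z n_bounds(6) by simp
    ultimately have "P - 1 = infsum (\<lambda>k. ?\<phi> k * ?\<sigma> k) (-{0, int n})"
      by (simp add: P_def Compl_partition)
    also have "cmod \<dots> \<le> infsum (\<lambda>k. cmod (?\<phi> k)) (-{0, int n})"
    proof (rule norm_infsum_le)
      show "((\<lambda>k. ?\<phi> k * ?\<sigma> k) has_sum infsum (\<lambda>k. ?\<phi> k * ?\<sigma> k) (-{0, int n})) (-{0, int n})"
        using st by simp
      show "((\<lambda>k. cmod (?\<phi> k)) has_sum infsum (\<lambda>k. cmod (?\<phi> k)) (-{0, int n})) (-{0, int n})"
        using phi_sum(1)[OF z] by simp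
      show "cmod (?\<phi> k * ?\<sigma> k) \<le> cmod (?\<phi> k)" for k
        using sw.phi_le_1[OF z, of k] by (simp add: norm_mult mult_left_le)
    qed
    also have "\<dots> \<le> 1/4" by (rule phi_sum_small[OF z])
    finally show ?thesis .
  qed
  show ?thesis
  proof
    assume "self_conv n (ysol z \<rho>) = 0"
    then have "2 * \<rho> = - (Q z + \<rho>\<^sup>2 * sw.Q z + 2 * \<rho> * (P - 1))" using eq by (simp add: algebra_simps)
    then have "cmod (2 * \<rho>) = cmod (Q z + \<rho>\<^sup>2 * sw.Q z + 2 * \<rho> * (P - 1))" by (metis norm_minus_cancel)
    also have "\<dots> \<le> cmod (Q z) + cmod \<rho> * (cmod \<rho> * cmod (sw.Q z)) + 2 * cmod \<rho> * cmod (P - 1)"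
      by (intro order_trans[OF norm_triangle_ineq add_mono] norm_triangle_ineq)
         (auto simp: norm_mult norm_power power2_eq_square intro!: order_trans[OF norm_triangle_ineq])
    also have "\<dots> \<le> cmod \<rho> / 4 + cmod \<rho> * (1/4) + 2 * cmod \<rho> * (1/4)"
      by (intro add_mono mult_left_mono Q_rho sw_Q_rho P) auto
    finally show False using rho_pos by simp
  qed
qed

lemma ysol_rest:
  "infsum (\<lambda>k. cmod (ysol z \<rho> k)) (-{0}) \<le> (cmod a + cmod b) / 3 * recip_sum n + 2 * cmod \<rho>"
proof -
  have sr: "(\<lambda>k. cmod (sw.phi z (int n - k))) summable_on UNIV"
    using summable_int_reflect[of "\<lambda>k. cmod (sw.phi z k)" "int n"] sw.phi_sum(3)[OF z] by simp
  have s1: "(\<lambda>k. cmod (phi z k)) summable_on -{0}" "(\<lambda>k. cmod \<rho> * cmod (sw.phi z (int n - k))) summable_on -{0}"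
    by (auto intro!: summable_on_cmult_right summable_on_subset_banach[OF phi_sum(3)[OF z]] summable_on_subset_banach[OF sr])
  have "infsum (\<lambda>k. cmod (ysol z \<rho> k)) (-{0}) \<le> infsum (\<lambda>k. cmod (phi z k) + cmod \<rho> * cmod (sw.phi z (int n - k))) (-{0})"
    by (intro infsum_mono summable_on_add s1 summable_on_subset_banach[OF ysol_sum])
       (auto simp: ysol_def norm_mult intro!: order_trans[OF norm_triangle_ineq])
  also have "\<dots> = infsum (\<lambda>k. cmod (phi z k)) (-{0}) + cmod \<rho> * infsum (\<lambda>k. cmod (sw.phi z (int n - k))) (-{0})"
    by (simp add: infsum_add[OF s1] infsum_cmult_right')
  also have "infsum (\<lambda>k. cmod (phi z k)) (-{0}) = tail_sum (phi z)"
    by (rule infsum_cong_neutral) (use z in auto)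
  also have "infsum (\<lambda>k. cmod (sw.phi z (int n - k))) (-{0}) = infsum (\<lambda>k. cmod (sw.phi z k)) UNIV"
  proof -
    have "infsum (\<lambda>k. cmod (sw.phi z (int n - k))) (-{0}) = infsum (\<lambda>k. cmod (sw.phi z (int n - k))) UNIV"
      by (rule infsum_cong_neutral) (use z in auto)
    then show ?thesis using infsum_int_reflect[of "\<lambda>k. cmod (sw.phi z k)" "int n"] by simp
  qed
  also have "\<dots> = infsum (\<lambda>k. cmod (sw.phi z k)) ({0, int n} \<union> -{0, int n})" by (simp add: Compl_partition)
  also have "\<dots> = infsum (\<lambda>k. cmod (sw.phi z k)) {0, int n} + tail_sum (sw.phi z)"
    by (intro infsum_Un_disjoint sw.phi_sum z) auto
  also have "infsum (\<lambda>k. cmod (sw.phi z k)) {0, int n} = 1" using z n_bounds(6) by simp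
  finally have "infsum (\<lambda>k. cmod (ysol z \<rho> k)) (-{0}) \<le> tail_sum (phi z) + cmod \<rho> * (1 + tail_sum (sw.phi z))" .
  also have "\<dots> \<le> (cmod a + cmod b) / 3 * recip_sum n + cmod \<rho> * (1 + 1)"
    using sw.phi_sum_small[OF z] by (intro add_mono phi_sum z mult_left_mono) auto
  finally show ?thesis by simp
qed

end

end

section \<open>Existence of asymmetric modes\<close>

context hill_seq
begin

text \<open>The denominators run through \<open>i\<close> and \<open>p - i\<close> simultaneously,
  and each family contributes one factorial.\<close>

lemma g_fact: "g (p - 1) = (cmod b / (4 * (real S)\<^sup>2)) ^ (p - 1) / (fact (p - 1))\<^sup>2"
proof -
  have "g (p - 1) = (\<Prod>i=1..p-1. (cmod b / (4 * (real S)\<^sup>2)) / (real i * real (p - i)))"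
    unfolding g_def
  proof (rule prod.cong)
    fix i assume "i \<in> {1..p-1}"
    then have "real (p - i) = real p - real i" by (intro of_nat_diff) auto
    then have "real n - real i * real S = real S * real (p - i)"
      by (simp add: n_eq(2) algebra_simps)
    then show "e i = (cmod b / (4 * (real S)\<^sup>2)) / (real i * real (p - i))"
      by (simp add: e_def power2_eq_square mult_ac)
  qed auto
  also have "\<dots> = (cmod b / (4 * (real S)\<^sup>2)) ^ (p - 1) / ((\<Prod>i=1..p-1. real i) * (\<Prod>i=1..p-1. real (p - i)))"
    by (simp add: prod_dividef prod.distrib power_divide power_mult_distrib)
  also have "(\<Prod>i=1..p-1. real (p - i)) = (\<Prod>i=1..p-1. real i)"
    by (rule prod.reindex_bij_witness[of _ "\<lambda>i. p - i" "\<lambda>i. p - i"]) auto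
  also have "(\<Prod>i=1..p-1. real i) = fact (p - 1)"
    by (simp add: fact_prod)
  finally show ?thesis by (simp add: power2_eq_square)
qed

end

section \<open>Comparing the direct paths up and down\<close>

lemma fact_add_ge: "(fact m * (real m + 1) ^ k :: real) \<le> fact (m + k)"
proof (induction k)
  case (Suc k)
  have "(fact m * (real m + 1) ^ Suc k :: real) = (real m + 1) * (fact m * (real m + 1) ^ k)" by simp
  also have "\<dots> \<le> (real (m + k) + 1) * fact (m + k)"
    by (intro mult_mono Suc) auto
  finally show ?case by (simp add: add.commute)
qed auto

text \<open>The quotient consists of the reciprocals of \<open>(R - S) * j \<ge> j\<close> integers,
  each at least \<open>S * j \<ge> j\<close>.\<close>

lemma fact_ratio:
  fixes R S j :: nat
  assumes "1 \<le> S" "S < R" "1 \<le> j"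
  shows "fact (S * j - 1) / fact (R * j - 1) \<le> 1 / real j ^ j"
proof -
  define m where "m = S * j - 1"
  have Sj: "S * j \<ge> 1" using assms by simp
  have m: "real m + 1 = real S * real j" using Sj by (simp add: m_def of_nat_diff)
  have "S * j \<le> R * j" using assms by simp
  then have mk: "m + (R - S) * j = R * j - 1" using Sj by (simp add: m_def diff_mult_distrib)
  have "real j ^ j \<le> (real S * real j) ^ j" using assms by (intro power_mono) auto
  also have "\<dots> \<le> (real S * real j) ^ ((R - S) * j)"
  proof (rule power_increasing)
    show "j \<le> (R - S) * j" using assms by simp
    show "1 \<le> real S * real j" using Sj by (metis of_nat_1 of_nat_le_iff of_nat_mult)
  qed
  finally have "fact m * real j ^ j \<le> fact m * (real m + 1) ^ ((R - S) * j)"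
    unfolding m by (intro mult_left_mono) auto
  also have "\<dots> \<le> fact (R * j - 1)" using fact_add_ge[of m "(R - S) * j"] by (simp add: mk)
  finally show ?thesis using assms by (simp add: m_def divide_simps)
qed

lemma pow_over_self_pow_tendsto_0: "(\<lambda>j. C ^ j / (real j ^ j)) \<longlonglongrightarrow> 0" if "C \<ge> 0" for C :: real
proof (rule tendsto_sandwich[where f="\<lambda>_. 0" and h="\<lambda>j. (1/2) ^ j"])
  show "\<forall>\<^sub>F j in sequentially. C ^ j / real j ^ j \<le> (1 / 2) ^ j"
    using eventually_ge_at_top[of "nat \<lceil>2 * C\<rceil> + 1"]
  proof eventually_elim
    case (elim j)
    then have "2 * C \<le> real j" "j > 0" by linarith+
    then have "(C / real j) ^ j \<le> (1/2) ^ j" using that by (intro power_mono) (auto simp: field_simps)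
    then show ?case by (simp add: power_divide)
  qed
  show "(\<lambda>j. (1 / 2) ^ j :: real) \<longlonglongrightarrow> 0" by (intro LIMSEQ_power_zero) auto
qed (use that in auto)

definition hill_rec :: "nat \<Rightarrow> nat \<Rightarrow> complex \<Rightarrow> complex \<Rightarrow> nat \<Rightarrow> complex \<Rightarrow> (int \<Rightarrow> complex) \<Rightarrow> bool" where
  "hill_rec R S a b n z y \<longleftrightarrow> (\<forall>k. (4 * of_int k * of_int (int n - k) + z) * y k = a * y (k + int R) + b * y (k - int S))"

text \<open>What the operator side needs, stated outside the locales: \<open>k0\<close> is the
  resonant index where the mode concentrates, the condition on \<open>self_conv\<close> is that the
  integral of \<open>Y * Y\<close> is nonzero, and the last clause is geometric simplicity.\<close>

definition good_mode :: "nat \<Rightarrow> nat \<Rightarrow> complex \<Rightarrow> complex \<Rightarrow> nat \<Rightarrow> int \<Rightarrow> real \<Rightarrow> bool" where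
  "good_mode R S a b n k0 \<epsilon> \<longleftrightarrow> (\<exists>z y. y k0 = 1 \<and> abs_summable y \<and>
     hill_rec R S a b n z y \<and> infsum (\<lambda>k. cmod (y k)) (-{k0}) \<le> \<epsilon> \<and>
     self_conv n y \<noteq> 0 \<and>
     (\<forall>w. hill_rec R S a b n z w \<longrightarrow> bounded (range w) \<longrightarrow> (\<exists>c. \<forall>k. w k = c * y k)))"

lemma all_int_reflect: "(\<forall>k::int. P (c - k)) \<longleftrightarrow> (\<forall>k. P k)"
  by (metis diff_diff_eq2 add_diff_cancel_left')

text \<open>Reduces \<open>R < S\<close> to \<open>S < R\<close>: the reflected mode solves the
  exchanged recurrence and concentrates at \<open>n\<close> instead of 0.\<close>

lemma good_mode_reflect:
  assumes "good_mode S R b a n 0 \<epsilon>"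
  shows "good_mode R S a b n (int n) \<epsilon>"
proof -
  have refl: "hill_rec R S a b n z (\<lambda>k. y (int n - k)) \<longleftrightarrow> hill_rec S R b a n z y" for z y
  proof -
    define P where "P k \<longleftrightarrow> (4 * of_int k * of_int (int n - k) + z) * y k = b * y (k + int S) + a * y (k - int R)" for k
    have "(4 * of_int k * of_int (int n - k) + z) * y (int n - k) = a * y (int n - (k + int R)) + b * y (int n - (k - int S)) \<longleftrightarrow> P (int n - k)" for k
    proof -
      have "int n - (k + int R) = int n - k - int R" "int n - (k - int S) = int n - k + int S" "int n - (int n - k) = k" by auto
      then show ?thesis unfolding P_def by (simp only: mult_ac add_ac)
    qed
    then have "hill_rec R S a b n z (\<lambda>k. y (int n - k)) \<longleftrightarrow> (\<forall>k. P (int n - k))"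
      unfolding hill_rec_def by blast
    also have "\<dots> \<longleftrightarrow> (\<forall>k. P k)" by (rule all_int_reflect)
    finally show ?thesis unfolding hill_rec_def P_def .
  qed
  obtain z y where y: "y 0 = 1" "abs_summable y" "hill_rec S R b a n z y"
     "infsum (\<lambda>k. cmod (y k)) (-{0}) \<le> \<epsilon>" "self_conv n y \<noteq> 0"
     "\<And>w. hill_rec S R b a n z w \<Longrightarrow> bounded (range w) \<Longrightarrow> \<exists>c. \<forall>k. w k = c * y k"
    using assms unfolding good_mode_def by blast
  show ?thesis
    unfolding good_mode_def
  proof (rule exI[of _ z], rule exI[of _ "\<lambda>k. y (int n - k)"], intro conjI allI impI)
    show "y (int n - int n) = 1" using y by simp
    show "(\<lambda>k. cmod (y (int n - k))) summable_on UNIV"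
      using summable_int_reflect[of "\<lambda>k. cmod (y k)" "int n"] y by simp
    show "hill_rec R S a b n z (\<lambda>k. y (int n - k))" using refl y by simp
    have "infsum (\<lambda>k. cmod (y (int n - k))) (-{int n}) = infsum (\<lambda>k. cmod (y k)) (-{0})"
      by (rule infsum_reindex_bij_witness[of _ "\<lambda>k. int n - k" "\<lambda>k. int n - k"]) auto
    then show "infsum (\<lambda>k. cmod (y (int n - k))) (-{int n}) \<le> \<epsilon>" using y by simp
    show "(\<Sum>\<^sub>\<infinity>k. y (int n - k) * y (int n - (int n - k))) \<noteq> 0"
      using y(5) by (simp add: mult.commute)
    fix w assume w: "hill_rec R S a b n z w" "bounded (range w)"
    have "hill_rec S R b a n z (\<lambda>k. w (int n - k))"
      using refl[of z "\<lambda>k. w (int n - k)"] w by simp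
    moreover have "bounded (range (\<lambda>k. w (int n - k)))"
      using w(2) by (rule bounded_subset) auto
    ultimately obtain c where "\<forall>k. w (int n - k) = c * y k" using y(6) by blast
    then show "\<exists>c. \<forall>k. w k = c * y (int n - k)"
      using all_int_reflect[of "\<lambda>k. w k = c * y (int n - k)" "int n"] by auto
  qed
qed

context hill_pair
begin

lemma good_mode_pair:
  assumes "(cmod a + cmod b) / 3 * recip_sum n + 2 * sqrt (3 * (cmod lead / cmod sw.lead)) \<le> \<epsilon>"
  shows "good_mode R S a b n 0 \<epsilon>"
proof -
  obtain z \<rho> where z: "cmod z \<le> 1" "z = alpha z + sw.beta z * \<rho>" "sw.beta z * \<rho>\<^sup>2 = beta z"
    by (rule root_exists)
  have rec: "hill_rec R S a b n z y \<longleftrightarrow> is_sol z y" for y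
    by (simp add: hill_rec_def is_sol_def D_def)
  have "cmod \<rho> \<le> sqrt (3 * (cmod lead / cmod sw.lead))"
    by (rule real_le_rsqrt[OF rho_bounds(1)[OF z]])
  then have e: "infsum (\<lambda>k. cmod (ysol z \<rho> k)) (-{0}) \<le> \<epsilon>"
    using ysol_rest[OF z] assms by linarith
  show ?thesis
    unfolding good_mode_def
    by (rule exI[of _ z], rule exI[of _ "ysol z \<rho>"], unfold rec)
       (use ysol_0[OF z] ysol_sum[OF z] is_sol_ysol[OF z] e pairing_nz[OF z] sol_unique[OF z] in blast)
qed

text \<open>Going up takes \<open>R * j\<close> steps, going down only \<open>S * j\<close>. Both
  weights are geometric over a squared factorial, so the quotient is geometric times the square of
  \<open>fact (S * j - 1) / fact (R * j - 1)\<close>. One factor of that square is bounded by 1, the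
  other beats the geometric part.\<close>

lemma lead_ratio:
  assumes n: "n = R * S * j" and j: "j \<ge> 1" and SR: "S < R"
  defines "x \<equiv> cmod b / (4 * (real S)\<^sup>2)" and "y \<equiv> cmod a / (4 * (real R)\<^sup>2)"
  shows "cmod lead / cmod sw.lead \<le> (cmod b / cmod a * (y / x)) * ((x ^ R / y ^ S) ^ j / real j ^ j)"
proof -
  have pos: "x > 0" "y > 0" "cmod a > 0" "cmod b > 0"
    using a_nz b_nz R_pos S_pos by (auto simp: x_def y_def)
  have p: "p = R * j" "sw.p = S * j" 
  proof -
    have "R * S * j = R * j * S" "R * S * j = S * j * R" by simp_all
    then have "n div S = R * j" "n div R = S * j" using n S_pos R_pos by auto
    then show "p = R * j" "sw.p = S * j" unfolding p_def sw.p_def by auto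
  qed
  have Sj: "S * j \<ge> 1" "R * j \<ge> 1" using S_pos R_pos j by auto
  define f where "f = fact (S * j - 1) / (fact (R * j - 1) :: real)"
  have f0: "f > 0" by (simp add: f_def)
  have f1: "f \<le> 1 / real j ^ j" unfolding f_def by (intro fact_ratio S_pos SR j)
  have "f\<^sup>2 = f * f" by (simp add: power2_eq_square)
  also have "\<dots> \<le> f * 1"
  proof (intro mult_left_mono)
    have "1 / real j ^ j \<le> 1" using j by simp
    then show "f \<le> 1" using f1 by linarith
  qed (use f0 in auto)
  finally have f2: "f\<^sup>2 \<le> 1 / real j ^ j" using f1 by simp
  have xp: "x ^ (R * j - 1) = (x ^ R) ^ j / x" "y ^ (S * j - 1) = (y ^ S) ^ j / y"
    using pos Sj by (simp_all add: power_mult[symmetric] power_diff)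
  have g: "g (p - 1) = x ^ (R * j - 1) / (fact (R * j - 1))\<^sup>2"
    using g_fact unfolding x_def p .
  have g': "sw.g (sw.p - 1) = y ^ (S * j - 1) / (fact (S * j - 1))\<^sup>2"
    using sw.g_fact unfolding y_def p .
  have "cmod lead / cmod sw.lead = (cmod b / cmod a) * (x ^ (R * j - 1) / y ^ (S * j - 1)) * f\<^sup>2"
    unfolding cmod_lead sw.cmod_lead g g' f_def by (simp add: power_divide)
  also have "\<dots> = (cmod b / cmod a * (y / x)) * (x ^ R / y ^ S) ^ j * f\<^sup>2"
    unfolding xp by (simp add: power_divide mult_ac)
  also have "\<dots> \<le> (cmod b / cmod a * (y / x)) * (x ^ R / y ^ S) ^ j * (1 / real j ^ j)"
    using pos f2 by (intro mult_left_mono) auto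
  finally show ?thesis by simp
qed

end

lemma hill_seq_eventually:
  fixes a b :: complex
  assumes "R \<ge> 1" "S \<ge> 1" "a \<noteq> 0" "b \<noteq> 0"
  shows "\<forall>\<^sub>F j in sequentially. hill_seq R S (R * S * j) a b"
proof -
  have "filterlim (\<lambda>j. R * S * j) sequentially sequentially"
    using assms by (intro mult_nat_left_at_top) auto
  moreover have "\<forall>\<^sub>F n in sequentially. C \<le> real n" for C
    using filterlim_real_sequentially by (simp add: filterlim_at_top)
  moreover have "\<forall>\<^sub>F n in sequentially. C * recip_sum n \<le> 1" for C
  proof -
    have "(\<lambda>n. C * recip_sum n) \<longlonglongrightarrow> C * 0" by (intro tendsto_intros recip_sum_tendsto)
    then show ?thesis by (intro eventually_mono[OF order_tendstoD(2)[of _ "C * 0" _ 1]]) auto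
  qed
  ultimately have "\<forall>\<^sub>F j in sequentially. C \<le> real (R * S * j)" "\<forall>\<^sub>F j in sequentially. C * recip_sum (R * S * j) \<le> 1" for C
    by (auto simp: filterlim_iff simp del: of_nat_mult)
  then have "\<forall>\<^sub>F j in sequentially.
     64 * (real R + real S) * (1 + cmod a + cmod b) \<le> real (R * S * j) \<and>
     64 * (real R + real S) * (1 + cmod a + cmod b) * recip_sum (R * S * j) \<le> 1 \<and>
     64 * (1 + cmod a + cmod b)\<^sup>2 \<le> real (R * S * j) \<and>
     16 * real S * (cmod a + cmod b) * sqrt (3 * cmod a / cmod b) * recip_sum (R * S * j) \<le> 1"
    by (intro eventually_conj)
  then show ?thesis
    by eventually_elim (unfold_locales, use assms in auto)
qed

lemma good_mode_eventually:
  fixes a b :: complex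
  assumes "1 \<le> S" "S < R" "a \<noteq> 0" "b \<noteq> 0" "\<epsilon> > 0"
  shows "\<forall>\<^sub>F j in sequentially. good_mode R S a b (R * S * j) 0 \<epsilon>"
proof -
  define x where "x = cmod b / (4 * (real S)\<^sup>2)"
  define y where "y = cmod a / (4 * (real R)\<^sup>2)"
  have pos: "x > 0" "y > 0" using assms by (auto simp: x_def y_def)
  define K where "K = cmod b / cmod a * (y / x)"
  let ?r = "\<lambda>j. K * ((x ^ R / y ^ S) ^ j / real j ^ j)"
  have lim: "filterlim (\<lambda>j. R * S * j) sequentially sequentially"
    using assms by (intro mult_nat_left_at_top) auto
  have "(\<lambda>j. (cmod a + cmod b) / 3 * recip_sum (R * S * j) + 2 * sqrt (3 * ?r j)) \<longlonglongrightarrow> (cmod a + cmod b) / 3 * 0 + 2 * sqrt (3 * (K * 0))"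
    using pos by (intro tendsto_intros filterlim_compose[OF recip_sum_tendsto lim] pow_over_self_pow_tendsto_0) auto
  then have ev: "\<forall>\<^sub>F j in sequentially. (cmod a + cmod b) / 3 * recip_sum (R * S * j) + 2 * sqrt (3 * ?r j) < \<epsilon>"
    using assms by (intro order_tendstoD(2)) auto
  have h1: "\<forall>\<^sub>F j in sequentially. hill_seq R S (R * S * j) a b"
    using assms by (intro hill_seq_eventually) auto
  have h2: "\<forall>\<^sub>F j in sequentially. hill_seq S R (R * S * j) b a"
    using hill_seq_eventually[of S R b a] assms by (simp add: mult.commute)
  show ?thesis
    using ev h1 h2 eventually_ge_at_top[of 1]
  proof eventually_elim
    case (elim j)
    interpret hill_pair R S "R * S * j" a b
      using elim by (simp add: hill_pair_def)
    have "cmod lead / cmod sw.lead \<le> ?r j"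
      unfolding K_def x_def y_def by (rule lead_ratio) (use elim assms in auto)
    then have "sqrt (3 * (cmod lead / cmod sw.lead)) \<le> sqrt (3 * ?r j)" by simp
    then show ?case using elim by (intro good_mode_pair) linarith
  qed
qed

theorem good_modes:
  fixes a b :: complex
  assumes "1 \<le> R" "1 \<le> S" "R \<noteq> S" "a \<noteq> 0" "b \<noteq> 0" "\<epsilon> > 0"
  shows "\<forall>\<^sub>F j in sequentially. \<exists>k0\<in>{0, int (R * S * j)}. good_mode R S a b (R * S * j) k0 \<epsilon>"
proof (cases "S < R")
  case True
  show ?thesis using good_mode_eventually[OF assms(2) True assms(4-6)] by eventually_elim auto
next
  case False
  then have "R < S" using assms by simp
  have "\<forall>\<^sub>F j in sequentially. good_mode S R b a (R * S * j) 0 \<epsilon>"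
    using good_mode_eventually[OF assms(1) \<open>R < S\<close> assms(5,4,6)] by (simp only: mult.commute[of S R])
  then show ?thesis by eventually_elim (use good_mode_reflect in blast)
qed

section \<open>Trigonometric functions and integration by parts\<close>

definition expi :: "int \<Rightarrow> real \<Rightarrow> complex" where
  "expi m x = exp (\<i> * of_int m * of_real x)"

lemma expi_add: "expi (m + k) x = expi m x * expi k x"
  by (simp add: expi_def exp_add[symmetric] algebra_simps)

lemma expi_0 [simp]: "expi 0 x = 1" "expi m 0 = 1"
  by (simp_all add: expi_def)

lemma norm_expi [simp]: "cmod (expi m x) = 1"
  unfolding expi_def by (metis mult.assoc norm_exp_i_times of_real_mult of_real_of_int_eq)

lemma expi_deriv: "(expi m has_vector_derivative \<i> * of_int m * expi m x) (at x within A)"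
proof -
  have "((\<lambda>z. exp (\<i> * of_int m * z)) has_field_derivative \<i> * of_int m * exp (\<i> * of_int m * of_real x)) (at (of_real x))"
    by (auto intro!: derivative_eq_intros)
  from has_vector_derivative_real_field[OF this] show ?thesis
    by (simp add: expi_def[abs_def] has_vector_derivative_at_within)
qed

lemma expi_cont [continuous_intros]: "continuous_on A (expi m)"
  unfolding expi_def[abs_def] by (intro continuous_intros)

lemma expi_pi: "expi m pi = (if even m then 1 else -1)"
proof (cases "even m")
  case True
  then obtain k where "m = 2 * k" by auto
  then have "expi m pi = exp (2 * of_int k * of_real pi * \<i>)" by (simp add: expi_def mult_ac)
  then show ?thesis using True exp_integer_2pi[of "of_int k"] by (simp add: mult_ac)
next
  case False
  then obtain k where "m = 2 * k + 1" by (auto elim: oddE)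
  then have "expi m pi = exp (2 * of_int k * of_real pi * \<i>) * exp (\<i> * of_real pi)"
    by (simp add: expi_def exp_add[symmetric] algebra_simps)
  then show ?thesis using False exp_integer_2pi[of "of_int k"] by (simp add: mult_ac)
qed

lemma expi_integral: "integral {0..pi} (expi (2 * k)) = (if k = 0 then of_real pi else 0)"
proof (cases "k = 0")
  case True
  then show ?thesis by (simp add: expi_def[abs_def] scaleR_conv_of_real)
next
  case False
  have "(expi (2 * k) has_integral (expi (2 * k) pi / (\<i> * of_int (2 * k)) - expi (2 * k) 0 / (\<i> * of_int (2 * k)))) {0..pi}"
  proof (rule fundamental_theorem_of_calculus)
    fix x :: real
    have "((\<lambda>x. expi (2 * k) x / (\<i> * of_int (2 * k))) has_vector_derivative (\<i> * of_int (2 * k) * expi (2 * k) x) / (\<i> * of_int (2 * k))) (at x within {0..pi})"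
      using bounded_linear.has_vector_derivative[OF bounded_linear_divide expi_deriv] .
    then show "((\<lambda>x. expi (2 * k) x / (\<i> * of_int (2 * k))) has_vector_derivative expi (2 * k) x) (at x within {0..pi})"
      using False by simp
  qed auto
  then show ?thesis using False by (simp add: expi_pi integral_unique)
qed

lemma L2_integrable: "f \<in> L2_pi \<Longrightarrow> integrable leb_pi f"
proof -
  assume f: "f \<in> L2_pi"
  have "finite_measure leb_pi" by (intro finite_measure_lebesgue_on) auto
  then interpret finite_measure leb_pi .
  show ?thesis
  proof (rule Bochner_Integration.integrable_bound)
    show "integrable leb_pi (\<lambda>x. 1 + (cmod (f x))\<^sup>2)" using f by (auto simp: L2_pi_def)
    show "f \<in> borel_measurable leb_pi" using f by (auto simp: L2_pi_def)
    have "t \<le> 1 + t\<^sup>2" for t :: real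
      using zero_le_power2[of "t - 1/2"] by (simp add: power2_eq_square algebra_simps)
    then show "AE x in leb_pi. cmod (f x) \<le> norm (1 + (cmod (f x))\<^sup>2)" by auto
  qed
qed

lemma cont_meas: "continuous_on {0..pi} h \<Longrightarrow> h \<in> borel_measurable leb_pi"
  for h :: "real \<Rightarrow> complex"
  by (rule continuous_imp_measurable_on_sets_lebesgue) auto

lemma cont_bounded:
  fixes h :: "real \<Rightarrow> complex"
  assumes "continuous_on {0..pi} h"
  obtains C where "C \<ge> 0" "\<And>x. x \<in> {0..pi} \<Longrightarrow> cmod (h x) \<le> C"
proof -
  have "bounded (h ` {0..pi})" by (intro compact_imp_bounded compact_continuous_image assms) auto
  then obtain C where "\<forall>x\<in>{0..pi}. cmod (h x) \<le> C" unfolding bounded_iff by auto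
  then show thesis by (intro that[of "max C 0"]) (auto simp: le_max_iff_disj)
qed

lemma integrable_mult_cont:
  fixes f h :: "real \<Rightarrow> complex"
  assumes "integrable leb_pi f" "continuous_on {0..pi} h"
  shows "integrable leb_pi (\<lambda>x. f x * h x)"
proof -
  obtain C where C: "C \<ge> 0" "\<And>x. x \<in> {0..pi} \<Longrightarrow> cmod (h x) \<le> C" using cont_bounded[OF assms(2)] by blast
  show ?thesis
  proof (rule Bochner_Integration.integrable_bound)
    show "integrable leb_pi (\<lambda>x. C * cmod (f x))" using assms by auto
    show "(\<lambda>x. f x * h x) \<in> borel_measurable leb_pi"
      using assms cont_meas by (intro borel_measurable_times) auto
    show "AE x in leb_pi. cmod (f x * h x) \<le> norm (C * cmod (f x))"
      using C by (intro AE_I2) (auto simp: norm_mult mult.commute[of C] intro!: mult_left_mono)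
  qed
qed

lemma integrable_cont: "continuous_on {0..pi} h \<Longrightarrow> integrable leb_pi h"
  for h :: "real \<Rightarrow> complex"
  by (rule continuous_imp_integrable_real)

lemma LINT_eq_integral: "integrable leb_pi f \<Longrightarrow> integral\<^sup>L leb_pi f = integral {0..pi} f"
  for f :: "real \<Rightarrow> complex"
  by (rule lebesgue_integral_eq_integral) auto

lemma integrable_subinterval:
  fixes f :: "real \<Rightarrow> complex"
  assumes "integrable leb_pi f" "0 \<le> x" "y \<le> pi"
  shows "f absolutely_integrable_on {x..y}"
proof -
  have "f absolutely_integrable_on {0..pi}" 
    using assms(1) by (simp add: set_integrable_def integrable_restrict_space)
  then show ?thesis
    by (rule set_integrable_subset) (use assms in auto)
qed

text \<open>Telescoping over equidistant partitions replaces differentiation in the integration by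
  parts below, where the second derivative exists only as an \<open>L\<^sup>2\<close> function.\<close>

lemma constant_if_small_increments:
  fixes \<Phi> :: "real \<Rightarrow> complex" and N :: "real \<Rightarrow> real"
  assumes "L > 0" and inc: "\<And>x y. 0 \<le> x \<Longrightarrow> x \<le> y \<Longrightarrow> y \<le> L \<Longrightarrow> cmod (\<Phi> y - \<Phi> x) \<le> K * (y - x) * (N y - N x)"
  shows "\<Phi> L = \<Phi> 0"
proof -
  have le: "cmod (\<Phi> L - \<Phi> 0) \<le> K * L * (N L - N 0) / real (Suc m)" for m
  proof -
    define t where "t i = real i * (L / real (Suc m))" for i
    have t: "t 0 = 0" "t (Suc m) = L" by (auto simp: t_def)
    have "cmod (\<Phi> L - \<Phi> 0) = cmod (\<Sum>i<Suc m. \<Phi> (t (Suc i)) - \<Phi> (t i))"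
      by (simp only: sum_lessThan_telescope[of "\<lambda>i. \<Phi> (t i)" "Suc m"] t)
    also have "\<dots> \<le> (\<Sum>i<Suc m. cmod (\<Phi> (t (Suc i)) - \<Phi> (t i)))" by (rule norm_sum)
    also have "\<dots> \<le> (\<Sum>i<Suc m. K * (L / real (Suc m)) * (N (t (Suc i)) - N (t i)))"
    proof (rule sum_mono)
      fix i assume i: "i \<in> {..<Suc m}"
      have d: "t (Suc i) - t i = L / real (Suc m)" by (simp add: t_def left_diff_distrib[symmetric] del: times_divide_eq_right)
      have "t (Suc i) \<le> t (Suc m)" unfolding t_def using assms i by (intro mult_right_mono) auto
      then have "cmod (\<Phi> (t (Suc i)) - \<Phi> (t i)) \<le> K * (t (Suc i) - t i) * (N (t (Suc i)) - N (t i))"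
        using t d assms(1) by (intro inc) (auto simp: t_def mult_right_mono divide_right_mono)
      then show "cmod (\<Phi> (t (Suc i)) - \<Phi> (t i)) \<le> K * (L / real (Suc m)) * (N (t (Suc i)) - N (t i))" unfolding d .
    qed
    also have "\<dots> = K * (L / real (Suc m)) * (N L - N 0)"
      by (simp only: sum_distrib_left[symmetric] sum_lessThan_telescope[of "\<lambda>i. N (t i)" "Suc m"] t)
    finally show ?thesis by simp
  qed
  have "(\<lambda>m. K * L * (N L - N 0) / real (Suc m)) \<longlonglongrightarrow> 0"
    by (intro real_tendsto_divide_at_top[OF tendsto_const] filterlim_compose[OF filterlim_real_sequentially filterlim_Suc])
  then have "cmod (\<Phi> L - \<Phi> 0) \<le> 0" by (rule tendsto_lowerbound) (use le in auto)
  then show ?thesis by simp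
qed

text \<open>\<open>u1\<close> is known only as the integral of \<open>u2\<close>, so the product
  rule fails pointwise. Instead the defect of the formula on \<open>{0..x}\<close> is shown to have
  increments bounded by the length of an interval times the increment of the integral of
  \<open>cmod (u2 t)\<close>.\<close>

lemma ibp_expi:
  assumes u2: "integrable leb_pi u2" and u1: "\<And>x. x \<in> {0..pi} \<Longrightarrow> (u2 has_integral (u1 x - u1 0)) {0..x}"
  shows "integral {0..pi} (\<lambda>x. u2 x * expi m x) = u1 pi * expi m pi - u1 0 - integral {0..pi} (\<lambda>x. u1 x * (\<i> * of_int m * expi m x))"
    and "continuous_on {0..pi} u1"
proof -
  define q where "q = expi m"
  define q1 where "q1 x = \<i> * of_int m * expi m x" for x
  define K where "K = \<bar>real_of_int m\<bar>"
  have q1K: "cmod (q1 x) = K" for x by (simp add: q1_def K_def norm_mult)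
  have cq: "continuous_on A q" "continuous_on A q1" for A
    unfolding q_def q1_def[abs_def] by (intro continuous_intros)+
  have qint: "(q1 has_integral (q y - q x)) {x..y}" if "x \<le> y" for x y
    using that unfolding q_def q1_def[abs_def] by (intro fundamental_theorem_of_calculus expi_deriv)
  have Lip: "cmod (q t - q y) \<le> K * (y - x)" if "x \<le> t" "t \<le> y" for x t y
  proof -
    have "cmod (q y - q t) \<le> K * (y - t)"
      using has_integral_bound[OF _ qint[OF that(2), unfolded interval_cbox]] q1K that(2) by (auto simp: K_def)
    also have "\<dots> \<le> K * (y - x)" using that by (intro mult_left_mono) (auto simp: K_def)
    finally show ?thesis by (simp add: norm_minus_commute)
  qed
  define N where "N x = integral {0..x} (\<lambda>t. cmod (u2 t))" for x
  have ai: "u2 absolutely_integrable_on {x..y}" if "0 \<le> x" "y \<le> pi" for x y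
    by (rule integrable_subinterval[OF u2 that])
  have i2: "u2 integrable_on {x..y}" "(\<lambda>t. cmod (u2 t)) integrable_on {x..y}" if "0 \<le> x" "y \<le> pi" for x y
    using ai[OF that] by (auto simp: absolutely_integrable_on_def)
  have u1d: "integral {x..y} u2 = u1 y - u1 x" if "0 \<le> x" "x \<le> y" "y \<le> pi" for x y
  proof -
    have "integral {0..x} u2 + integral {x..y} u2 = integral {0..y} u2"
      using that i2 by (intro Henstock_Kurzweil_Integration.integral_combine) auto
    moreover have "integral {0..x} u2 = u1 x - u1 0" "integral {0..y} u2 = u1 y - u1 0"
      using u1[of x] u1[of y] that by (auto intro: integral_unique)
    ultimately show ?thesis by (simp add: algebra_simps)
  qed
  have Nd: "integral {x..y} (\<lambda>t. cmod (u2 t)) = N y - N x" if "0 \<le> x" "x \<le> y" "y \<le> pi" for x y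
  proof -
    have "N x + integral {x..y} (\<lambda>t. cmod (u2 t)) = N y"
      unfolding N_def using that i2 by (intro Henstock_Kurzweil_Integration.integral_combine) auto
    then show ?thesis by simp
  qed
  have Nmono: "N x \<le> N y" if "0 \<le> x" "x \<le> y" "y \<le> pi" for x y
    using Nd[OF that] integral_nonneg[OF i2(2)[of x y]] that by simp
  have u1N: "cmod (u1 y - u1 x) \<le> N y - N x" if "0 \<le> x" "x \<le> y" "y \<le> pi" for x y
    using integral_norm_bound_integral[OF i2[of x y]] u1d[OF that] Nd[OF that] that by auto
  show cu1: "continuous_on {0..pi} u1"
  proof -
    have "continuous_on {0..pi} (\<lambda>x. integral {0..x} u2)"
      by (rule indefinite_integral_continuous_1) (use i2[of 0 pi] in auto)
    then have "continuous_on {0..pi} (\<lambda>x. integral {0..x} u2 + u1 0)" by (intro continuous_intros)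
    then show ?thesis
      by (rule continuous_on_eq) (use u1d[of 0] in auto)
  qed
  have i2q: "(\<lambda>t. u2 t * q t) integrable_on {x..y}" if "0 \<le> x" "y \<le> pi" for x y
    using integrable_subinterval[OF integrable_mult_cont[OF u2 cq(1)] that] by (auto simp: absolutely_integrable_on_def)
  have i1q: "(\<lambda>t. u1 t * q1 t) integrable_on {x..y}" if "0 \<le> x" "y \<le> pi" for x y
    by (intro integrable_continuous_real continuous_intros cq continuous_on_subset[OF cu1]) (use that in auto)
  define \<Phi> where "\<Phi> x = integral {0..x} (\<lambda>t. u2 t * q t) + integral {0..x} (\<lambda>t. u1 t * q1 t) - u1 x * q x" for x
  have "\<Phi> pi = \<Phi> 0"
  proof (rule constant_if_small_increments)
    fix x y :: real assume xy: "0 \<le> x" "x \<le> y" "y \<le> pi"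
    have A: "integral {0..y} (\<lambda>t. u2 t * q t) - integral {0..x} (\<lambda>t. u2 t * q t) = integral {x..y} (\<lambda>t. u2 t * q t)"
      using Henstock_Kurzweil_Integration.integral_combine[of 0 x y "\<lambda>t. u2 t * q t"] xy i2q[of 0 y] by (simp add: algebra_simps)
    have B: "integral {0..y} (\<lambda>t. u1 t * q1 t) - integral {0..x} (\<lambda>t. u1 t * q1 t) = integral {x..y} (\<lambda>t. u1 t * q1 t)"
      using Henstock_Kurzweil_Integration.integral_combine[of 0 x y "\<lambda>t. u1 t * q1 t"] xy i1q[of 0 y] by (simp add: algebra_simps)
    have h1: "((\<lambda>t. u2 t * q t - u2 t * q y) has_integral (integral {x..y} (\<lambda>t. u2 t * q t) - (u1 y - u1 x) * q y)) {x..y}"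
      using integrable_integral[OF i2q[of x y]] integrable_integral[OF i2(1)[of x y]] u1d[OF xy] xy
      by (intro has_integral_diff has_integral_mult_left) auto
    have h2: "((\<lambda>t. u1 t * q1 t - u1 x * q1 t) has_integral (integral {x..y} (\<lambda>t. u1 t * q1 t) - u1 x * (q y - q x))) {x..y}"
      using integrable_integral[OF i1q[of x y]] qint[OF xy(2)] xy
      by (intro has_integral_diff has_integral_mult_right) auto
    \<comment> \<open>Freezing \<open>q\<close> at the right end and \<open>u1\<close> at the left
      end splits the boundary term exactly: \<open>u1 y * q y - u1 x * q x = (u1 y - u1 x) * q y +
      u1 x * (q y - q x)\<close>.\<close>
    have "\<Phi> y - \<Phi> x = (integral {x..y} (\<lambda>t. u2 t * q t) - (u1 y - u1 x) * q y) + (integral {x..y} (\<lambda>t. u1 t * q1 t) - u1 x * (q y - q x))"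
      unfolding \<Phi>_def A[symmetric] B[symmetric] by (simp add: algebra_simps)
    also have "cmod \<dots> \<le> K * (y - x) * (N y - N x) + K * (y - x) * (N y - N x)"
    proof (rule order_trans[OF norm_triangle_ineq add_mono])
      have "cmod (integral {x..y} (\<lambda>t. u2 t * q t - u2 t * q y)) \<le> integral {x..y} (\<lambda>t. K * (y - x) * cmod (u2 t))"
      proof (rule integral_norm_bound_integral)
        fix t assume t: "t \<in> {x..y}"
        have "cmod (u2 t * q t - u2 t * q y) = cmod (u2 t) * cmod (q t - q y)" by (simp flip: norm_mult right_diff_distrib)
        also have "\<dots> \<le> cmod (u2 t) * (K * (y - x))" using Lip[of x t y] t by (intro mult_left_mono) auto
        finally show "cmod (u2 t * q t - u2 t * q y) \<le> K * (y - x) * cmod (u2 t)" by (simp add: mult.commute)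
      qed (use h1 i2[of x y] xy in \<open>auto simp: has_integral_iff intro!: integrable_on_mult_right\<close>)
      then show "cmod (integral {x..y} (\<lambda>t. u2 t * q t) - (u1 y - u1 x) * q y) \<le> K * (y - x) * (N y - N x)"
        using h1 Nd[OF xy] by (simp add: has_integral_iff)
      have "cmod (integral {x..y} (\<lambda>t. u1 t * q1 t) - u1 x * (q y - q x)) \<le> (K * (N y - N x)) * measure lborel {x..y}"
      proof (rule has_integral_bound[OF _ h2[unfolded interval_cbox], folded interval_cbox])
        show "0 \<le> K * (N y - N x)" using Nmono[OF xy] by (simp add: K_def)
        fix t assume t: "t \<in> {x..y}"
        have "cmod (u1 t * q1 t - u1 x * q1 t) = cmod (u1 t - u1 x) * K" by (simp add: q1K norm_mult flip: left_diff_distrib)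
        also have "\<dots> \<le> (N t - N x) * K" using u1N[of x t] t xy by (intro mult_right_mono) (auto simp: K_def)
        also have "\<dots> \<le> (N y - N x) * K" using Nmono[of t y] t xy by (intro mult_right_mono) (auto simp: K_def)
        finally show "cmod (u1 t * q1 t - u1 x * q1 t) \<le> K * (N y - N x)" by (simp add: mult.commute)
      qed
      then show "cmod (integral {x..y} (\<lambda>t. u1 t * q1 t) - u1 x * (q y - q x)) \<le> K * (y - x) * (N y - N x)"
        using xy by (simp add: mult_ac)
    qed
    also have "\<dots> = (2 * K) * (y - x) * (N y - N x)" by simp
    finally show "cmod (\<Phi> y - \<Phi> x) \<le> (2 * K) * (y - x) * (N y - N x)" .
  qed auto
  then have "integral {0..pi} (\<lambda>t. u2 t * q t) + integral {0..pi} (\<lambda>t. u1 t * q1 t) - u1 pi * q pi = - u1 0"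
    by (simp add: \<Phi>_def q_def)
  then show "integral {0..pi} (\<lambda>x. u2 x * expi m x) = u1 pi * expi m pi - u1 0 - integral {0..pi} (\<lambda>x. u1 x * (\<i> * of_int m * expi m x))"
    by (simp add: q_def q1_def algebra_simps)
qed

text \<open>The conjugate of \<open>V\<close> descends to a continuous function on the circle and is
  uniformly approximated there by polynomials. \<open>V\<close> is orthogonal to all of these, so
  the integral of its squared modulus is arbitrarily small.\<close>

lemma fourier_unique:
  fixes V :: "real \<Rightarrow> complex"
  assumes contV: "continuous_on {0..pi} V" and per: "V pi = V 0"
    and zero: "\<And>k. integral {0..pi} (\<lambda>x. V x * expi (2 * k) x) = 0"
    and x: "x \<in> {0..pi}"
  shows "V x = 0"
proof -
  define F where "F = (\<lambda>t. cnj (V (pi * t))) \<circ> (\<lambda>z. Arg2pi z / (2 * pi))"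
  define c where "c x = exp (2 * \<i> * of_real x)" for x :: real
  have c_expi: "c x = expi 2 x" for x by (simp add: c_def expi_def mult_ac)
  have c_sphere: "c x \<in> sphere 0 1" for x by (simp add: c_expi)
  have Fc: "F (c x) = cnj (V x)" if "x \<in> {0..pi}" for x
  proof (cases "x = pi")
    case True
    then have "c x = 1" by (simp add: c_expi expi_pi)
    then show ?thesis using True per Arg2pi_of_real[of 1] by (simp add: F_def)
  next
    case False
    then have "Arg2pi (c x) = 2 * x" unfolding c_def using that by (subst Arg2pi_exp) auto
    then show ?thesis by (simp add: F_def)
  qed
  have contF: "continuous_on (sphere 0 1) F"
  proof -
    have "continuous_on {0..1} (\<lambda>t. cnj (V (pi * t)))"
      by (intro continuous_on_cnj continuous_on_compose2[OF contV] continuous_intros) (auto simp: mult_left_le)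
    \<comment> \<open>Continuity on the circle, including the point where the argument jumps, is
      obtained from the trivial homotopy of a loop to itself.\<close>
    then have "homotopic_loops UNIV (\<lambda>t. cnj (V (pi * t))) (\<lambda>t. cnj (V (pi * t)))"
      using per by (simp add: homotopic_loops_refl path_def pathstart_def pathfinish_def)
    from homotopic_with_imp_continuous[OF homotopic_loops_imp_homotopic_circlemaps[OF this]]
    show ?thesis by (simp add: F_def)
  qed
  have cc: "continuous_on A c" for A unfolding c_expi[abs_def] by (intro continuous_intros)
  \<comment> \<open>\<open>Z\<close> generalises over \<open>W\<close> so that the induction over
    polynomials can multiply one factor after another; the multiplications by
    \<open>expi (2 * j)\<close> under which it is invariant generate them all.\<close>
  define Z where "Z W \<longleftrightarrow> continuous_on {0..pi} W \<and> (\<forall>k. integral {0..pi} (\<lambda>x. W x * expi (2 * k) x) = 0)" for W :: "real \<Rightarrow> complex"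
  have Zi: "(\<lambda>x. W x * expi k x) integrable_on {0..pi}" if "Z W" for W k
    using that unfolding Z_def by (intro integrable_continuous_real continuous_intros) auto
  have Zadd: "Z (\<lambda>x. W x + W' x)" if "Z W" "Z W'" for W W'
    using that Zi[OF that(1)] Zi[OF that(2)] unfolding Z_def
    by (auto intro!: continuous_intros simp: distrib_right integral_add)
  have Zcmult: "Z (\<lambda>x. C * W x)" if "Z W" for W C
    using that unfolding Z_def by (auto intro!: continuous_intros simp: mult.assoc)
  have Zshift: "Z (\<lambda>x. W x * expi (2 * j) x)" if "Z W" for W j
    unfolding Z_def
  proof (intro conjI allI)
    show "continuous_on {0..pi} (\<lambda>x. W x * expi (2 * j) x)"
      using that unfolding Z_def by (intro continuous_intros) auto
    fix k
    have "W x * expi (2 * j) x * expi (2 * k) x = W x * expi (2 * (j + k)) x" for x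
      by (simp add: distrib_left expi_add)
    then show "integral {0..pi} (\<lambda>x. W x * expi (2 * j) x * expi (2 * k) x) = 0"
      using that unfolding Z_def by (simp only:)
  qed
  have Zr: "Z (\<lambda>x. W x * of_real (r (c x)))" if "real_polynomial_function r" "Z W" for r W
    using that
  proof (induction r arbitrary: W rule: real_polynomial_function.induct)
    case (linear f)
    interpret f: bounded_linear f by fact
    \<comment> \<open>The exponential coefficients of
      \<open>f 1 * cos (2 * x) + f \<i> * sin (2 * x)\<close>, the restriction of a real-linear
      function to the circle.\<close>
    define p where "p = (complex_of_real (f 1) - \<i> * of_real (f \<i>)) / 2"
    define p' where "p' = (complex_of_real (f 1) + \<i> * of_real (f \<i>)) / 2"
    have "complex_of_real (f (c x)) = p * expi (2 * 1) x + p' * expi (2 * (-1)) x" for x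
    proof -
      have "c x = Re (c x) *\<^sub>R 1 + Im (c x) *\<^sub>R \<i>" by (simp add: complex_eq_iff)
      then have "f (c x) = Re (c x) * f 1 + Im (c x) * f \<i>"
        by (metis f.add f.scaleR real_scaleR_def)
      moreover have "Re (c x) = cos (2 * x)" "Im (c x) = sin (2 * x)"
        by (simp_all add: c_def Re_exp Im_exp)
      moreover have "expi (2 * 1) x = cis (2 * x)" "expi (2 * (-1)) x = cis (- (2 * x))"
        by (simp_all add: expi_def cis_conv_exp mult_ac)
      ultimately have eq: "complex_of_real (f (c x)) = of_real (cos (2 * x) * f 1 + sin (2 * x) * f \<i>)"
        and eq2: "p * expi (2 * 1) x + p' * expi (2 * (-1)) x = p * cis (2 * x) + p' * cis (- (2 * x))" by simp_all
      show ?thesis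
        unfolding eq eq2 unfolding p_def p'_def by (rule complex_eqI) (simp_all add: field_simps)
    qed
    then have "(\<lambda>x. W x * of_real (f (c x))) = (\<lambda>x. p * (W x * expi (2 * 1) x) + p' * (W x * expi (2 * (-1)) x))"
      by (simp add: fun_eq_iff algebra_simps)
    then show ?case using linear by (simp only:) (intro Zadd Zcmult Zshift)
  next
    case (const C)
    then show ?case using Zcmult[of W "of_real C"] by (simp add: mult.commute)
  next
    case (add f g)
    then show ?case using Zadd[OF add.IH(1)[OF add.prems] add.IH(2)[OF add.prems]] by (simp add: distrib_left)
  next
    case (mult f g)
    then show ?case using mult.IH(2)[OF mult.IH(1)[OF mult.prems]] by (simp add: mult.assoc)
  qed
  have ZV: "Z V" using contV zero by (simp add: Z_def)
  define I where "I = integral {0..pi} (\<lambda>x. cmod (V x))"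
  define J where "J = integral {0..pi} (\<lambda>x. (cmod (V x))\<^sup>2)"
  have cI: "(\<lambda>x. cmod (V x)) integrable_on {0..pi}" by (intro integrable_continuous_real continuous_intros contV)
  have I0: "I \<ge> 0" unfolding I_def by (intro integral_nonneg cI) auto
  have small: "J \<le> e * I" if e: "e > 0" for e
  proof -
    obtain h where h: "polynomial_function h" "\<And>w. w \<in> sphere 0 1 \<Longrightarrow> norm (F w - h w) < e"
      using Stone_Weierstrass_polynomial_function[OF compact_sphere contF e] by blast
    have hr: "real_polynomial_function (Re \<circ> h)" "real_polynomial_function (Im \<circ> h)"
      using h(1) bounded_linear_Re bounded_linear_Im by (auto simp: polynomial_function_def)
    have "Z (\<lambda>x. V x * of_real ((Re \<circ> h) (c x)) + \<i> * (V x * of_real ((Im \<circ> h) (c x))))"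
      by (intro Zadd Zcmult Zr hr ZV)
    moreover have "V x * of_real ((Re \<circ> h) (c x)) + \<i> * (V x * of_real ((Im \<circ> h) (c x))) = V x * h (c x)" for x
      by (simp add: complex_eq_iff algebra_simps)
    ultimately have Zh: "Z (\<lambda>x. V x * h (c x))" by simp
    then have i0: "integral {0..pi} (\<lambda>x. V x * h (c x)) = 0" and ch: "continuous_on {0..pi} (\<lambda>x. V x * h (c x))"
    proof -
      have "integral {0..pi} (\<lambda>x. V x * h (c x) * expi (2 * 0) x) = 0" using Zh unfolding Z_def by blast
      then show "integral {0..pi} (\<lambda>x. V x * h (c x)) = 0" by simp
      show "continuous_on {0..pi} (\<lambda>x. V x * h (c x))" using Zh unfolding Z_def by blast
    qed
    have "complex_of_real J = integral {0..pi} (\<lambda>x. complex_of_real ((cmod (V x))\<^sup>2))"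
      unfolding J_def
      by (subst integral_linear[OF _ bounded_linear_of_real, symmetric])
         (auto simp: o_def intro!: integrable_continuous_real continuous_intros contV)
    also have "\<dots> = integral {0..pi} (\<lambda>x. V x * cnj (V x)) - integral {0..pi} (\<lambda>x. V x * h (c x))"
      unfolding complex_norm_square i0 by simp
    also have "\<dots> = integral {0..pi} (\<lambda>x. V x * cnj (V x) - V x * h (c x))"
      by (rule Henstock_Kurzweil_Integration.integral_diff[symmetric])
         (intro integrable_continuous_real continuous_intros contV ch)+
    finally have J: "complex_of_real J = integral {0..pi} (\<lambda>x. V x * cnj (V x) - V x * h (c x))" .
    have "J \<le> cmod (complex_of_real J)" by simp
    also have "\<dots> = cmod (integral {0..pi} (\<lambda>x. V x * cnj (V x) - V x * h (c x)))" by (simp only: J)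
    also have "\<dots> \<le> integral {0..pi} (\<lambda>x. e * cmod (V x))"
    proof (rule integral_norm_bound_integral)
      fix x assume x: "x \<in> {0..pi}"
      have "cmod (V x * cnj (V x) - V x * h (c x)) = cmod (V x) * cmod (F (c x) - h (c x))"
        by (simp add: Fc[OF x] flip: right_diff_distrib norm_mult)
      also have "\<dots> \<le> cmod (V x) * e" using h(2)[OF c_sphere[of x]] by (intro mult_left_mono) auto
      finally show "cmod (V x * cnj (V x) - V x * h (c x)) \<le> e * cmod (V x)" by (simp add: mult.commute)
    qed (intro integrable_continuous_real continuous_intros contV ch)+
    also have "\<dots> = e * I" by (simp add: I_def)
    finally show ?thesis .
  qed
  have "J \<le> 0"
  proof (rule field_le_epsilon)
    fix e :: real assume e: "e > 0"
    have "J \<le> e / (I + 1) * I" using e I0 by (intro small) auto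
    also have "\<dots> \<le> e" using e I0 by (simp add: field_simps)
    finally show "J \<le> 0 + e" by simp
  qed
  moreover have "J \<ge> 0" unfolding J_def by (intro integral_nonneg integrable_continuous_real continuous_intros contV) auto
  ultimately have "J = 0" by linarith
  moreover have "continuous_on {0..pi} (\<lambda>x. (cmod (V x))\<^sup>2)" by (intro continuous_intros contV)
  ultimately have "\<forall>x\<in>{0..pi}. (cmod (V x))\<^sup>2 = 0"
    using integral_eq_0_iff[of 0 pi "\<lambda>x. (cmod (V x))\<^sup>2"] unfolding J_def by simp
  then show ?thesis using x by simp
qed

section \<open>From coefficient sequences to functions\<close>

abbreviation bilin :: "(real \<Rightarrow> complex) \<Rightarrow> (real \<Rightarrow> complex) \<Rightarrow> complex" where
  "bilin f h \<equiv> LINT x|leb_pi. f x * h x"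

text \<open>No conjugation, in accordance with \<open>bilin\<close>: on a trigonometric sum,
  \<open>hat\<close> at frequency \<open>m\<close> reads the coefficient at \<open>- m\<close>. This
  is the source of the index reflections below.\<close>

definition hat :: "(real \<Rightarrow> complex) \<Rightarrow> int \<Rightarrow> complex" where
  "hat f m = (LINT x|leb_pi. f x * expi m x)"

lemma hat_bounded: "integrable leb_pi f \<Longrightarrow> cmod (hat f m) \<le> (LINT x|leb_pi. cmod (f x))"
  unfolding hat_def
  by (rule order_trans[OF integral_norm_bound]) (simp add: norm_mult)

lemma hat_cong_AE:
  assumes "AE x in leb_pi. f x = g x" "f \<in> borel_measurable leb_pi" "g \<in> borel_measurable leb_pi"
  shows "hat f m = hat g m"
  unfolding hat_def
  using assms cont_meas[OF expi_cont] by (intro integral_cong_AE) (auto elim!: eventually_mono)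

lemma L2_meas: "f \<in> L2_pi \<Longrightarrow> f \<in> borel_measurable leb_pi"
  by (simp add: L2_pi_def)

section \<open>Absolutely convergent trigonometric series\<close>

definition trig_sum :: "(int \<Rightarrow> complex) \<Rightarrow> nat \<Rightarrow> real \<Rightarrow> complex" where
  "trig_sum y n x = (\<Sum>\<^sub>\<infinity>k. y k * expi (2 * k - int n) x)"

lemma infsum_int_sums:
  fixes f :: "int \<Rightarrow> 'a::banach"
  assumes "f summable_on UNIV"
  shows "(\<lambda>j. f (int_decode j)) sums infsum f UNIV"
proof (rule has_sum_imp_sums)
  have "(f has_sum infsum f UNIV) UNIV" by (rule has_sum_infsum[OF assms])
  then show "((\<lambda>j. f (int_decode j)) has_sum infsum f UNIV) UNIV"
    by (rule has_sum_reindex_bij_betw[OF bij_int_decode, THEN iffD2])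
qed

lemma trig_sum_sums:
  assumes "abs_summable y"
  shows "(\<lambda>j. y (int_decode j) * expi (2 * int_decode j - int n) x) sums trig_sum y n x"
    and "(\<lambda>j. cmod (y (int_decode j))) sums infsum (\<lambda>k. cmod (y k)) UNIV"
proof -
  have "(\<lambda>k. y k * expi (2 * k - int n) x) summable_on UNIV"
    by (rule abs_summable_summable) (use assms in \<open>simp add: norm_mult\<close>)
  then show "(\<lambda>j. y (int_decode j) * expi (2 * int_decode j - int n) x) sums trig_sum y n x"
    unfolding trig_sum_def by (rule infsum_int_sums)
  show "(\<lambda>j. cmod (y (int_decode j))) sums infsum (\<lambda>k. cmod (y k)) UNIV"
    by (rule infsum_int_sums[OF assms])
qed

lemma trig_sum_cont:
  assumes y: "abs_summable y"
  shows "continuous_on A (trig_sum y n)"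
proof -
  have "uniform_limit A (\<lambda>N x. \<Sum>j<N. y (int_decode j) * expi (2 * int_decode j - int n) x)
     (\<lambda>x. \<Sum>j. y (int_decode j) * expi (2 * int_decode j - int n) x) sequentially"
    by (rule Weierstrass_m_test[where M="\<lambda>j. cmod (y (int_decode j))"])
       (auto simp: norm_mult intro: sums_summable[OF trig_sum_sums(2)[OF y]])
  then have "continuous_on A (\<lambda>x. \<Sum>j. y (int_decode j) * expi (2 * int_decode j - int n) x)"
    by (rule uniform_limit_theorem[rotated]) (auto intro!: always_eventually continuous_intros)
  moreover have "(\<Sum>j. y (int_decode j) * expi (2 * int_decode j - int n) x) = trig_sum y n x" for x
    using trig_sum_sums(1)[OF y] by (rule sums_unique[symmetric])
  ultimately show ?thesis by simp
qed

lemma trig_sum_pi: "trig_sum y n pi = expi (int n) pi * trig_sum y n 0"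
proof -
  have "trig_sum y n pi = (\<Sum>\<^sub>\<infinity>k. expi (int n) pi * (y k * expi (2 * k - int n) 0))"
    unfolding trig_sum_def by (intro infsum_cong) (simp add: expi_pi mult.commute)
  then show ?thesis unfolding trig_sum_def by (simp add: infsum_cmult_right')
qed

lemma trig_sum_close:
  assumes y: "abs_summable y" "y k0 = 1" "infsum (\<lambda>k. cmod (y k)) (-{k0}) \<le> \<epsilon>"
  shows "cmod (trig_sum y n x - expi (2 * k0 - int n) x) \<le> \<epsilon>"
proof -
  let ?f = "\<lambda>k. y k * expi (2 * k - int n) x"
  have s: "?f summable_on A" for A
    by (rule abs_summable_summable) (use summable_on_subset_banach[OF y(1), of A] in \<open>simp add: norm_mult\<close>)
  have "infsum ?f ({k0} \<union> -{k0}) = infsum ?f {k0} + infsum ?f (-{k0})"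
    by (intro infsum_Un_disjoint s) auto
  then have "trig_sum y n x - expi (2 * k0 - int n) x = infsum ?f (-{k0})"
    using y(2) by (simp add: trig_sum_def Compl_partition)
  also have "cmod \<dots> \<le> infsum (\<lambda>k. cmod (?f k)) (-{k0})"
    by (rule norm_infsum_bound) (use summable_on_subset_banach[OF y(1), of "-{k0}"] in \<open>simp add: norm_mult\<close>)
  also have "\<dots> \<le> \<epsilon>" using y(3) by (simp add: norm_mult)
  finally show ?thesis .
qed

text \<open>The integers are enumerated by \<open>int_decode\<close>, so that termwise integration
  of ordinary series applies; absolute summability makes the order immaterial.\<close>

lemma LINT_trig_sum:
  assumes y: "abs_summable y" and f: "integrable leb_pi f"
  shows "(LINT x|leb_pi. f x * trig_sum y n x) = (\<Sum>\<^sub>\<infinity>k. y k * hat f (2 * k - int n))"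
    and "(\<lambda>k. y k * hat f (2 * k - int n)) summable_on UNIV"
proof -
  define C where "C = (LINT x|leb_pi. cmod (f x))"
  have hC: "cmod (hat f m) \<le> C" for m unfolding C_def by (rule hat_bounded[OF f])
  show s: "(\<lambda>k. y k * hat f (2 * k - int n)) summable_on UNIV"
  proof -
    have "(\<lambda>k. cmod (y k * hat f (2 * k - int n))) summable_on UNIV"
      by (rule summable_on_comparison_test[OF summable_on_cmult_left[OF y, of C]])
         (auto simp: norm_mult intro!: mult_left_mono hC)
    then show ?thesis by (rule abs_summable_summable)
  qed
  let ?t = "\<lambda>j x. f x * (y (int_decode j) * expi (2 * int_decode j - int n) x)"
  have ti: "integrable leb_pi (?t j)" for j
    by (intro integrable_mult_cont f continuous_intros)
  have nt: "norm (?t j x) = cmod (y (int_decode j)) * cmod (f x)" for j x by (simp add: norm_mult)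
  have sy: "summable (\<lambda>j. cmod (y (int_decode j)))" by (rule sums_summable[OF trig_sum_sums(2)[OF y]])
  have "(LINT x|leb_pi. (\<Sum>j. ?t j x)) = (\<Sum>j. integral\<^sup>L leb_pi (?t j))"
  proof (rule integral_suminf[OF ti])
    show "AE x in leb_pi. summable (\<lambda>j. norm (?t j x))"
      unfolding nt by (intro AE_I2 summable_mult2 sy)
    show "summable (\<lambda>j. LINT x|leb_pi. norm (?t j x))"
      unfolding nt by (simp add: summable_mult2 sy)
  qed
  moreover have "(\<Sum>j. ?t j x) = f x * trig_sum y n x" for x
    using sums_mult[OF trig_sum_sums(1)[OF y], of "f x"] by (rule sums_unique[symmetric])
  moreover have "integral\<^sup>L leb_pi (?t j) = y (int_decode j) * hat f (2 * int_decode j - int n)" for j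
    unfolding hat_def by (subst integral_mult_right_zero[symmetric]) (simp add: mult_ac)
  ultimately have "(LINT x|leb_pi. f x * trig_sum y n x) = (\<Sum>j. y (int_decode j) * hat f (2 * int_decode j - int n))"
    by simp
  also have "\<dots> = (\<Sum>\<^sub>\<infinity>k. y k * hat f (2 * k - int n))"
    by (rule sums_unique[symmetric, OF infsum_int_sums[OF s]])
  finally show "(LINT x|leb_pi. f x * trig_sum y n x) = (\<Sum>\<^sub>\<infinity>k. y k * hat f (2 * k - int n))" .
qed

text \<open>On an interval of length \<pi> exponentials are orthogonal only when their frequencies
  have equal parity; this is why parities are tracked up to the main result.\<close>

lemma hat_expi:
  assumes "even (m + k)"
  shows "hat (expi m) k = (if m + k = 0 then of_real pi else 0)"
proof -
  obtain j where j: "m + k = 2 * j" using assms by (rule evenE)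
  have "hat (expi m) k = (LINT x|leb_pi. expi (2 * j) x)" by (simp add: hat_def j flip: expi_add)
  also have "\<dots> = integral {0..pi} (expi (2 * j))" by (intro LINT_eq_integral integrable_cont expi_cont)
  finally show ?thesis using j by (simp add: expi_integral)
qed

lemma hat_trig_sum:
  assumes y: "abs_summable y"
  shows "hat (trig_sum y n) (2 * k - int n) = of_real pi * y (int n - k)"
proof -
  have "hat (trig_sum y n) (2 * k - int n) = (LINT x|leb_pi. expi (2 * k - int n) x * trig_sum y n x)"
    by (simp add: hat_def mult.commute)
  also have "\<dots> = (\<Sum>\<^sub>\<infinity>j. y j * hat (expi (2 * k - int n)) (2 * j - int n))"
    by (intro LINT_trig_sum y integrable_cont expi_cont)
  also have "\<dots> = (\<Sum>\<^sub>\<infinity>j\<in>{int n - k}. y j * of_real pi)"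
    by (rule infsum_cong_neutral) (auto simp: hat_expi)
  finally show ?thesis by (simp add: mult.commute)
qed

text \<open>\<open>\<sigma>\<close> is the sign \<open>(-1) ^ n\<close>, so the exponentials with
  frequencies \<open>2 * k - n\<close> are exactly those meeting the boundary condition.\<close>

locale hill_setup =
  fixes R S :: nat and a b :: complex and v :: "real \<Rightarrow> complex" and \<sigma> :: complex and n :: nat
  assumes v: "v = (\<lambda>x. a * exp (- 2 * \<i> * of_nat R * of_real x) + b * exp (2 * \<i> * of_nat S * of_real x))"
    and sigma: "\<sigma> = expi (int n) pi"
begin

lemma v_expi: "v x * expi m x = a * expi (m - 2 * int R) x + b * expi (m + 2 * int S) x"
  by (simp add: v expi_def distrib_right exp_add[symmetric] mult.assoc) (simp add: algebra_simps)

lemma v_cont: "continuous_on A v"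
  unfolding v by (intro continuous_intros)

lemma sigma2: "\<sigma> * \<sigma> = 1"
  by (simp add: sigma expi_pi)

lemma expi_pi_sigma: "expi (2 * k - int n) pi = \<sigma>" "expi (2 * k + int n) pi = \<sigma>"
  by (auto simp: sigma expi_pi)

text \<open>After two integrations by parts the boundary terms cancel: functions and exponential
  each contribute a factor \<open>\<sigma>\<close>, whose square is 1. Multiplication by
  \<open>v\<close> shifts indices, opposite to \<open>hill_rec\<close>: the coefficients obey the
  transposed recurrence.\<close>

lemma hat_hill:
  assumes L: "hill_op \<sigma> v w g"
  defines "m \<equiv> \<lambda>k. 2 * k - int n"
  shows "hat g (m k) = of_int ((m k)\<^sup>2) * hat w (m k) + a * hat w (m (k - int R)) + b * hat w (m (k + int S))"
proof -
  obtain u u1 u2 where u: "H2_derivs u u1 u2" "u pi = \<sigma> * u 0" "u1 pi = \<sigma> * u1 0"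
    "AE x in leb_pi. w x = u x" "AE x in leb_pi. g x = - u2 x + v x * u x" and wg: "w \<in> L2_pi" "g \<in> L2_pi"
    using L unfolding hill_op_def by blast
  define q where "q = m k"
  have u2: "integrable leb_pi u2" and du: "\<And>x. x \<in> {0..pi} \<Longrightarrow> (u has_vector_derivative u1 x) (at x within {0..pi})"
    and du1: "\<And>x. x \<in> {0..pi} \<Longrightarrow> (u2 has_integral (u1 x - u1 0)) {0..x}"
    using u(1) L2_integrable by (auto simp: H2_derivs_def)
  have cu: "continuous_on {0..pi} u"
    using du has_vector_derivative_continuous continuous_on_eq_continuous_within by blast
  note ibp = ibp_expi[OF u2 du1]
  have exs: "expi q pi = \<sigma>" by (simp add: q_def m_def expi_pi_sigma)
  have "((\<lambda>x. u1 x * expi q x + u x * (\<i> * of_int q * expi q x)) has_integral (u pi * expi q pi - u 0 * expi q 0)) {0..pi}"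
    by (rule fundamental_theorem_of_calculus)
       (auto intro!: has_vector_derivative_eq_rhs[OF has_vector_derivative_mult[OF du expi_deriv]] simp: add.commute)
  then have "integral {0..pi} (\<lambda>x. u1 x * expi q x + u x * (\<i> * of_int q * expi q x)) = 0"
    using u(2) exs sigma2 by (simp add: integral_unique mult_ac)
  moreover have "integral {0..pi} (\<lambda>x. u1 x * expi q x + u x * (\<i> * of_int q * expi q x)) =
     integral {0..pi} (\<lambda>x. u1 x * expi q x) + integral {0..pi} (\<lambda>x. u x * (\<i> * of_int q * expi q x))"
    by (intro Henstock_Kurzweil_Integration.integral_add integrable_continuous_real continuous_intros cu ibp(2)) auto
  ultimately have i1: "integral {0..pi} (\<lambda>x. u1 x * expi q x) = - \<i> * of_int q * integral {0..pi} (\<lambda>x. u x * expi q x)"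
    by (simp add: eq_neg_iff_add_eq_0 mult.left_commute[of _ "\<i> * of_int q"])
  have "integral {0..pi} (\<lambda>x. u2 x * expi q x) = - integral {0..pi} (\<lambda>x. u1 x * (\<i> * of_int q * expi q x))"
    using ibp(1)[of q] u(3) exs sigma2 by (simp add: mult_ac)
  also have "integral {0..pi} (\<lambda>x. u1 x * (\<i> * of_int q * expi q x)) = \<i> * of_int q * integral {0..pi} (\<lambda>x. u1 x * expi q x)"
    by (simp add: mult.left_commute[of _ "\<i> * of_int q"])
  finally have i2: "integral {0..pi} (\<lambda>x. u2 x * expi q x) = - of_int (q\<^sup>2) * integral {0..pi} (\<lambda>x. u x * expi q x)"
    unfolding i1 by (simp add: power2_eq_square mult_ac)
  have ui: "integrable leb_pi u" by (rule integrable_cont[OF cu])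
  have hat_u2: "hat u2 q = - of_int (q\<^sup>2) * hat u q"
    unfolding hat_def using i2
    by (simp add: LINT_eq_integral integrable_mult_cont[OF u2 expi_cont] integrable_mult_cont[OF ui expi_cont])
  have hw: "hat w j = hat u j" for j
    by (rule hat_cong_AE[OF u(4) L2_meas[OF wg(1)] cont_meas[OF cu]])
  have vu: "integrable leb_pi (\<lambda>x. v x * u x)" using integrable_mult_cont[OF ui v_cont] by (simp add: mult.commute)
  have "hat g q = hat (\<lambda>x. - u2 x + v x * u x) q"
    using u2 vu by (intro hat_cong_AE[OF u(5) L2_meas[OF wg(2)]] borel_measurable_add borel_measurable_uminus) auto
  also have "\<dots> = - hat u2 q + hat (\<lambda>x. v x * u x) q"
    unfolding hat_def using integrable_mult_cont[OF u2 expi_cont] integrable_mult_cont[OF vu expi_cont]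
    by (simp add: left_diff_distrib)
  also have "hat (\<lambda>x. v x * u x) q = (LINT x|leb_pi. a * (u x * expi (q - 2 * int R) x) + b * (u x * expi (q + 2 * int S) x))"
  proof -
    have "v x * u x * expi q x = a * (u x * expi (q - 2 * int R) x) + b * (u x * expi (q + 2 * int S) x)" for x
    proof -
      have "v x * u x * expi q x = u x * (v x * expi q x)" by simp
      also have "\<dots> = a * (u x * expi (q - 2 * int R) x) + b * (u x * expi (q + 2 * int S) x)"
        unfolding v_expi by (simp add: algebra_simps)
      finally show ?thesis .
    qed
    then show ?thesis by (simp add: hat_def)
  qed
  also have "\<dots> = a * hat u (q - 2 * int R) + b * hat u (q + 2 * int S)"
    unfolding hat_def using integrable_mult_cont[OF ui expi_cont] by simp
  also have "q - 2 * int R = m (k - int R)" by (simp add: q_def m_def)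
  also have "q + 2 * int S = m (k + int S)" by (simp add: q_def m_def)
  finally show ?thesis unfolding hat_u2 hw by (simp add: q_def)
qed

end

section \<open>One mode and its pairing with the root functions\<close>

locale hill_mode = hill_setup +
  fixes z :: complex and y :: "int \<Rightarrow> complex"
  assumes y_sum: "abs_summable y"
    and y_rec: "hill_rec R S a b n z y"
    and y_pair: "self_conv n y \<noteq> 0"
    and y_unique: "\<And>w. hill_rec R S a b n z w \<Longrightarrow> bounded (range w) \<Longrightarrow> \<exists>c. \<forall>k. w k = c * y k"
begin

definition lam :: complex where "lam = (of_nat n)\<^sup>2 + z"

definition Y :: "real \<Rightarrow> complex" where "Y = trig_sum y n"

lemma Y_cont: "continuous_on A Y"
  unfolding Y_def by (rule trig_sum_cont[OF y_sum])

lemma Y_square: "bilin Y Y \<noteq> 0"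
proof -
  have "bilin Y Y = (\<Sum>\<^sub>\<infinity>k. y k * hat Y (2 * k - int n))"
    using LINT_trig_sum(1)[OF y_sum integrable_cont[OF Y_cont]] by (simp add: Y_def)
  also have "\<dots> = (\<Sum>\<^sub>\<infinity>k. of_real pi * (y k * y (int n - k)))"
    unfolding Y_def hat_trig_sum[OF y_sum] by (simp add: mult_ac)
  also have "\<dots> = of_real pi * self_conv n y" by (rule infsum_cmult_right')
  finally show ?thesis using y_pair by simp
qed

text \<open>\<open>Y\<close> is an eigenvector of the transpose. Shifting summation indices moves
  the action of the operator from the coefficients of \<open>w\<close> onto \<open>y\<close>, where
  the recurrence applies; absolute summability of \<open>y\<close> and boundedness of the
  coefficients suffice, and no derivative of \<open>Y\<close> occurs.\<close>

lemma resolvent_pairing: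
  assumes L: "hill_op \<sigma> v w g"
  shows "bilin g Y = lam * bilin w Y"
proof -
  define W where "W k = hat w (2 * k - int n)" for k
  define G where "G k = hat g (2 * k - int n)" for k
  have wg: "integrable leb_pi w" "integrable leb_pi g" using L L2_integrable by (auto simp: hill_op_def)
  note sw = LINT_trig_sum[OF y_sum wg(1), of n, folded W_def Y_def]
  note sg = LINT_trig_sum[OF y_sum wg(2), of n, folded G_def Y_def]
  define C where "C = (LINT x|leb_pi. cmod (w x))"
  have WC: "cmod (W k) \<le> C" for k unfolding W_def C_def by (rule hat_bounded[OF wg(1)])
  have s1: "(\<lambda>k. y (k + c) * W k) summable_on UNIV" for c
  proof (rule summable_on_mult_bounded(1))
    show "(\<lambda>k. cmod (y (k + c))) summable_on UNIV"
      using summable_int_shift[of "\<lambda>k. cmod (y k)" c] y_sum by simp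
  qed (rule WC)
  have s2: "(\<lambda>k. y k * W (k + c)) summable_on UNIV" for c
    by (rule summable_on_mult_bounded(1)[OF y_sum WC])
  have i12: "infsum (\<lambda>k. y k * W (k + c)) UNIV = infsum (\<lambda>k. y (k - c) * W k) UNIV" for c
    using infsum_int_shift[of "\<lambda>k. y (k - c) * W k" c] by simp
  \<comment> \<open>All shifts are written as additions, also of negative numbers, to match
    \<open>s1\<close>, \<open>s2\<close> and \<open>i12\<close>. After summation the two groups of
    shifted terms cancel.\<close>
  have G: "y k * G k = lam * (y k * W k) + ((a * (y k * W (k + (- int R))) + b * (y k * W (k + int S)))
      + (- a * (y (k + int R) * W k) + - b * (y (k + (- int S)) * W k)))" for k
  proof -
    have "G k = of_int ((2 * k - int n)\<^sup>2) * W k + a * W (k - int R) + b * W (k + int S)"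
      unfolding G_def W_def using hat_hill[OF L] by simp
    moreover define E where "E = 4 * of_int k * of_int (int n - k) + z"
    have "of_int ((2 * k - int n)\<^sup>2) = lam - E"
      by (simp add: lam_def E_def power2_eq_square algebra_simps)
    ultimately have Gk: "G k = (lam - E) * W k + a * W (k - int R) + b * W (k + int S)" by (simp only:)
    have G: "y k * G k = lam * (y k * W k) - E * y k * W k + (a * (y k * W (k - int R)) + b * (y k * W (k + int S)))"
      unfolding Gk by (simp add: algebra_simps)
    have "(4 * of_int k * of_int (int n - k) + z) * y k = a * y (k + int R) + b * y (k - int S)"
      using y_rec by (simp add: hill_rec_def)
    then have E: "E * y k * W k = a * (y (k + int R) * W k) + b * (y (k - int S) * W k)"
      unfolding E_def by (simp only: distrib_right mult.assoc)
    show ?thesis unfolding G E by simp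
  qed
  have "bilin g Y = (\<Sum>\<^sub>\<infinity>k. lam * (y k * W k) + ((a * (y k * W (k + (- int R))) + b * (y k * W (k + int S)))
      + (- a * (y (k + int R) * W k) + - b * (y (k + (- int S)) * W k))))"
    unfolding sg(1) G ..
  also have "\<dots> = (\<Sum>\<^sub>\<infinity>k. lam * (y k * W k)) + (((\<Sum>\<^sub>\<infinity>k. a * (y k * W (k + (- int R)))) + (\<Sum>\<^sub>\<infinity>k. b * (y k * W (k + int S))))
      + ((\<Sum>\<^sub>\<infinity>k. - a * (y (k + int R) * W k)) + (\<Sum>\<^sub>\<infinity>k. - b * (y (k + (- int S)) * W k))))"
    by (subst infsum_add | intro summable_on_add summable_on_cmult_right s1 s2 sw(2) | rule refl)+
  also have "\<dots> = lam * (\<Sum>\<^sub>\<infinity>k. y k * W k)"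
    unfolding infsum_cmult_right' i12 by simp
  finally show ?thesis unfolding sw(1) .
qed

text \<open>The coefficients of \<open>w\<close> form a bounded solution of the recurrence, so they
  are a multiple of \<open>y\<close>; uniqueness of Fourier coefficients transfers this to the
  functions.\<close>

lemma kernel_multiple:
  assumes L: "hill_op \<sigma> v w g" and ae: "AE x in leb_pi. g x = lam * w x"
  shows "\<exists>c. AE x in leb_pi. w x = c * Y x"
proof -
  have wg: "w \<in> L2_pi" "g \<in> L2_pi" using L by (auto simp: hill_op_def)
  \<comment> \<open>Reading the coefficients in reverse order turns the transposed relation of
    \<open>hat_hill\<close> back into \<open>hill_rec\<close>.\<close>
  define W where "W k = hat w (2 * (int n - k) - int n)" for k
  have hg: "hat g m = lam * hat w m" for m
  proof -
    have "hat g m = hat (\<lambda>x. lam * w x) m"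
      using L2_meas[OF wg(1)] L2_meas[OF wg(2)] by (intro hat_cong_AE[OF ae]) auto
    then show ?thesis by (simp add: hat_def mult.assoc)
  qed
  have "hill_rec R S a b n z W"
    unfolding hill_rec_def
  proof
    fix k
    have "lam * W k = of_int ((2 * (int n - k) - int n)\<^sup>2) * W k + a * W (k + int R) + b * W (k - int S)"
      using hat_hill[OF L, of "int n - k"] unfolding hg W_def by (simp add: algebra_simps)
    moreover define E where "E = 4 * of_int k * of_int (int n - k) + z"
    have "of_int ((2 * (int n - k) - int n)\<^sup>2) = lam - E"
      by (simp add: lam_def E_def power2_eq_square algebra_simps)
    ultimately have "lam * W k = (lam - E) * W k + a * W (k + int R) + b * W (k - int S)" by (simp only:)
    then have "E * W k = a * W (k + int R) + b * W (k - int S)" by (simp add: algebra_simps)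
    then show "(4 * of_int k * of_int (int n - k) + z) * W k = a * W (k + int R) + b * W (k - int S)"
      unfolding E_def .
  qed
  moreover have "bounded (range W)"
    unfolding bounded_iff W_def using hat_bounded[OF L2_integrable[OF wg(1)]] by blast
  ultimately obtain c where c: "\<And>k. W k = c * y k" using y_unique by blast
  define c' where "c' = c / of_real pi"
  obtain u u1 u2 where u: "H2_derivs u u1 u2" "u pi = \<sigma> * u 0" "AE x in leb_pi. w x = u x"
    using L unfolding hill_op_def by blast
  have cu: "continuous_on {0..pi} u"
    using u(1) has_vector_derivative_continuous continuous_on_eq_continuous_within unfolding H2_derivs_def by blast
  \<comment> \<open>The extra exponential makes the difference periodic and its frequencies even:
    both factors pick up \<open>\<sigma>\<close> at \<pi>, and \<open>fourier_unique\<close> becomes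
    applicable.\<close>
  define V where "V x = (u x - c' * Y x) * expi (int n) x" for x
  have cV: "continuous_on {0..pi} V" unfolding V_def by (intro continuous_intros cu Y_cont)
  have V0: "V x = 0" if "x \<in> {0..pi}" for x
  proof (rule fourier_unique[OF cV _ _ that])
    have "Y pi = \<sigma> * Y 0" unfolding Y_def sigma by (rule trig_sum_pi)
    then have "V pi = (\<sigma> * \<sigma>) * (u 0 - c' * Y 0)" by (simp add: V_def u(2) sigma algebra_simps)
    then show "V pi = V 0" by (simp add: sigma2 V_def)
    fix j :: int
    have e: "expi (int n) x * expi (2 * j) x = expi (2 * (int n + j) - int n) x" for x
      by (simp flip: expi_add)
    have ui: "integrable leb_pi u" "integrable leb_pi Y" by (intro integrable_cont cu Y_cont)+
    have "hat w m = hat u m" for m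
      by (rule hat_cong_AE[OF u(3) L2_meas[OF wg(1)] cont_meas[OF cu]])
    then have "hat u (2 * (int n + j) - int n) = W (- j)" by (simp add: W_def)
    moreover have "c' * hat Y (2 * (int n + j) - int n) = W (- j)"
      unfolding Y_def hat_trig_sum[OF y_sum] by (simp add: c c'_def)
    ultimately have "0 = hat u (2 * (int n + j) - int n) - c' * hat Y (2 * (int n + j) - int n)" by simp
    also have "\<dots> = (LINT x|leb_pi. u x * expi (2 * (int n + j) - int n) x - c' * (Y x * expi (2 * (int n + j) - int n) x))"
      unfolding hat_def
      by (simp add: integrable_mult_cont[OF ui(1) expi_cont] integrable_mult_cont[OF ui(2) expi_cont])
    also have "\<dots> = (LINT x|leb_pi. V x * expi (2 * j) x)"
      unfolding V_def mult.assoc e by (simp add: algebra_simps)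
    also have "\<dots> = integral {0..pi} (\<lambda>x. V x * expi (2 * j) x)"
      by (intro LINT_eq_integral integrable_cont continuous_intros cV)
    finally show "integral {0..pi} (\<lambda>x. V x * expi (2 * j) x) = 0" by simp
  qed
  have "expi (int n) x \<noteq> 0" for x by (metis norm_expi norm_zero zero_neq_one)
  then have "u x = c' * Y x" if "x \<in> {0..pi}" for x using V0[OF that] by (simp add: V_def)
  then have "AE x in leb_pi. u x = c' * Y x" by (intro AE_I2) auto
  with u(3) have "AE x in leb_pi. w x = c' * Y x" by eventually_elim simp
  then show ?thesis by blast
qed

text \<open>Pairing \<open>(L - \<mu>) w\<close> with \<open>Y\<close> gives
  \<open>lam - \<mu>\<close> times the pairing of \<open>w\<close>, so the vanishing propagates up
  the chain of associated functions.\<close>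

lemma pairing_other:
  assumes "in_ker_pow (hill_op \<sigma> v) \<mu> k w" "\<mu> \<noteq> lam"
  shows "bilin w Y = 0"
  using assms(1)
proof (induction k arbitrary: w)
  case 0
  then have "w \<in> L2_pi" and ae: "AE x in leb_pi. w x = 0" by auto
  have "bilin w Y = (LINT x|leb_pi. 0)"
    using ae integrable_mult_cont[OF L2_integrable[OF \<open>w \<in> L2_pi\<close>] Y_cont]
    by (intro integral_cong_AE) (auto elim: eventually_mono)
  then show ?case by simp
next
  case (Suc k)
  then obtain g where g: "hill_op \<sigma> v w g" "in_ker_pow (hill_op \<sigma> v) \<mu> k (\<lambda>x. g x - \<mu> * w x)" by auto
  have wg: "integrable leb_pi w" "integrable leb_pi g" using g(1) L2_integrable by (auto simp: hill_op_def)
  note wi = integrable_mult_cont[OF wg(1) Y_cont] integrable_mult_cont[OF wg(2) Y_cont]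
  have "0 = (LINT x|leb_pi. (g x - \<mu> * w x) * Y x)" using Suc.IH[OF g(2)] by simp
  also have "\<dots> = (LINT x|leb_pi. g x * Y x - \<mu> * (w x * Y x))" by (simp add: algebra_simps)
  also have "\<dots> = (lam - \<mu>) * bilin w Y"
    using wi resolvent_pairing[OF g(1)] by (simp add: algebra_simps)
  finally show ?case using assms(2) by simp
qed

text \<open>There are no Jordan chains at \<open>lam\<close>: if \<open>(L - lam) w = c * Y\<close>,
  pairing with \<open>Y\<close> gives 0 on the left and \<open>c\<close> times the nonzero
  \<open>bilin Y Y\<close> on the right.\<close>

lemma root_multiple:
  assumes "in_ker_pow (hill_op \<sigma> v) lam k w"
  shows "\<exists>c. AE x in leb_pi. w x = c * Y x"
  using assms
proof (induction k arbitrary: w)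
  case 0
  then show ?case by (intro exI[of _ 0]) auto
next
  case (Suc k)
  then obtain g where g: "hill_op \<sigma> v w g" "in_ker_pow (hill_op \<sigma> v) lam k (\<lambda>x. g x - lam * w x)" by auto
  have wg: "integrable leb_pi w" "integrable leb_pi g" using g(1) L2_integrable by (auto simp: hill_op_def)
  note wi = integrable_mult_cont[OF wg(1) Y_cont] integrable_mult_cont[OF wg(2) Y_cont]
  obtain c where c: "AE x in leb_pi. g x - lam * w x = c * Y x" using Suc.IH[OF g(2)] by blast
  have "c * bilin Y Y = (LINT x|leb_pi. c * (Y x * Y x))" by simp
  also have "\<dots> = (LINT x|leb_pi. g x * Y x - lam * (w x * Y x))"
  proof (rule integral_cong_AE)
    show "AE x in leb_pi. c * (Y x * Y x) = g x * Y x - lam * (w x * Y x)"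
      using c
    proof eventually_elim
      case (elim x)
      have "c * (Y x * Y x) = (g x - lam * w x) * Y x" unfolding elim by simp
      then show ?case by (simp add: left_diff_distrib)
    qed
  qed (use wi integrable_mult_cont[OF integrable_cont[OF Y_cont] Y_cont] in auto)
  also have "\<dots> = 0" using wi resolvent_pairing[OF g(1)] by simp
  finally have "c = 0" using Y_square by simp
  then have "AE x in leb_pi. g x = lam * w x" using c by (auto elim: eventually_mono)
  then show ?case by (rule kernel_multiple[OF g(1)])
qed

lemma root_function_dichotomy:
  assumes "root_function (hill_op \<sigma> v) w"
  shows "bilin w Y = 0 \<or> (\<exists>c. AE x in leb_pi. w x = c * Y x)"
  using assms pairing_other root_multiple unfolding root_function_def by metis

end

section \<open>Schauder bases\<close>

lemma finite_measure_leb_pi: "finite_measure leb_pi"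
  by (intro finite_measure_lebesgue_on) auto

lemma measure_leb_pi: "measure leb_pi {0..pi} = pi"
  by (simp add: measure_restrict_space)

section \<open>Elementary estimates in the space of square-integrable functions\<close>

lemma L2_cont: "continuous_on {0..pi} h \<Longrightarrow> h \<in> L2_pi"
proof -
  assume h: "continuous_on {0..pi} h"
  have "continuous_on {0..pi} (\<lambda>x. (cmod (h x))\<^sup>2)" by (intro continuous_intros h)
  then have "integrable leb_pi (\<lambda>x. (cmod (h x))\<^sup>2)" by (rule continuous_imp_integrable_real)
  then show ?thesis using cont_meas[OF h] by (simp add: L2_pi_def)
qed

lemma cmod_add_sq: "(cmod (x + y))\<^sup>2 \<le> 2 * (cmod x)\<^sup>2 + 2 * (cmod y)\<^sup>2"
proof -
  have "(cmod (x + y))\<^sup>2 \<le> (cmod x + cmod y)\<^sup>2" by (intro power_mono norm_triangle_ineq) auto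
  also have "\<dots> \<le> 2 * (cmod x)\<^sup>2 + 2 * (cmod y)\<^sup>2"
    using zero_le_power2[of "cmod x - cmod y"] by (simp add: power2_eq_square algebra_simps)
  finally show ?thesis .
qed

lemma L2_add: "f \<in> L2_pi \<Longrightarrow> h \<in> L2_pi \<Longrightarrow> (\<lambda>x. f x + h x) \<in> L2_pi"
proof -
  assume fh: "f \<in> L2_pi" "h \<in> L2_pi"
  have "integrable leb_pi (\<lambda>x. (cmod (f x + h x))\<^sup>2)"
  proof (rule Bochner_Integration.integrable_bound)
    show "integrable leb_pi (\<lambda>x. 2 * (cmod (f x))\<^sup>2 + 2 * (cmod (h x))\<^sup>2)" using fh by (auto simp: L2_pi_def)
    show "(\<lambda>x. (cmod (f x + h x))\<^sup>2) \<in> borel_measurable leb_pi"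
      using fh[THEN L2_meas] by measurable
    show "AE x in leb_pi. norm ((cmod (f x + h x))\<^sup>2) \<le> norm (2 * (cmod (f x))\<^sup>2 + 2 * (cmod (h x))\<^sup>2)"
      using cmod_add_sq by (intro AE_I2) auto
  qed
  then show ?thesis using fh by (auto simp: L2_pi_def)
qed

lemma L2_scale: "f \<in> L2_pi \<Longrightarrow> (\<lambda>x. c * f x) \<in> L2_pi"
  by (auto simp: L2_pi_def norm_mult power_mult_distrib)

lemma L2_diff: "f \<in> L2_pi \<Longrightarrow> h \<in> L2_pi \<Longrightarrow> (\<lambda>x. f x - h x) \<in> L2_pi"
  using L2_add[of f "\<lambda>x. -1 * h x"] L2_scale[of h "-1"] by simp

lemma L2_sum: "(\<And>i. i < N \<Longrightarrow> f i \<in> L2_pi) \<Longrightarrow> (\<lambda>x. \<Sum>i<N. f i x) \<in> L2_pi" for N :: nat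
proof (induction N)
  case 0
  show ?case by (simp add: L2_cont)
next
  case (Suc N)
  then show ?case using L2_add[of "\<lambda>x. \<Sum>i<N. f i x" "f N"] by simp
qed

lemma L2_norm_sq: "(L2_norm_pi f)\<^sup>2 = (LINT x|leb_pi. (cmod (f x))\<^sup>2)"
  unfolding L2_norm_pi_def by simp

lemma L2_norm_nonneg: "L2_norm_pi f \<ge> 0"
  unfolding L2_norm_pi_def by simp

lemma L2_norm_cong_AE:
  assumes "AE x in leb_pi. f x = h x" "f \<in> L2_pi" "h \<in> L2_pi"
  shows "L2_norm_pi f = L2_norm_pi h"
  unfolding L2_norm_pi_def using assms
  by (intro arg_cong[of _ _ sqrt] integral_cong_AE) (auto simp: L2_pi_def elim: eventually_mono)

lemma L2_norm_add_sq:
  assumes "f \<in> L2_pi" "h \<in> L2_pi"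
  shows "(L2_norm_pi (\<lambda>x. f x + h x))\<^sup>2 \<le> 2 * (L2_norm_pi f)\<^sup>2 + 2 * (L2_norm_pi h)\<^sup>2"
proof -
  have "(LINT x|leb_pi. (cmod (f x + h x))\<^sup>2) \<le> (LINT x|leb_pi. 2 * (cmod (f x))\<^sup>2 + 2 * (cmod (h x))\<^sup>2)"
    using assms L2_add[OF assms] cmod_add_sq by (intro integral_mono) (auto simp: L2_pi_def)
  then show ?thesis using assms by (simp add: L2_norm_sq L2_pi_def)
qed

text \<open>Young's inequality with parameter \<open>t\<close> replaces Cauchy-Schwarz; its constant
  \<open>(pi + 1) / 2\<close> is rounded up to 3. The \<open>e\<close> keeps the divisor
  \<open>t\<close> positive when the norm vanishes.\<close>

lemma L1_le_L2:
  assumes h: "h \<in> L2_pi"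
  shows "(LINT x|leb_pi. cmod (h x)) \<le> 3 * L2_norm_pi h"
proof (rule field_le_epsilon)
  fix e :: real assume e: "e > 0"
  interpret finite_measure leb_pi by (rule finite_measure_leb_pi)
  define t where "t = L2_norm_pi h + e / 3"
  have t: "t > 0" "L2_norm_pi h \<le> t" using e L2_norm_nonneg[of h] by (auto simp: t_def)
  have pt: "cmod w \<le> t / 2 + (cmod w)\<^sup>2 / (2 * t)" for w :: complex
  proof -
    have "2 * t * cmod w \<le> t\<^sup>2 + (cmod w)\<^sup>2"
      using zero_le_power2[of "t - cmod w"] by (simp add: power2_eq_square algebra_simps)
    then show ?thesis using t by (simp add: field_simps power2_eq_square)
  qed
  have "(LINT x|leb_pi. cmod (h x)) \<le> (LINT x|leb_pi. t / 2 + (cmod (h x))\<^sup>2 / (2 * t))"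
    using h L2_integrable[OF h] by (intro integral_mono pt) (auto simp: L2_pi_def)
  also have "\<dots> = t / 2 * pi + (L2_norm_pi h)\<^sup>2 / (2 * t)"
    using h by (subst Bochner_Integration.integral_add) (auto simp: L2_pi_def L2_norm_sq measure_leb_pi)
  also have "(L2_norm_pi h)\<^sup>2 / (2 * t) \<le> t\<^sup>2 / (2 * t)"
    using t L2_norm_nonneg by (intro divide_right_mono power_mono) auto
  also have "t / 2 * pi + t\<^sup>2 / (2 * t) = t * ((pi + 1) / 2)" using t by (simp add: field_simps power2_eq_square)
  also have "\<dots> \<le> t * 3" using t pi_less_4 by (intro mult_left_mono) auto
  finally show "(LINT x|leb_pi. cmod (h x)) \<le> 3 * L2_norm_pi h + e" by (simp add: t_def)
qed

lemma LINT_mult_bound: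
  assumes f: "integrable leb_pi f" and h: "continuous_on {0..pi} h" "\<And>x. x \<in> {0..pi} \<Longrightarrow> cmod (h x) \<le> C"
  shows "cmod (bilin f h) \<le> C * (LINT x|leb_pi. cmod (f x))"
proof -
  have "cmod (bilin f h) \<le> (LINT x|leb_pi. cmod (f x * h x))" by (rule integral_norm_bound)
  also have "\<dots> \<le> (LINT x|leb_pi. C * cmod (f x))"
  proof (rule integral_mono)
    show "integrable leb_pi (\<lambda>x. cmod (f x * h x))" using integrable_mult_cont[OF f h(1)] by (rule integrable_norm)
    show "integrable leb_pi (\<lambda>x. C * cmod (f x))" using f by simp
    fix x assume "x \<in> space leb_pi"
    then have "cmod (h x) * cmod (f x) \<le> C * cmod (f x)" by (intro mult_right_mono h(2)) auto
    then show "cmod (f x * h x) \<le> C * cmod (f x)" by (simp add: norm_mult mult.commute)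
  qed
  finally show ?thesis by simp
qed

lemma LINT_cont_bound:
  assumes h: "continuous_on {0..pi} h" "\<And>x. x \<in> {0..pi} \<Longrightarrow> cmod (h x) \<le> C"
  shows "cmod (LINT x|leb_pi. h x) \<le> pi * C"
proof -
  interpret finite_measure leb_pi by (rule finite_measure_leb_pi)
  have "cmod (LINT x|leb_pi. h x) \<le> (LINT x|leb_pi. cmod (h x))" by (rule integral_norm_bound)
  also have "\<dots> \<le> (LINT x|leb_pi. C)"
    using integrable_cont[OF h(1)] h(2) by (intro integral_mono) auto
  finally show ?thesis by (simp add: measure_leb_pi)
qed

text \<open>Pairing with a continuous function is continuous for the norm, so it may be applied to
  an expansion term by term.\<close>

lemma schauder_expansion_pairing:
  assumes eL: "\<And>i. e i \<in> L2_pi" and f: "f \<in> L2_pi"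
    and lim: "(\<lambda>N. L2_norm_pi (\<lambda>x. f x - (\<Sum>i<N. c i * e i x))) \<longlonglongrightarrow> 0"
    and Y: "continuous_on {0..pi} Y"
  shows "(\<lambda>i. c i * bilin (e i) Y) sums (bilin f Y)"
proof -
  obtain C where C: "C \<ge> 0" "\<And>x. x \<in> {0..pi} \<Longrightarrow> cmod (Y x) \<le> C" using cont_bounded[OF Y] by blast
  define r where "r N x = f x - (\<Sum>i<N. c i * e i x)" for N x
  have rL: "r N \<in> L2_pi" for N unfolding r_def by (intro L2_diff f L2_sum L2_scale eL)
  have fi: "integrable leb_pi (\<lambda>x. f x * Y x)" and ei: "integrable leb_pi (\<lambda>x. e i x * Y x)" for i
    using integrable_mult_cont[OF L2_integrable[OF f] Y] integrable_mult_cont[OF L2_integrable[OF eL] Y] by blast+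
  have rN: "bilin (r N) Y = bilin f Y - (\<Sum>i<N. c i * bilin (e i) Y)" for N
  proof -
    have "bilin (r N) Y = (LINT x|leb_pi. f x * Y x - (\<Sum>i<N. c i * (e i x * Y x)))"
      by (simp add: r_def left_diff_distrib sum_distrib_right mult.assoc)
    also have "\<dots> = bilin f Y - (LINT x|leb_pi. (\<Sum>i<N. c i * (e i x * Y x)))"
      by (intro Bochner_Integration.integral_diff fi Bochner_Integration.integrable_sum integrable_mult_right ei)
    also have "(LINT x|leb_pi. (\<Sum>i<N. c i * (e i x * Y x))) = (\<Sum>i<N. LINT x|leb_pi. c i * (e i x * Y x))"
      by (intro Bochner_Integration.integral_sum integrable_mult_right ei)
    finally show ?thesis by simp
  qed
  have le: "cmod (bilin (r N) Y) \<le> C * (3 * L2_norm_pi (r N))" for N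
    using LINT_mult_bound[OF L2_integrable[OF rL] Y C(2), of N] mult_left_mono[OF L1_le_L2[OF rL] C(1), of N] by linarith
  have "(\<lambda>N. L2_norm_pi (r N)) \<longlonglongrightarrow> 0" using lim unfolding r_def .
  then have "(\<lambda>N. C * (3 * L2_norm_pi (r N))) \<longlonglongrightarrow> C * (3 * 0)" by (intro tendsto_intros)
  then have lim0: "(\<lambda>N. C * (3 * L2_norm_pi (r N))) \<longlonglongrightarrow> 0" by simp
  have "(\<lambda>N. bilin (r N) Y) \<longlonglongrightarrow> 0"
    by (rule Lim_null_comparison[OF always_eventually[OF allI[OF le]] lim0])
  then have "(\<lambda>N. (bilin f Y) - bilin (r N) Y) \<longlonglongrightarrow> (bilin f Y) - 0"
    by (intro tendsto_intros)
  then show ?thesis unfolding sums_def rN by simp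
qed

text \<open>Each term is the difference of two consecutive remainders, and the remainders
  converge.\<close>

lemma schauder_terms_bounded:
  assumes eL: "\<And>i. e i \<in> L2_pi" and f: "f \<in> L2_pi"
    and lim: "(\<lambda>N. L2_norm_pi (\<lambda>x. f x - (\<Sum>i<N. c i * e i x))) \<longlonglongrightarrow> 0"
  obtains K where "\<And>i. L2_norm_pi (\<lambda>x. c i * e i x) \<le> K"
proof -
  define r where "r N x = f x - (\<Sum>i<N. c i * e i x)" for N x
  have rL: "r N \<in> L2_pi" for N unfolding r_def by (intro L2_diff f L2_sum L2_scale eL)
  have "Bseq (\<lambda>N. L2_norm_pi (r N))"
    using lim by (intro convergent_imp_Bseq) (auto simp: convergent_def r_def[abs_def])
  then obtain B where B: "B > 0" "\<And>N. norm (L2_norm_pi (r N)) \<le> B" unfolding Bseq_def by blast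
  have "L2_norm_pi (\<lambda>x. c i * e i x) \<le> 2 * B" for i
  proof (rule power2_le_imp_le)
    have "(\<lambda>x. c i * e i x) = (\<lambda>x. r i x + (- 1) * r (Suc i) x)" by (simp add: r_def fun_eq_iff)
    then have "(L2_norm_pi (\<lambda>x. c i * e i x))\<^sup>2 \<le> 2 * (L2_norm_pi (r i))\<^sup>2 + 2 * (L2_norm_pi (\<lambda>x. (- 1) * r (Suc i) x))\<^sup>2"
      by (simp only:) (intro L2_norm_add_sq rL L2_scale)
    also have "L2_norm_pi (\<lambda>x. (- 1) * r (Suc i) x) = L2_norm_pi (r (Suc i))" by (simp add: L2_norm_pi_def)
    also have "2 * (L2_norm_pi (r i))\<^sup>2 + 2 * (L2_norm_pi (r (Suc i)))\<^sup>2 \<le> 2 * B\<^sup>2 + 2 * B\<^sup>2"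
      using B(2)[of i] B(2)[of "Suc i"] L2_norm_nonneg by (intro add_mono mult_left_mono power_mono) auto
    finally show "(L2_norm_pi (\<lambda>x. c i * e i x))\<^sup>2 \<le> (2 * B)\<^sup>2" by (simp add: power2_eq_square)
  qed (use B in auto)
  then show thesis by (rule that)
qed

text \<open>Two proportional members give 0 a second expansion, with the coefficients
  \<open>\<kappa>'\<close> and \<open>- \<kappa>\<close> at \<open>i\<close> and
  \<open>j\<close>.\<close>

lemma basis_not_proportional:
  assumes basis: "schauder_basis_L2 e" and ij: "i \<noteq> j"
    and i: "AE x in leb_pi. e i x = \<kappa> * Y x" and j: "AE x in leb_pi. e j x = \<kappa>' * Y x"
    and nz: "\<kappa> \<noteq> 0"
  shows False
proof -
  define d where "d k = (if k = i then \<kappa>' else if k = j then - \<kappa> else 0)" for k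
  have eL: "e k \<in> L2_pi" for k using basis by (simp add: schauder_basis_L2_def)
  have z: "(\<lambda>x. 0) \<in> L2_pi" by (rule L2_cont) auto
  define Z where "Z c \<longleftrightarrow> (\<lambda>N. L2_norm_pi (\<lambda>x. 0 - (\<Sum>k<N. c k * e k x))) \<longlonglongrightarrow> 0" for c
  have "\<forall>f\<in>L2_pi. \<exists>!c. (\<lambda>N. L2_norm_pi (\<lambda>x. f x - (\<Sum>k<N. c k * e k x))) \<longlonglongrightarrow> 0"
    using basis unfolding schauder_basis_L2_def by (rule conjunct2)
  from bspec[OF this z] have "Ex1 Z" unfolding Z_def .
  moreover have "Z (\<lambda>_. 0)"
    unfolding Z_def by (simp add: L2_norm_pi_def)
  moreover have "Z d"
    unfolding Z_def
  proof (rule tendsto_eventually, rule eventually_mono[OF eventually_gt_at_top[of "max i j"]])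
    fix N assume "max i j < N"
    then have N: "i < N" "j < N" by auto
    have s: "(\<Sum>k<N. d k * e k x) = \<kappa>' * e i x - \<kappa> * e j x" for x
    proof -
      have "(\<Sum>k<N. d k * e k x) = (\<Sum>k\<in>{i,j}. d k * e k x)"
        using N by (intro sum.mono_neutral_right) (auto simp: d_def)
      then show ?thesis using ij by (simp add: d_def)
    qed
    have "L2_norm_pi (\<lambda>x. 0 - (\<Sum>k<N. d k * e k x)) = L2_norm_pi (\<lambda>x. 0)"
    proof (rule L2_norm_cong_AE)
      show "AE x in leb_pi. 0 - (\<Sum>k<N. d k * e k x) = 0"
        using i j by eventually_elim (simp add: s)
    qed (intro L2_diff z L2_sum L2_scale eL)+
    then show "L2_norm_pi (\<lambda>x. 0 - (\<Sum>k<N. d k * e k x)) = 0" by (simp add: L2_norm_pi_def)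
  qed
  ultimately have "d = (\<lambda>_. 0)" by blast
  then have "d j = 0" by (rule fun_cong)
  then show False using ij nz by (simp add: d_def split: if_splits)
qed

text \<open>\<open>P\<close> stands for being a root function; the last clause is all that the basis
  argument sees of the operator.\<close>

definition asym_mode :: "((real \<Rightarrow> complex) \<Rightarrow> bool) \<Rightarrow> real \<Rightarrow> int \<Rightarrow> (real \<Rightarrow> complex) \<Rightarrow> bool" where
  "asym_mode P \<epsilon> m Y \<longleftrightarrow> continuous_on {0..pi} Y \<and> (\<forall>x\<in>{0..pi}. cmod (Y x - expi m x) \<le> \<epsilon>) \<and>
     (bilin Y Y) \<noteq> 0 \<and>
     (\<forall>w. P w \<longrightarrow> (bilin w Y) = 0 \<or> (\<exists>c. AE x in leb_pi. w x = c * Y x))"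

text \<open>At most one basis member pairs nontrivially with \<open>Y\<close>, since such members
  are multiples of \<open>Y\<close> and no two can be proportional. Its term in the expansion of
  \<open>f\<close> is bounded in norm and \<open>cmod (Y x) \<ge> 1/2\<close>, so \<open>K\<close>
  depends on \<open>f\<close> but not on the mode.\<close>

lemma basis_pairing_bound:
  assumes basis: "schauder_basis_L2 e" and P: "\<And>i. P (e i)"
    and f: "f \<in> L2_pi"
  obtains K where "\<And>\<epsilon> m Y. asym_mode P \<epsilon> m Y \<Longrightarrow> \<epsilon> \<le> 1/2 \<Longrightarrow>
    cmod (bilin f Y) \<le> K * cmod (bilin Y Y)"
proof -
  have eL: "e k \<in> L2_pi" for k using basis by (simp add: schauder_basis_L2_def)
  obtain c where c: "(\<lambda>N. L2_norm_pi (\<lambda>x. f x - (\<Sum>i<N. c i * e i x))) \<longlonglongrightarrow> 0"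
    using basis f unfolding schauder_basis_L2_def by blast
  obtain K where K: "\<And>i. L2_norm_pi (\<lambda>x. c i * e i x) \<le> K"
    using schauder_terms_bounded[OF eL f c] by blast
  have K0: "K \<ge> 0" using order_trans[OF L2_norm_nonneg K[of 0]] .
  show thesis
  proof (rule that[of "2 * K"])
    fix \<epsilon> m Y assume Y: "asym_mode P \<epsilon> m Y" and \<epsilon>: "\<epsilon> \<le> 1/2"
    have Yc: "continuous_on {0..pi} Y" using Y by (simp add: asym_mode_def)
    have multiple: "bilin (e i) Y = 0 \<or> (\<exists>c. AE x in leb_pi. e i x = c * Y x)" for i
      using Y P[of i] unfolding asym_mode_def by blast
    have pair: "(\<lambda>i. c i * bilin (e i) Y) sums (bilin f Y)"
      by (rule schauder_expansion_pairing[OF eL f c Yc])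
    show "cmod (bilin f Y) \<le> 2 * K * cmod (bilin Y Y)"
    proof (cases "\<forall>i. (bilin (e i) Y) = 0")
      case True
      then have "(\<lambda>i. c i * bilin (e i) Y) sums 0" by simp
      then have "bilin f Y = 0" by (rule sums_unique2[OF pair])
      then show ?thesis using K0 by simp
    next
      case False
      then obtain k where k: "bilin (e k) Y \<noteq> 0" by blast
      then obtain \<kappa> where \<kappa>: "AE x in leb_pi. e k x = \<kappa> * Y x"
        using multiple[of k] by blast
      have ek: "bilin (e k) Y = \<kappa> * bilin Y Y"
      proof -
        have "bilin (e k) Y = (LINT x|leb_pi. \<kappa> * (Y x * Y x))"
        proof (rule integral_cong_AE)
          show "AE x in leb_pi. e k x * Y x = \<kappa> * (Y x * Y x)" using \<kappa> by eventually_elim simp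
        qed (use integrable_mult_cont[OF L2_integrable[OF eL] Yc] integrable_mult_cont[OF integrable_cont[OF Yc] Yc] in auto)
        then show ?thesis by simp
      qed
      have \<kappa>0: "\<kappa> \<noteq> 0" using k ek by auto
      have other: "bilin (e i) Y = 0" if "i \<noteq> k" for i
      proof (rule ccontr)
        assume "bilin (e i) Y \<noteq> 0"
        then obtain \<kappa>' where "AE x in leb_pi. e i x = \<kappa>' * Y x"
          using multiple[of i] by blast
        then show False using basis_not_proportional[OF basis that[symmetric] \<kappa> _ \<kappa>0] by blast
      qed
      have "(\<lambda>i. c i * bilin (e i) Y) sums (c k * bilin (e k) Y)"
        using sums_single[of k "\<lambda>i. c i * bilin (e i) Y"]
        by (rule sums_cong[THEN iffD1, rotated]) (use other in auto)
      then have fY: "bilin f Y = (c k * \<kappa>) * bilin Y Y"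
        using sums_unique2[OF pair] ek by simp
      have "cmod (c k * \<kappa>) * (1/2) \<le> K"
      proof (rule order_trans[OF power2_le_imp_le K[of k]])
        interpret finite_measure leb_pi by (rule finite_measure_leb_pi)
        have "cmod (c k * \<kappa>) * (1/2) \<le> cmod (c k * \<kappa> * Y x)" if "x \<in> {0..pi}" for x
        proof -
          have "cmod (Y x - expi m x) \<le> 1/2" using Y that \<epsilon> unfolding asym_mode_def by force
          then have "1/2 \<le> cmod (Y x)" using norm_triangle_ineq2[of "expi m x" "Y x"] by (simp add: norm_minus_commute)
          then show ?thesis by (simp only: norm_mult[of "c k * \<kappa>"]) (intro mult_left_mono, auto)
        qed
        moreover have YL: "(\<lambda>x. c k * \<kappa> * Y x) \<in> L2_pi" by (intro L2_cont continuous_intros Yc)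
        ultimately have "(LINT x|leb_pi. (cmod (c k * \<kappa>) * (1/2))\<^sup>2) \<le> (LINT x|leb_pi. (cmod (c k * \<kappa> * Y x))\<^sup>2)"
          using YL by (intro integral_mono power_mono) (auto simp: L2_pi_def)
        moreover have "(LINT x|leb_pi. (cmod (c k * \<kappa>) * (1/2))\<^sup>2) \<ge> (cmod (c k * \<kappa>) * (1/2))\<^sup>2"
          using pi_gt3 by (simp add: measure_leb_pi mult_le_cancel_right1)
        moreover have "L2_norm_pi (\<lambda>x. c k * \<kappa> * Y x) = L2_norm_pi (\<lambda>x. c k * e k x)"
        proof (rule L2_norm_cong_AE)
          show "AE x in leb_pi. c k * \<kappa> * Y x = c k * e k x" using \<kappa> by eventually_elim simp
        qed (intro L2_cont continuous_intros Yc L2_scale eL)+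
        ultimately show "(cmod (c k * \<kappa>) * (1/2))\<^sup>2 \<le> (L2_norm_pi (\<lambda>x. c k * e k x))\<^sup>2"
          by (simp add: L2_norm_sq[symmetric])
      qed (rule L2_norm_nonneg)
      then show ?thesis unfolding fY norm_mult[of "c k * \<kappa>"] by (intro mult_right_mono) auto
    qed
  qed
qed

text \<open>The square of a nonconstant exponential integrates to 0 over \<open>{0..pi}\<close>;
  only the deviation of \<open>Y\<close> from it contributes.\<close>

lemma asym_mode_square:
  assumes "asym_mode P \<epsilon> m Y" "\<epsilon> \<le> 1/2" "m \<noteq> 0"
  shows "cmod (bilin Y Y) \<le> 3 * pi * \<epsilon>"
proof -
  have Yc: "continuous_on {0..pi} Y" and Ye: "\<And>x. x \<in> {0..pi} \<Longrightarrow> cmod (Y x - expi m x) \<le> \<epsilon>"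
    using assms by (auto simp: asym_mode_def)
  have "(LINT x|leb_pi. expi m x * expi m x) = 0" using hat_expi[of m m] assms(3) by (simp add: hat_def)
  moreover have "(LINT x|leb_pi. Y x * Y x - expi m x * expi m x) = bilin Y Y - (LINT x|leb_pi. expi m x * expi m x)"
    by (intro Bochner_Integration.integral_diff integrable_cont continuous_intros Yc)
  ultimately have "cmod (bilin Y Y) = cmod (LINT x|leb_pi. Y x * Y x - expi m x * expi m x)" by simp
  also have "\<dots> \<le> pi * (3 * \<epsilon>)"
  proof (rule LINT_cont_bound)
    fix x assume x: "x \<in> {0..pi}"
    have "cmod (Y x + expi m x) = cmod ((Y x - expi m x) + 2 * expi m x)" by (simp add: algebra_simps)
    also have "\<dots> \<le> \<epsilon> + 2" using Ye[OF x] norm_triangle_ineq[of "Y x - expi m x" "2 * expi m x"] by (simp add: norm_mult)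
    also have "\<dots> \<le> 3" using assms(2) by simp
    finally have "cmod (Y x - expi m x) * cmod (Y x + expi m x) \<le> \<epsilon> * 3"
      using Ye[OF x] by (intro mult_mono) (auto intro: order_trans[OF norm_ge_zero])
    then show "cmod (Y x * Y x - expi m x * expi m x) \<le> 3 * \<epsilon>"
      by (simp add: square_diff_square_factored norm_mult mult.commute)
  qed (intro continuous_intros Yc)
  finally show ?thesis by simp
qed

text \<open>A gliding hump: the terms of the expansion of \<open>f = \<Sum> 2\<^sup>-\<^sup>i expi (-m\<^sub>i)\<close> along the modes
  \<open>Y\<^sub>i \<approx> expi m\<^sub>i\<close> are unbounded because the pairings of \<open>Y\<^sub>i\<close> with itself are tiny.\<close>

theorem no_schauder_basis:
  assumes modes: "\<And>\<epsilon> N. \<epsilon> > 0 \<Longrightarrow> \<exists>m Y. N \<le> \<bar>m\<bar> \<and> even (m + d) \<and> asym_mode P \<epsilon> m Y"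
  shows "\<nexists>e. schauder_basis_L2 e \<and> (\<forall>i. P (e i))"
proof
  assume "\<exists>e. schauder_basis_L2 e \<and> (\<forall>i. P (e i))"
  then obtain e where basis: "schauder_basis_L2 e" and P: "\<And>i. P (e i)" by blast
  \<comment> \<open>The coefficients of \<open>f\<close> decay like \<open>2^-j\<close> and the
    self-pairings like \<open>8^-j\<close>, so their quotient grows like \<open>4^j\<close>. The
    divisor 4 keeps the approximation error at most half of the main term.\<close>
  define \<epsilon> where "\<epsilon> i = (1/8) ^ i / (4::real)" for i :: nat
  have \<epsilon>: "\<epsilon> i > 0" "\<epsilon> i \<le> 1/2" for i
    using power_le_one[of "1/8::real" i] by (auto simp: \<epsilon>_def)
  \<comment> \<open>The frequencies are chosen with increasing absolute values, hence distinct, as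
    the orthogonality in \<open>f_expi\<close> requires.\<close>
  have "\<exists>s. \<forall>i. (1 \<le> \<bar>fst (s i)\<bar> \<and> even (fst (s i) + d) \<and> asym_mode P (\<epsilon> i) (fst (s i)) (snd (s i)))
     \<and> \<bar>fst (s i)\<bar> < \<bar>fst (s (Suc i))\<bar>"
  proof (rule dependent_nat_choice)
    show "\<exists>s. 1 \<le> \<bar>fst s\<bar> \<and> even (fst s + d) \<and> asym_mode P (\<epsilon> 0) (fst s) (snd s)"
      using modes[OF \<epsilon>(1), of 1 0] by auto
    fix s :: "int \<times> (real \<Rightarrow> complex)" and i
    show "\<exists>t. (1 \<le> \<bar>fst t\<bar> \<and> even (fst t + d) \<and> asym_mode P (\<epsilon> (Suc i)) (fst t) (snd t)) \<and> \<bar>fst s\<bar> < \<bar>fst t\<bar>"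
    proof -
      obtain m Y where "\<bar>fst s\<bar> + 1 \<le> \<bar>m\<bar> \<and> even (m + d) \<and> asym_mode P (\<epsilon> (Suc i)) m Y"
        using modes[OF \<epsilon>(1)] by blast
      then show ?thesis by (intro exI[of _ "(m, Y)"]) auto
    qed
  qed
  then obtain s where s: "\<And>i. 1 \<le> \<bar>fst (s i)\<bar>" "\<And>i. even (fst (s i) + d)" "\<And>i. asym_mode P (\<epsilon> i) (fst (s i)) (snd (s i))"
     "\<And>i. \<bar>fst (s i)\<bar> < \<bar>fst (s (Suc i))\<bar>" by blast
  define m where "m i = fst (s i)" for i
  define Y where "Y i = snd (s i)" for i
  have mY: "asym_mode P (\<epsilon> i) (m i) (Y i)" "m i \<noteq> 0" "even (m i + d)" for i
    using s(1)[of i] s(2)[of i] s(3)[of i] by (auto simp: m_def Y_def)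
  have "strict_mono (\<lambda>i. \<bar>m i\<bar>)" unfolding m_def by (intro strict_mono_Suc_iff[THEN iffD2]) (use s(4) in auto)
  then have minj: "m i = m j \<longleftrightarrow> i = j" for i j by (metis strict_mono_eq)
  \<comment> \<open>The frequency \<open>- m i\<close> is the one that the bilinear pairing with
    \<open>expi (m i)\<close> picks out.\<close>
  define t where "t i x = of_real ((1/2) ^ i) * expi (- m i) x" for i x
  have nt: "cmod (t i x) = (1/2) ^ i" for i x by (simp add: t_def norm_mult norm_power)
  have sg: "summable (\<lambda>i. (1/2::real) ^ i)" by (intro summable_geometric) auto
  define f where "f x = (\<Sum>i. t i x)" for x
  have tc: "continuous_on {0..pi} (t i)" for i unfolding t_def[abs_def] by (intro continuous_intros)
  have fc: "continuous_on {0..pi} f"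
  proof -
    have "uniform_limit {0..pi} (\<lambda>N x. \<Sum>i<N. t i x) (\<lambda>x. \<Sum>i. t i x) sequentially"
      by (rule Weierstrass_m_test[OF _ sg]) (simp add: nt)
    then have "continuous_on {0..pi} (\<lambda>x. \<Sum>i. t i x)"
      by (rule uniform_limit_theorem[rotated]) (auto intro!: always_eventually continuous_intros tc)
    then show ?thesis by (simp add: f_def[abs_def])
  qed
  have st: "summable (\<lambda>i. norm (t i x))" for x by (simp add: nt sg)
  have fb: "cmod (f x) \<le> 2" for x
    using summable_norm[OF st[of x]] suminf_geometric[of "1/2::real"] by (simp add: f_def nt)
  have f_expi: "(LINT x|leb_pi. f x * expi (m j) x) = of_real ((1/2) ^ j * pi)" for j
  proof -
    have ti: "integrable leb_pi (\<lambda>x. t i x * expi (m j) x)" for i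
      by (intro integrable_cont continuous_intros tc)
    interpret finite_measure leb_pi by (rule finite_measure_leb_pi)
    have "(LINT x|leb_pi. (\<Sum>i. t i x * expi (m j) x)) = (\<Sum>i. LINT x|leb_pi. t i x * expi (m j) x)"
      by (rule integral_suminf[OF ti]) (simp_all add: norm_mult nt sg summable_mult2 measure_leb_pi)
    moreover have "(\<Sum>i. t i x * expi (m j) x) = f x * expi (m j) x" for x
      unfolding f_def by (rule suminf_mult2[symmetric, OF summable_norm_cancel[OF st]])
    moreover have "(LINT x|leb_pi. t i x * expi (m j) x) = (if i = j then of_real ((1/2) ^ j * pi) else 0)" for i
    proof -
      have "even (- m i + m j)" using mY(3)[of i] mY(3)[of j] by presburger
      from hat_expi[OF this] have "hat (expi (- m i)) (m j) = (if i = j then of_real pi else 0)"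
        using minj[of i j] by auto
      moreover have "(LINT x|leb_pi. t i x * expi (m j) x) = of_real ((1/2) ^ i) * hat (expi (- m i)) (m j)"
        by (simp add: t_def hat_def mult.assoc)
      ultimately show ?thesis by simp
    qed
    ultimately have "(LINT x|leb_pi. f x * expi (m j) x) = (\<Sum>i. if i = j then of_real ((1/2) ^ j * pi) else 0)"
      by simp
    also have "\<dots> = of_real ((1/2) ^ j * pi)"
      using sums_single[of j "\<lambda>_. complex_of_real ((1/2) ^ j * pi)"] by (rule sums_unique[symmetric])
    finally show ?thesis .
  qed
  obtain K where K: "\<And>\<epsilon> m Y. asym_mode P \<epsilon> m Y \<Longrightarrow> \<epsilon> \<le> 1/2 \<Longrightarrow>
    cmod (bilin f Y) \<le> K * cmod (bilin Y Y)"
    by (rule basis_pairing_bound[where P=P and e=e and f=f]) (use basis P L2_cont[OF fc] in blast)+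
  have "4 ^ j * 2 \<le> 3 * \<bar>K\<bar>" for j
  proof -
    have Yc: "continuous_on {0..pi} (Y j)" and Ye: "\<And>x. x \<in> {0..pi} \<Longrightarrow> cmod (Y j x - expi (m j) x) \<le> \<epsilon> j"
      using mY(1)[of j] by (auto simp: asym_mode_def)
    have "cmod (LINT x|leb_pi. f x * expi (m j) x - f x * Y j x) \<le> pi * (2 * \<epsilon> j)"
    proof (rule LINT_cont_bound)
      fix x assume x: "x \<in> {0..pi}"
      have "cmod (f x * expi (m j) x - f x * Y j x) = cmod (f x) * cmod (Y j x - expi (m j) x)"
        using norm_minus_commute[of "Y j x" "expi (m j) x"] by (simp flip: right_diff_distrib add: norm_mult)
      also have "\<dots> \<le> 2 * \<epsilon> j" using fb Ye[OF x] by (intro mult_mono) auto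
      finally show "cmod (f x * expi (m j) x - f x * Y j x) \<le> 2 * \<epsilon> j" .
    qed (intro continuous_intros fc Yc)
    moreover have "(LINT x|leb_pi. f x * expi (m j) x - f x * Y j x) = of_real ((1/2) ^ j * pi) - bilin f (Y j)"
      unfolding f_expi[symmetric]
      by (intro Bochner_Integration.integral_diff integrable_cont continuous_intros fc Yc)
    ultimately have "cmod (of_real ((1/2) ^ j * pi)) - cmod (bilin f (Y j)) \<le> pi * (2 * \<epsilon> j)"
      by (metis norm_triangle_ineq2 order_trans)
    then have "(1/2) ^ j * pi \<le> pi * (2 * \<epsilon> j) + cmod (bilin f (Y j))"
      by (simp add: norm_mult norm_power)
    also have "cmod (bilin f (Y j)) \<le> \<bar>K\<bar> * (3 * pi * \<epsilon> j)"
      using K[OF mY(1) \<epsilon>(2), of j] asym_mode_square[OF mY(1) \<epsilon>(2) mY(2), of j]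
      by (smt (verit) mult_mono norm_ge_zero abs_ge_zero abs_ge_self)
    finally have "pi * (1/2) ^ j \<le> pi * (2 * \<epsilon> j + 3 * \<bar>K\<bar> * \<epsilon> j)" by (simp add: algebra_simps)
    then have "(1/2) ^ j \<le> 2 * \<epsilon> j + 3 * \<bar>K\<bar> * \<epsilon> j" by simp
    then have "(1/2) ^ j * 8 ^ j \<le> (2 * \<epsilon> j + 3 * \<bar>K\<bar> * \<epsilon> j) * (8::real) ^ j" by (intro mult_right_mono) auto
    moreover have "(1/2) ^ j * 8 ^ j = (4::real) ^ j" by (simp flip: power_mult_distrib)
    moreover have "\<epsilon> j * 8 ^ j = 1/4" by (simp add: \<epsilon>_def flip: power_mult_distrib)
    then have "(2 * \<epsilon> j + 3 * \<bar>K\<bar> * \<epsilon> j) * 8 ^ j = 2 * (1/4) + 3 * \<bar>K\<bar> * (1/4)"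
      by (simp only: distrib_right mult.assoc)
    ultimately have "4 ^ j \<le> 1/2 + 3 * \<bar>K\<bar> / 4" by simp
    moreover have "1 \<le> (4::real) ^ j" by simp
    ultimately show ?thesis by linarith
  qed
  moreover obtain j where "3 * \<bar>K\<bar> < (4::real) ^ j" using real_arch_pow[of 4 "3 * \<bar>K\<bar>"] by auto
  ultimately show False by (smt (verit) zero_le_power)
qed

text \<open>The parity of \<open>d\<close> encodes the boundary condition, and
  \<open>n = R * S * j\<close> has to share it. Even \<open>j\<close> serve \<open>d = 0\<close>;
  for \<open>d = 1\<close> all of \<open>R\<close>, \<open>S\<close> and \<open>j\<close> must be
  odd, which is where the antiperiodic case needs its restriction.\<close>

lemma no_basis_hill:
  fixes R S :: nat and a b :: complex and d :: nat
  assumes "1 \<le> R" "1 \<le> S" "R \<noteq> S" "a \<noteq> 0" "b \<noteq> 0"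
    and v: "v = (\<lambda>x. a * exp (- 2 * \<i> * of_nat R * of_real x) + b * exp (2 * \<i> * of_nat S * of_real x))"
    and parity: "\<And>j0. \<exists>j\<ge>j0. even (R * S * j + d)"
    and \<sigma>: "\<sigma> = expi (int d) pi"
  shows "\<nexists>e. schauder_basis_L2 e \<and> (\<forall>i. root_function (hill_op \<sigma> v) (e i))"
proof (rule no_schauder_basis[where d="int d"])
  fix \<epsilon> :: real and N :: int assume "\<epsilon> > 0"
  then obtain j0 where j0: "\<And>j. j \<ge> j0 \<Longrightarrow> \<exists>k0\<in>{0, int (R * S * j)}. good_mode R S a b (R * S * j) k0 \<epsilon>"
    using good_modes[OF assms(1-5)] unfolding eventually_sequentially by blast
  obtain j where j: "j \<ge> max j0 (nat N)" "even (R * S * j + d)" using parity by blast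
  define n where "n = R * S * j"
  have n: "N \<le> int n"
  proof -
    have "1 * j \<le> n" unfolding n_def using assms(1,2) by (intro mult_right_mono) (simp_all add: Suc_le_eq)
    then show ?thesis using j(1) by auto
  qed
  obtain k0 where k0: "k0 = 0 \<or> k0 = int n" "good_mode R S a b n k0 \<epsilon>" using j0[of j] j(1) by (auto simp: n_def)
  then obtain z y where y: "y k0 = 1" "abs_summable y" "hill_rec R S a b n z y"
     "infsum (\<lambda>k. cmod (y k)) (-{k0}) \<le> \<epsilon>" "self_conv n y \<noteq> 0"
     "\<And>w. hill_rec R S a b n z w \<Longrightarrow> bounded (range w) \<Longrightarrow> \<exists>c. \<forall>k. w k = c * y k"
    unfolding good_mode_def by blast
  have par: "even n = even d" using j(2) by (simp add: n_def)
  interpret hill_mode R S a b v \<sigma> n z y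
  proof
    show "\<sigma> = expi (int n) pi" using par by (simp add: \<sigma> expi_pi)
  qed (use v y in auto)
  let ?m = "2 * k0 - int n"
  have "asym_mode (root_function (hill_op \<sigma> v)) \<epsilon> ?m Y"
    unfolding asym_mode_def
    using Y_cont Y_square root_function_dichotomy trig_sum_close[OF y(2,1,4)] unfolding Y_def by blast
  moreover have "N \<le> \<bar>?m\<bar>" using n k0(1) by auto
  moreover have "even (?m + int d)" using par by auto
  ultimately show "\<exists>m Y. N \<le> \<bar>m\<bar> \<and> even (m + int d) \<and> asym_mode (root_function (hill_op \<sigma> v)) \<epsilon> m Y" by blast
qed

theorem theorem11:
  fixes R S :: nat and a b :: complex and v :: "real \<Rightarrow> complex"
  assumes "R \<ge> 1" and "S \<ge> 1" and "R \<noteq> S" and "a \<noteq> 0" and "b \<noteq> 0"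
    and "v = (\<lambda>x. a * exp (- 2 * \<i> * of_nat R * of_real x) + b * exp (2 * \<i> * of_nat S * of_real x))"
  shows "(\<nexists>e. schauder_basis_L2 e \<and> (\<forall>n. root_function (hill_per_plus v) (e n))) \<and>
    (odd R \<and> odd S \<longrightarrow>
      (\<nexists>e. schauder_basis_L2 e \<and> (\<forall>n. root_function (hill_per_minus v) (e n))))"
proof (intro conjI impI)
  show "\<nexists>e. schauder_basis_L2 e \<and> (\<forall>n. root_function (hill_per_plus v) (e n))"
  proof (rule no_basis_hill[OF assms, where d=0])
    show "\<exists>j\<ge>j0. even (R * S * j + 0)" for j0 by (rule exI[of _ "2 * j0"]) auto
  qed simp
  assume odd: "odd R \<and> odd S"
  show "\<nexists>e. schauder_basis_L2 e \<and> (\<forall>n. root_function (hill_per_minus v) (e n))"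
  proof (rule no_basis_hill[OF assms, where d=1])
    show "\<exists>j\<ge>j0. even (R * S * j + 1)" for j0 using odd by (intro exI[of _ "2 * j0 + 1"]) auto
  qed (simp add: expi_pi)
qed

end
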